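(* Let $X$ be a finite CW complex, $f:X\to X$ a cellular self-map, and $T_f=X\times[0,1]/\big((x,1)\sim(f(x),0)\big)$ its mapping torus. For every field $\Bbbk$, $$\mathcal P_{T_f,\Bbbk}(t)=(1+t)\,\mathcal F_{f,\Bbbk}(t).$$ Equivalently, $$(1+t)\,\mathcal P_{X,\Bbbk}(t)-\mathcal P_{T_f,\Bbbk}(t)=(1+t)\,\Delta_{f,\Bbbk}(t).$$
   Context: For a space $Y$ with finite-dimensional total homology, $\mathcal P_{Y,\Bbbk}(t)=\sum_j\dim_\Bbbk H_j(Y;\Bbbk)\,t^j$. Define $\nu_j(f;\Bbbk)=\dim_\Bbbk\ker\big(1-f_*:H_j(X;\Bbbk)\to H_j(X;\Bbbk)\big)$, $\mathcal F_{f,\Bbbk}(t)=\sum_j\nu_j(f;\Bbbk)t^j$, and $\Delta_{f,\Bbbk}(t)=\mathcal P_{X,\Bbbk}(t)-\mathcal F_{f,\Bbbk}(t)=\sum_j\operatorname{rank}(1-f_*|_{H_j(X;\Bbbk)})\,t^j$. *)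

theory Defs
  imports
    "HOL-Homology.Homology"
    "HOL-Computational_Algebra.Polynomial"
    "Jordan_Normal_Form.VS_Connect"
begin

section \<open>Finite CW complexes and cellular maps\<close>

definition closed_disc :: "nat \<Rightarrow> (nat \<Rightarrow> real) set"
  where "closed_disc n = {x \<in> topspace (Euclidean_space n). (\<Sum>i<n. x i ^ 2) \<le> 1}"

definition open_disc :: "nat \<Rightarrow> (nat \<Rightarrow> real) set"
  where "open_disc n = {x \<in> topspace (Euclidean_space n). (\<Sum>i<n. x i ^ 2) < 1}"

text \<open>
  A CW structure on \<open>X\<close> is a family of characteristic maps \<open>\<phi> i\<close>, for \<open>i \<in> I\<close>, defined on the
  closed disc of dimension \<open>d i\<close>.  The axioms are the intrinsic ones (Hausdorff, cells, closure
  finiteness, weak topology); the values of \<open>\<phi> i\<close> outside the disc are irrelevant.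
\<close>

locale cw_complex =
  fixes X :: "'a topology" and I :: "'i set" and d :: "'i \<Rightarrow> nat"
    and \<phi> :: "'i \<Rightarrow> (nat \<Rightarrow> real) \<Rightarrow> 'a"
  assumes hausdorff: "Hausdorff_space X"
    and characteristic_map: "i \<in> I \<Longrightarrow>
      continuous_map (subtopology (Euclidean_space (d i)) (closed_disc (d i))) X (\<phi> i)"
    and homeomorphism_onto_cell: "i \<in> I \<Longrightarrow>
      homeomorphic_map (subtopology (Euclidean_space (d i)) (open_disc (d i)))
        (subtopology X (\<phi> i ` open_disc (d i))) (\<phi> i)"
    and disjoint_cells: "disjoint_family_on (\<lambda>i. \<phi> i ` open_disc (d i)) I"
    and cells_cover: "(\<Union>i\<in>I. \<phi> i ` open_disc (d i)) = topspace X"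
    and closure_finite: "i \<in> I \<Longrightarrow>
      \<exists>J\<subseteq>I. finite J \<and> (\<forall>j\<in>J. d j < d i) \<and>
        \<phi> i ` (closed_disc (d i) - open_disc (d i)) \<subseteq> (\<Union>j\<in>J. \<phi> j ` open_disc (d j))"
    and weak_topology: "\<lbrakk>A \<subseteq> topspace X;
        \<And>i. i \<in> I \<Longrightarrow> closedin X (A \<inter> Abstract_Topology.closure_of X (\<phi> i ` open_disc (d i)))\<rbrakk> \<Longrightarrow> closedin X A"

locale finite_cw_complex = cw_complex +
  assumes finite_cells: "finite I"

definition skeleton ::
    "'i set \<Rightarrow> ('i \<Rightarrow> nat) \<Rightarrow> ('i \<Rightarrow> (nat \<Rightarrow> real) \<Rightarrow> 'a) \<Rightarrow> nat \<Rightarrow> 'a set"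
  where "skeleton I d \<phi> n = (\<Union>i\<in>{i \<in> I. d i \<le> n}. \<phi> i ` open_disc (d i))"

definition cellular_self_map ::
    "'a topology \<Rightarrow> 'i set \<Rightarrow> ('i \<Rightarrow> nat) \<Rightarrow> ('i \<Rightarrow> (nat \<Rightarrow> real) \<Rightarrow> 'a) \<Rightarrow> ('a \<Rightarrow> 'a) \<Rightarrow> bool"
  where "cellular_self_map X I d \<phi> f \<longleftrightarrow>
    continuous_map X X f \<and> (\<forall>n. f ` skeleton I d \<phi> n \<subseteq> skeleton I d \<phi> n)"


section \<open>Quotient topologies and the mapping torus\<close>

definition quotient_topology :: "'a topology \<Rightarrow> ('a \<times> 'a) set \<Rightarrow> 'a set topology"
  where "quotient_topology X R =
    topology (\<lambda>U. U \<subseteq> topspace X // R \<and> openin X (\<Union>U))"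

lemma openin_quotient_topology:
  assumes R: "equiv (topspace X) R"
  shows "openin (quotient_topology X R) U \<longleftrightarrow> U \<subseteq> topspace X // R \<and> openin X (\<Union>U)"
proof -
  have "istopology (\<lambda>U. U \<subseteq> topspace X // R \<and> openin X (\<Union>U))"
    unfolding istopology_def
  proof (intro conjI allI impI; (elim conjE)?)
    fix S T
    assume S: "S \<subseteq> topspace X // R" "openin X (\<Union>S)" and T: "T \<subseteq> topspace X // R" "openin X (\<Union>T)"
    have "\<Union>(S \<inter> T) = \<Union>S \<inter> \<Union>T"
    proof
      show "\<Union>S \<inter> \<Union>T \<subseteq> \<Union>(S \<inter> T)"
      proof
        fix x assume "x \<in> \<Union>S \<inter> \<Union>T"
        then obtain s t where st: "s \<in> S" "t \<in> T" "x \<in> s" "x \<in> t" by blast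
        then have "s = t"
          using quotient_disj[OF R, of s t] S T by blast
        then show "x \<in> \<Union>(S \<inter> T)" using st by blast
      qed
    qed blast
    then show "openin X (\<Union>(S \<inter> T))" using S T by auto
    show "S \<inter> T \<subseteq> topspace X // R" using S by blast
  next
    fix K
    assume K: "\<forall>U\<in>K. U \<subseteq> topspace X // R \<and> openin X (\<Union>U)"
    then show "\<Union>K \<subseteq> topspace X // R" by blast
    have "\<Union>(\<Union>K) = (\<Union>U\<in>K. \<Union>U)" by blast
    then show "openin X (\<Union>(\<Union>K))" using K by auto
  qed
  then show ?thesis
    unfolding quotient_topology_def by simp
qed

lemma topspace_quotient_topology:
  assumes R: "equiv (topspace X) R"
  shows "topspace (quotient_topology X R) = topspace X // R"
proof -
  have "openin (quotient_topology X R) (topspace X // R)"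
    unfolding openin_quotient_topology[OF R] Union_quotient[OF R] by simp
  then show ?thesis
    by (meson openin_quotient_topology[OF R] openin_subset openin_topspace subset_antisym)
qed

lemma quotient_map_quotient_topology:
  assumes R: "equiv (topspace X) R"
  shows "quotient_map X (quotient_topology X R) (\<lambda>x. R `` {x})"
  unfolding quotient_map_def
proof (intro conjI allI impI)
  show "(\<lambda>x. R `` {x}) ` topspace X = topspace (quotient_topology X R)"
    unfolding topspace_quotient_topology[OF R] by (auto simp: quotient_def)
  fix U
  assume "U \<subseteq> topspace (quotient_topology X R)"
  then have U: "U \<subseteq> topspace X // R"
    by (simp add: topspace_quotient_topology[OF R])
  have "{x \<in> topspace X. R `` {x} \<in> U} = \<Union>U"
  proof (intro equalityI subsetI)
    fix x assume "x \<in> {x \<in> topspace X. R `` {x} \<in> U}"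
    then show "x \<in> \<Union>U" using equiv_class_self[OF R] by blast
  next
    fix x assume "x \<in> \<Union>U"
    then obtain C where C: "C \<in> U" "x \<in> C" by blast
    then have "x \<in> topspace X" using U Union_quotient[OF R] by blast
    moreover have "R `` {x} = C"
    proof -
      obtain y where "y \<in> topspace X" "C = R `` {y}"
        using C U by (meson quotientE subsetD)
      then show ?thesis using C equiv_class_eq[OF R] by blast
    qed
    ultimately show "x \<in> {x \<in> topspace X. R `` {x} \<in> U}" using C by simp
  qed
  then show "openin X {x \<in> topspace X. R `` {x} \<in> U} = openin (quotient_topology X R) U"
    using U by (simp add: openin_quotient_topology[OF R])
qed

definition torus_glue :: "'a topology \<Rightarrow> ('a \<Rightarrow> 'a) \<Rightarrow> 'a \<times> real \<Rightarrow> 'a \<times> real \<Rightarrow> bool"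
  where "torus_glue X f a b \<longleftrightarrow> (\<exists>x\<in>topspace X. a = (x, 1) \<and> b = (f x, 0))"

definition torus_rel :: "'a topology \<Rightarrow> ('a \<Rightarrow> 'a) \<Rightarrow> (('a \<times> real) \<times> ('a \<times> real)) set"
  where "torus_rel X f =
    {(a, b). a \<in> topspace X \<times> {0..1} \<and> b \<in> topspace X \<times> {0..1} \<and> equivclp (torus_glue X f) a b}"

definition mapping_torus :: "'a topology \<Rightarrow> ('a \<Rightarrow> 'a) \<Rightarrow> ('a \<times> real) set topology"
  where "mapping_torus X f =
    quotient_topology (prod_topology X (top_of_set {0..1})) (torus_rel X f)"

lemma equiv_torus_rel: "equiv (topspace (prod_topology X (top_of_set {0..1}))) (torus_rel X f)"
  unfolding equiv_def refl_on_def sym_def trans_def torus_rel_def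
  by (auto intro: equivclp_sym equivclp_trans)


section \<open>Singular homology with coefficients in a field\<close>

text \<open>
  Coefficient fields are types of class \<open>field\<close>, passed as a type argument \<open>K\<close>.
\<close>

type_synonym ('k, 'a) kchain = "((nat \<Rightarrow> real) \<Rightarrow> 'a) \<Rightarrow>\<^sub>0 'k"

definition kscale :: "'k::field \<Rightarrow> ('b \<Rightarrow>\<^sub>0 'k) \<Rightarrow> ('b \<Rightarrow>\<^sub>0 'k)"
  where "kscale a = Poly_Mapping.map (\<lambda>b. a * b)"

text \<open>The \<open>'k\<close>-linear analogue of \<open>frag_extend\<close>.\<close>

definition kextend :: "('b \<Rightarrow> ('c \<Rightarrow>\<^sub>0 'k)) \<Rightarrow> ('b \<Rightarrow>\<^sub>0 'k::field) \<Rightarrow> ('c \<Rightarrow>\<^sub>0 'k)"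
  where "kextend g c = (\<Sum>s\<in>Poly_Mapping.keys c. kscale (Poly_Mapping.lookup c s) (g s))"

definition chain_space ::
    "'k::field itself \<Rightarrow> nat \<Rightarrow> 'a topology \<Rightarrow> ('k, ('k, 'a) kchain) module"
  where "chain_space K p X =
    \<lparr>carrier = {c. Poly_Mapping.keys c \<subseteq> singular_simplex_set p X},
     mult = undefined, one = undefined, zero = 0, add = (+), smult = kscale\<rparr>"

abbreviation base_change :: "('b \<Rightarrow>\<^sub>0 int) \<Rightarrow> ('b \<Rightarrow>\<^sub>0 'k::field)"
  where "base_change \<equiv> Poly_Mapping.map of_int"

text \<open>The singular complex over \<open>'k\<close> is the integral one of the library, tensored with \<open>'k\<close>.\<close>

definition kboundary :: "nat \<Rightarrow> ('k::field, 'a) kchain \<Rightarrow> ('k, 'a) kchain"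
  where "kboundary p =
    kextend (\<lambda>s. base_change (chain_boundary p (frag_of s)))"

definition kchain_map :: "nat \<Rightarrow> ('a \<Rightarrow> 'b) \<Rightarrow> ('k::field, 'a) kchain \<Rightarrow> ('k, 'b) kchain"
  where "kchain_map p f = kextend (\<lambda>s. Poly_Mapping.single (simplex_map p f s) 1)"

definition cycle_space ::
    "'k::field itself \<Rightarrow> nat \<Rightarrow> 'a topology \<Rightarrow> ('k, ('k, 'a) kchain) module"
  where "cycle_space K p X =
    (chain_space K p X)\<lparr>carrier := {c \<in> carrier (chain_space K p X). kboundary p c = 0}\<rparr>"

definition boundaries ::
    "'k::field itself \<Rightarrow> nat \<Rightarrow> 'a topology \<Rightarrow> ('k, 'a) kchain set"
  where "boundaries K p X = kboundary (Suc p) ` carrier (chain_space K (Suc p) X)"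

definition quotient_module :: "('k, 'b) module \<Rightarrow> 'b set \<Rightarrow> ('k, 'b set) module"
  where "quotient_module M W =
    \<lparr>carrier = a_rcosets\<^bsub>M\<^esub> W, mult = undefined, one = undefined, zero = W, add = set_add M,
     smult = (\<lambda>a C. \<Union>x\<in>C. W +>\<^bsub>M\<^esub> (a \<odot>\<^bsub>M\<^esub> x))\<rparr>"

definition homology ::
    "'k::field itself \<Rightarrow> nat \<Rightarrow> 'a topology \<Rightarrow> ('k, ('k, 'a) kchain set) module"
  where "homology K p X = quotient_module (cycle_space K p X) (boundaries K p X)"

definition induced_map ::
    "'k::field itself \<Rightarrow> nat \<Rightarrow> 'b topology \<Rightarrow> ('a \<Rightarrow> 'b) \<Rightarrow> ('k, 'a) kchain set \<Rightarrow> ('k, 'b) kchain set"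
  where "induced_map K p Y f C =
    (\<Union>c\<in>C. boundaries K p Y +>\<^bsub>cycle_space K p Y\<^esub> kchain_map p f c)"


section \<open>Poincare polynomials\<close>

definition betti :: "'k::field itself \<Rightarrow> nat \<Rightarrow> 'a topology \<Rightarrow> nat"
  where "betti K j X = vectorspace.dim class_ring (homology K j X)"

definition finite_total_homology :: "'k::field itself \<Rightarrow> 'a topology \<Rightarrow> bool"
  where "finite_total_homology K X \<longleftrightarrow>
    (\<forall>j. vectorspace.fin_dim class_ring (homology K j X)) \<and> finite {j. betti K j X \<noteq> 0}"

text \<open>
  The polynomials below are meaningful for spaces with finite-dimensional total homology; otherwise
  a sum over an infinite index set is \<open>0\<close> by the library convention.
\<close>

definition poincare_poly :: "'k::field itself \<Rightarrow> 'a topology \<Rightarrow> int poly"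
  where "poincare_poly K X = (\<Sum>j | betti K j X \<noteq> 0. monom (int (betti K j X)) j)"

definition id_minus_induced ::
    "'k::field itself \<Rightarrow> nat \<Rightarrow> 'a topology \<Rightarrow> ('a \<Rightarrow> 'a) \<Rightarrow> ('k, 'a) kchain set \<Rightarrow> ('k, 'a) kchain set"
  where "id_minus_induced K j X f = (\<lambda>C. C \<ominus>\<^bsub>homology K j X\<^esub> induced_map K j X f C)"

definition nu :: "'k::field itself \<Rightarrow> nat \<Rightarrow> 'a topology \<Rightarrow> ('a \<Rightarrow> 'a) \<Rightarrow> nat"
  where "nu K j X f = vectorspace.dim class_ring
    ((homology K j X)\<lparr>carrier :=
      a_kernel (homology K j X) (homology K j X) (id_minus_induced K j X f)\<rparr>)"

definition fixed_poly :: "'k::field itself \<Rightarrow> 'a topology \<Rightarrow> ('a \<Rightarrow> 'a) \<Rightarrow> int poly"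
  where "fixed_poly K X f = (\<Sum>j | nu K j X f \<noteq> 0. monom (int (nu K j X f)) j)"

text \<open>\<open>delta_poly_eq_ranks\<close> below is the expression of this polynomial by ranks.\<close>

definition delta_poly :: "'k::field itself \<Rightarrow> 'a topology \<Rightarrow> ('a \<Rightarrow> 'a) \<Rightarrow> int poly"
  where "delta_poly K X f = poincare_poly K X - fixed_poly K X f"

definition rank_id_minus :: "'k::field itself \<Rightarrow> nat \<Rightarrow> 'a topology \<Rightarrow> ('a \<Rightarrow> 'a) \<Rightarrow> nat"
  where "rank_id_minus K j X f = vectorspace.dim class_ring
    ((homology K j X)\<lparr>carrier := id_minus_induced K j X f ` carrier (homology K j X)\<rparr>)"


section \<open>Homology spaces, induced maps and rank-nullity\<close>

lemma lookup_kscale [simp]: "Poly_Mapping.lookup (kscale a c) s = a * Poly_Mapping.lookup c s"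
  by (simp add: kscale_def Poly_Mapping.map.rep_eq when_def)

lemma kscale_simps:
  "kscale a (c + c') = kscale a c + kscale a c'"
  "kscale (a + b) c = kscale a c + kscale b c"
  "kscale a (kscale b c) = kscale (a * b) c"
  "kscale 1 c = c" "kscale 0 c = 0" "kscale a 0 = 0"
  by (simp_all add: poly_mapping_eq_iff fun_eq_iff lookup_add algebra_simps)

lemma kscale_sum: "kscale a (sum g A) = (\<Sum>x\<in>A. kscale a (g x))"
  by (induction A rule: infinite_finite_induct) (simp_all add: kscale_simps)

lemma keys_kscale: "Poly_Mapping.keys (kscale a c) \<subseteq> Poly_Mapping.keys c"
  by (auto simp: in_keys_iff)

lemma kextend_superset:
  assumes "finite A" "Poly_Mapping.keys c \<subseteq> A"
  shows "kextend g c = (\<Sum>s\<in>A. kscale (Poly_Mapping.lookup c s) (g s))"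
  unfolding kextend_def
  by (rule sum.mono_neutral_left) (use assms in \<open>auto simp: in_keys_iff kscale_simps\<close>)

lemma kextend_add: "kextend g (c + c') = kextend g c + kextend g c'"
proof -
  let ?A = "Poly_Mapping.keys c \<union> Poly_Mapping.keys c'"
  show ?thesis
    using keys_add[of c c']
    by (simp add: kextend_superset[of ?A] lookup_add kscale_simps sum.distrib)
qed

lemma kextend_kscale: "kextend g (kscale a c) = kscale a (kextend g c)"
  using keys_kscale[of a c]
  by (simp add: kextend_superset[of "Poly_Mapping.keys c"] kscale_sum kscale_simps)

lemma kextend_0 [simp]: "kextend g 0 = 0"
  by (simp add: kextend_def)

lemma kextend_sum: "kextend g (sum h A) = (\<Sum>x\<in>A. kextend g (h x))"
  by (induction A rule: infinite_finite_induct) (simp_all add: kextend_add)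

lemma kextend_single [simp]: "kextend g (Poly_Mapping.single s a) = kscale a (g s)"
  by (simp add: kextend_superset[of "{s}"])

lemma kextend_kextend: "kextend h (kextend g c) = kextend (\<lambda>s. kextend h (g s)) c"
  by (simp add: kextend_def[of g] kextend_def[of "\<lambda>s. kextend h (g s)"] kextend_sum kextend_kscale)

lemma kextend_cong:
  "(\<And>s. s \<in> Poly_Mapping.keys c \<Longrightarrow> g s = h s) \<Longrightarrow> kextend g c = kextend h c"
  by (simp add: kextend_def)

lemma keys_kextend:
  "Poly_Mapping.keys (kextend g c) \<subseteq> (\<Union>s\<in>Poly_Mapping.keys c. Poly_Mapping.keys (g s))"
  unfolding kextend_def using keys_sum keys_kscale by fastforce

lemma lookup_base_change:
  "Poly_Mapping.lookup (base_change c) s = of_int (Poly_Mapping.lookup c s)"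
  by (simp add: Poly_Mapping.map.rep_eq when_def)

lemma base_change_sum_cmul:
  "base_change (\<Sum>x\<in>A. frag_cmul (n x) (g x)) = (\<Sum>x\<in>A. kscale (of_int (n x)) (base_change (g x)))"
  by (simp add: poly_mapping_eq_iff fun_eq_iff lookup_sum lookup_base_change)

lemma kextend_base_change:
  fixes g :: "'b \<Rightarrow> 'c \<Rightarrow>\<^sub>0 int"
  shows "(kextend (\<lambda>s. base_change (g s)) (base_change c) :: 'c \<Rightarrow>\<^sub>0 'k::field) = base_change (frag_extend g c)"
proof -
  have "Poly_Mapping.keys (base_change c :: 'b \<Rightarrow>\<^sub>0 'k) \<subseteq> Poly_Mapping.keys c"
    by (auto simp: in_keys_iff lookup_base_change)
  then show ?thesis
    by (simp add: kextend_superset[of "Poly_Mapping.keys c"] lookup_base_change frag_extend_def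
        base_change_sum_cmul)
qed

lemma chain_boundary_frag_extend:
  "frag_extend (\<lambda>s. chain_boundary p (frag_of s)) c = chain_boundary p c"
  by (cases "p = 0") (simp_all add: chain_boundary_def frag_extend_def)

lemma kboundary_base_change: "kboundary p (base_change c) = base_change (chain_boundary p c)"
  by (simp add: kboundary_def kextend_base_change chain_boundary_frag_extend)

lemma kboundary_kboundary:
  assumes "c \<in> carrier (chain_space K (Suc p) X)"
  shows "kboundary p (kboundary (Suc p) c) = 0"
proof -
  have "kboundary p (kboundary (Suc p) c)
      = kextend (\<lambda>s. kboundary p (base_change (chain_boundary (Suc p) (frag_of s)))) c"
    by (simp add: kboundary_def kextend_kextend)
  also have "\<dots> = kextend (\<lambda>s. 0) c"
  proof (rule kextend_cong)
    fix s assume "s \<in> Poly_Mapping.keys c"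
    then have "singular_chain (Suc p) X (frag_of s)"
      using assms by (auto simp: chain_space_def singular_chain_of)
    then show "kboundary p (base_change (chain_boundary (Suc p) (frag_of s))) = (0 :: ('b, 'a) kchain)"
      by (simp add: kboundary_base_change chain_boundary_boundary_alt poly_mapping_eq_iff fun_eq_iff
          lookup_base_change)
  qed
  finally show ?thesis by (simp add: kextend_def kscale_simps)
qed

lemma kboundary_in_chain_space:
  fixes c :: "('k::field, 'a) kchain"
  assumes "c \<in> carrier (chain_space K (Suc p) X)"
  shows "kboundary (Suc p) c \<in> carrier (chain_space K p X)"
proof -
  have sub: "Poly_Mapping.keys (base_change (chain_boundary (Suc p) (frag_of s)) :: ('k, 'a) kchain)
      \<subseteq> singular_simplex_set p X" if "s \<in> Poly_Mapping.keys c" for s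
  proof -
    have "singular_chain (Suc p) X (frag_of s)"
      using assms that by (auto simp: chain_space_def singular_chain_of)
    then have "Poly_Mapping.keys (chain_boundary (Suc p) (frag_of s)) \<subseteq> singular_simplex_set p X"
      using singular_chain_boundary[of "Suc p" X "frag_of s"] by (simp add: singular_chain_def)
    moreover have "Poly_Mapping.keys (base_change e :: ('k, 'a) kchain) \<subseteq> Poly_Mapping.keys e" for e
      by (auto simp: in_keys_iff lookup_base_change)
    ultimately show ?thesis by blast
  qed
  have "Poly_Mapping.keys (kboundary (Suc p) c) \<subseteq> singular_simplex_set p X"
    unfolding kboundary_def by (rule order_trans[OF keys_kextend UN_least]) (rule sub)
  then show ?thesis
    by (simp add: chain_space_def)
qed

lemma chain_space_closed:
  "0 \<in> carrier (chain_space K p X)"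
  "\<lbrakk>c \<in> carrier (chain_space K p X); c' \<in> carrier (chain_space K p X)\<rbrakk>
    \<Longrightarrow> c + c' \<in> carrier (chain_space K p X)"
  "c \<in> carrier (chain_space K p X) \<Longrightarrow> kscale a c \<in> carrier (chain_space K p X)"
proof -
  show "0 \<in> carrier (chain_space K p X)" by (simp add: chain_space_def)
  show "c + c' \<in> carrier (chain_space K p X)"
    if "c \<in> carrier (chain_space K p X)" "c' \<in> carrier (chain_space K p X)"
    using that keys_add[of c c'] unfolding chain_space_def by auto
  show "kscale a c \<in> carrier (chain_space K p X)" if "c \<in> carrier (chain_space K p X)"
    using that keys_kscale[of a c] unfolding chain_space_def by auto
qed

lemma chain_space_sel [simp]:
  "add (chain_space K p X) = (+)" "zero (chain_space K p X) = 0"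
  "module.smult (chain_space K p X) = kscale"
  by (simp_all add: chain_space_def)

lemma vectorspace_chain_space: "vectorspace class_ring (chain_space K p X)"
proof (rule vs_criteria)
  show "field (class_ring :: 'a ring)" by (rule class_field)
  show "\<forall>v\<in>carrier (chain_space K p X).
     \<exists>w\<in>carrier (chain_space K p X). v \<oplus>\<^bsub>chain_space K p X\<^esub> w = \<zero>\<^bsub>chain_space K p X\<^esub>"
  proof
    fix v assume v: "v \<in> carrier (chain_space K p X)"
    show "\<exists>w\<in>carrier (chain_space K p X). v \<oplus>\<^bsub>chain_space K p X\<^esub> w = \<zero>\<^bsub>chain_space K p X\<^esub>"
    proof (rule bexI)
      show "v \<oplus>\<^bsub>chain_space K p X\<^esub> kscale (-1) v = \<zero>\<^bsub>chain_space K p X\<^esub>"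
        by (simp add: poly_mapping_eq_iff fun_eq_iff lookup_add)
    qed (rule chain_space_closed(3)[OF v])
  qed
  show "\<forall>a b v. a \<in> carrier class_ring \<and> b \<in> carrier class_ring \<and> v \<in> carrier (chain_space K p X) \<longrightarrow>
      (a \<otimes>\<^bsub>class_ring\<^esub> b) \<odot>\<^bsub>chain_space K p X\<^esub> v = a \<odot>\<^bsub>chain_space K p X\<^esub> (b \<odot>\<^bsub>chain_space K p X\<^esub> v)"
    by (simp add: kscale_simps(3))
qed (simp_all add: kscale_simps chain_space_closed add.assoc add.commute)

lemma kboundary_linear:
  "kboundary p (c + c') = kboundary p c + kboundary p c'"
  "kboundary p (kscale a c) = kscale a (kboundary p c)" "kboundary p 0 = 0"
  by (simp_all add: kboundary_def kextend_add kextend_kscale)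

lemma kchain_map_linear:
  "kchain_map p f (c + c') = kchain_map p f c + kchain_map p f c'"
  "kchain_map p f (kscale a c) = kscale a (kchain_map p f c)" "kchain_map p f 0 = 0"
  by (simp_all add: kchain_map_def kextend_add kextend_kscale)

lemma cycle_space_sel [simp]:
  "add (cycle_space K p X) = (+)" "zero (cycle_space K p X) = 0"
  "module.smult (cycle_space K p X) = kscale"
  by (simp_all add: cycle_space_def)

lemma vectorspace_cycle_space: "vectorspace class_ring (cycle_space K p X)"
proof -
  interpret C: vectorspace "class_ring :: 'a ring" "chain_space K p X"
    by (rule vectorspace_chain_space)
  let ?Z = "{c \<in> carrier (chain_space K p X). kboundary p c = 0}"
  have "submodule (class_ring :: 'a ring) ?Z (chain_space K p X)"
  proof (rule submodule.intro[OF C.module_axioms])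
    show "?Z \<subseteq> carrier (chain_space K p X)" by blast
    show "\<zero>\<^bsub>chain_space K p X\<^esub> \<in> ?Z"
      by (simp add: kboundary_linear chain_space_closed(1))
  next
    fix v w and a :: 'a assume "v \<in> ?Z" "w \<in> ?Z"
    then show "v \<oplus>\<^bsub>chain_space K p X\<^esub> w \<in> ?Z" "a \<odot>\<^bsub>chain_space K p X\<^esub> v \<in> ?Z"
      by (simp_all add: kboundary_linear kscale_simps chain_space_closed)
  qed
  then show ?thesis
    unfolding cycle_space_def
    by (intro C.subspace_is_vs subspace.intro C.vectorspace_axioms)
qed

lemma submodule_boundaries: "submodule class_ring (boundaries K p X) (cycle_space K p X)"
proof -
  interpret Z: vectorspace "class_ring :: 'a ring" "cycle_space K p X"
    by (rule vectorspace_cycle_space)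
  show ?thesis
  proof (intro submodule.intro Z.module_axioms)
    show "boundaries K p X \<subseteq> carrier (cycle_space K p X)"
    proof
      fix b assume "b \<in> boundaries K p X"
      then obtain c where c: "c \<in> carrier (chain_space K (Suc p) X)" "b = kboundary (Suc p) c"
        unfolding boundaries_def by blast
      then show "b \<in> carrier (cycle_space K p X)"
        using kboundary_kboundary[OF c(1)] kboundary_in_chain_space[OF c(1)]
        unfolding cycle_space_def by simp
    qed
    show "\<zero>\<^bsub>cycle_space K p X\<^esub> \<in> boundaries K p X"
      unfolding boundaries_def cycle_space_sel
      by (metis kboundary_linear(3) chain_space_closed(1) imageI)
  next
    fix v w and a :: 'a assume v: "v \<in> boundaries K p X" and w: "w \<in> boundaries K p X"
    then obtain c c' where "c \<in> carrier (chain_space K (Suc p) X)" "v = kboundary (Suc p) c"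
      "c' \<in> carrier (chain_space K (Suc p) X)" "w = kboundary (Suc p) c'"
      unfolding boundaries_def by blast
    then show "v \<oplus>\<^bsub>cycle_space K p X\<^esub> w \<in> boundaries K p X"
      and "a \<odot>\<^bsub>cycle_space K p X\<^esub> v \<in> boundaries K p X"
      unfolding boundaries_def cycle_space_sel
      by (metis (no_types) kboundary_linear(1,2) chain_space_closed(2,3) imageI)+
  qed
qed


lemma submodule_abelian_subgroup:
  assumes "vectorspace R M" "submodule R W M"
  shows "abelian_subgroup W M"
proof -
  interpret M: vectorspace R M by fact
  interpret W: submodule R W M by fact
  have "subgroup W (add_monoid M)"
  proof (rule M.add.subgroupI)
    fix x assume x: "x \<in> W"
    then have "\<ominus>\<^bsub>M\<^esub> x = (\<ominus>\<^bsub>R\<^esub> \<one>\<^bsub>R\<^esub>) \<odot>\<^bsub>M\<^esub> x"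
      using W.subset M.smult_minus_1 by auto
    then show "\<ominus>\<^bsub>M\<^esub> x \<in> W" using x by simp
  next
    show "W \<noteq> {}" using W.zero_closed by blast
  qed (use W.subset in auto)
  then show ?thesis
    by (intro abelian_subgroupI3 additive_subgroup.intro M.abelian_group_axioms)
qed

lemma quotient_module_simps:
  assumes "vectorspace R M" "submodule R W M"
  shows "carrier (quotient_module M W) = (\<lambda>x. W +>\<^bsub>M\<^esub> x) ` carrier M"
    and "\<zero>\<^bsub>quotient_module M W\<^esub> = W +>\<^bsub>M\<^esub> \<zero>\<^bsub>M\<^esub>"
    and "\<lbrakk>x \<in> carrier M; y \<in> carrier M\<rbrakk> \<Longrightarrow>
      (W +>\<^bsub>M\<^esub> x) \<oplus>\<^bsub>quotient_module M W\<^esub> (W +>\<^bsub>M\<^esub> y) = W +>\<^bsub>M\<^esub> (x \<oplus>\<^bsub>M\<^esub> y)"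
    and "\<lbrakk>a \<in> carrier R; x \<in> carrier M\<rbrakk> \<Longrightarrow>
      a \<odot>\<^bsub>quotient_module M W\<^esub> (W +>\<^bsub>M\<^esub> x) = W +>\<^bsub>M\<^esub> (a \<odot>\<^bsub>M\<^esub> x)"
proof -
  interpret M: vectorspace R M by fact
  interpret sub: submodule R W M by fact
  interpret W: abelian_subgroup W M by (rule submodule_abelian_subgroup[OF assms])
  show "carrier (quotient_module M W) = (\<lambda>x. W +>\<^bsub>M\<^esub> x) ` carrier M"
    by (auto simp: quotient_module_def A_RCOSETS_def')
  show "\<zero>\<^bsub>quotient_module M W\<^esub> = W +>\<^bsub>M\<^esub> \<zero>\<^bsub>M\<^esub>"
    using sub.subset by (simp add: quotient_module_def M.a_coset_add_zero)
  show "(W +>\<^bsub>M\<^esub> x) \<oplus>\<^bsub>quotient_module M W\<^esub> (W +>\<^bsub>M\<^esub> y) = W +>\<^bsub>M\<^esub> (x \<oplus>\<^bsub>M\<^esub> y)"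
    if "x \<in> carrier M" "y \<in> carrier M"
    using that by (simp add: quotient_module_def W.a_rcos_sum)
  show "a \<odot>\<^bsub>quotient_module M W\<^esub> (W +>\<^bsub>M\<^esub> x) = W +>\<^bsub>M\<^esub> (a \<odot>\<^bsub>M\<^esub> x)"
    if a: "a \<in> carrier R" and x: "x \<in> carrier M"
  proof -
    have "W +>\<^bsub>M\<^esub> (a \<odot>\<^bsub>M\<^esub> y) = W +>\<^bsub>M\<^esub> (a \<odot>\<^bsub>M\<^esub> x)" if y: "y \<in> W +>\<^bsub>M\<^esub> x" for y
    proof -
      obtain w where w: "w \<in> W" "y = w \<oplus>\<^bsub>M\<^esub> x"
        using y by (auto simp: a_r_coset_def')
      then have "a \<odot>\<^bsub>M\<^esub> y = (a \<odot>\<^bsub>M\<^esub> w) \<oplus>\<^bsub>M\<^esub> (a \<odot>\<^bsub>M\<^esub> x)" "a \<odot>\<^bsub>M\<^esub> w \<in> W"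
        using a x sub.subset by (auto simp: M.smult_r_distr)
      then have "a \<odot>\<^bsub>M\<^esub> y \<in> W +>\<^bsub>M\<^esub> (a \<odot>\<^bsub>M\<^esub> x)"
        by (auto simp: a_r_coset_def')
      then show ?thesis
        using a x by (metis W.a_repr_independence' M.smult_closed)
    qed
    moreover have "x \<in> W +>\<^bsub>M\<^esub> x" using x by (rule W.a_rcos_self)
    ultimately have "(\<Union>y\<in>W +>\<^bsub>M\<^esub> x. W +>\<^bsub>M\<^esub> (a \<odot>\<^bsub>M\<^esub> y)) = W +>\<^bsub>M\<^esub> (a \<odot>\<^bsub>M\<^esub> x)"
      by blast
    then show ?thesis by (simp add: quotient_module_def)
  qed
qed

lemma vectorspace_quotient_module:
  assumes "vectorspace R M" "submodule R W M"
  shows "vectorspace R (quotient_module M W)"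
proof -
  interpret M: vectorspace R M by fact
  note s [simp] = quotient_module_simps[OF assms]
  show ?thesis
  proof (rule vs_criteria)
    show "\<forall>v\<in>carrier (quotient_module M W). \<exists>w\<in>carrier (quotient_module M W).
        v \<oplus>\<^bsub>quotient_module M W\<^esub> w = \<zero>\<^bsub>quotient_module M W\<^esub>"
    proof
      fix v assume "v \<in> carrier (quotient_module M W)"
      then obtain x where x: "x \<in> carrier M" "v = W +>\<^bsub>M\<^esub> x" by auto
      then have "W +>\<^bsub>M\<^esub> (\<ominus>\<^bsub>M\<^esub> x) \<in> carrier (quotient_module M W)"
        "v \<oplus>\<^bsub>quotient_module M W\<^esub> (W +>\<^bsub>M\<^esub> (\<ominus>\<^bsub>M\<^esub> x)) = \<zero>\<^bsub>quotient_module M W\<^esub>"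
        by (simp_all add: M.M.r_neg)
      then show "\<exists>w\<in>carrier (quotient_module M W).
        v \<oplus>\<^bsub>quotient_module M W\<^esub> w = \<zero>\<^bsub>quotient_module M W\<^esub>" by blast
    qed
  next
    let ?Q = "quotient_module M W"
    show "\<forall>u v w. u \<in> carrier ?Q \<and> v \<in> carrier ?Q \<and> w \<in> carrier ?Q \<longrightarrow>
        u \<oplus>\<^bsub>?Q\<^esub> v \<oplus>\<^bsub>?Q\<^esub> w = u \<oplus>\<^bsub>?Q\<^esub> (v \<oplus>\<^bsub>?Q\<^esub> w)"
      by (auto simp: M.M.a_assoc)
    show "\<forall>u v. u \<in> carrier ?Q \<and> v \<in> carrier ?Q \<longrightarrow> u \<oplus>\<^bsub>?Q\<^esub> v = v \<oplus>\<^bsub>?Q\<^esub> u"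
      by (auto simp: M.M.a_comm)
    show "\<forall>a u v. a \<in> carrier R \<and> u \<in> carrier ?Q \<and> v \<in> carrier ?Q \<longrightarrow>
        a \<odot>\<^bsub>?Q\<^esub> (u \<oplus>\<^bsub>?Q\<^esub> v) = a \<odot>\<^bsub>?Q\<^esub> u \<oplus>\<^bsub>?Q\<^esub> a \<odot>\<^bsub>?Q\<^esub> v"
      by (auto simp: M.smult_r_distr)
    show "\<forall>a b v. a \<in> carrier R \<and> b \<in> carrier R \<and> v \<in> carrier ?Q \<longrightarrow>
        (a \<oplus>\<^bsub>R\<^esub> b) \<odot>\<^bsub>?Q\<^esub> v = a \<odot>\<^bsub>?Q\<^esub> v \<oplus>\<^bsub>?Q\<^esub> b \<odot>\<^bsub>?Q\<^esub> v"
      by (auto simp: M.smult_l_distr)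
    show "\<forall>a b v. a \<in> carrier R \<and> b \<in> carrier R \<and> v \<in> carrier ?Q \<longrightarrow>
        (a \<otimes>\<^bsub>R\<^esub> b) \<odot>\<^bsub>?Q\<^esub> v = a \<odot>\<^bsub>?Q\<^esub> (b \<odot>\<^bsub>?Q\<^esub> v)"
      by (auto simp: M.smult_assoc1)
    show "field R" by (rule M.field_axioms)
    show "\<zero>\<^bsub>?Q\<^esub> \<in> carrier ?Q" by simp
    show "\<forall>u v. u \<in> carrier ?Q \<and> v \<in> carrier ?Q \<longrightarrow> u \<oplus>\<^bsub>?Q\<^esub> v \<in> carrier ?Q"
      by auto
    show "\<forall>a v. a \<in> carrier R \<and> v \<in> carrier ?Q \<longrightarrow> a \<odot>\<^bsub>?Q\<^esub> v \<in> carrier ?Q"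
      by auto
    show "\<forall>v\<in>carrier ?Q. v \<oplus>\<^bsub>?Q\<^esub> \<zero>\<^bsub>?Q\<^esub> = v"
      by (auto simp del: M.a_coset_add_zero)
    show "\<forall>v\<in>carrier ?Q. \<one>\<^bsub>R\<^esub> \<odot>\<^bsub>?Q\<^esub> v = v"
      by auto
  qed
qed

lemma vectorspace_homology: "vectorspace class_ring (homology K p X)"
  unfolding homology_def
  by (rule vectorspace_quotient_module[OF vectorspace_cycle_space submodule_boundaries])

lemma base_change_frag_of: "base_change (frag_of s) = (Poly_Mapping.single s 1 :: 'b \<Rightarrow>\<^sub>0 'k::field)"
  by (simp add: poly_mapping_eq_iff fun_eq_iff lookup_base_change lookup_single when_def)

lemma kchain_map_base_change: "kchain_map p f (base_change c) = base_change (chain_map p f c)"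
  unfolding kchain_map_def chain_map_def o_def kextend_base_change[symmetric] base_change_frag_of ..

lemma kboundary_kchain_map:
  fixes c :: "('k::field, 'a) kchain" and f :: "'a \<Rightarrow> 'b"
  assumes "c \<in> carrier (chain_space K p X)"
  shows "kboundary p (kchain_map p f c) = kchain_map (p - 1) f (kboundary p c)"
proof -
  have "kboundary p (kchain_map p f c)
      = kextend (\<lambda>s. kboundary p (base_change (frag_of (simplex_map p f s)))) c"
    by (simp only: kboundary_def kchain_map_def kextend_kextend base_change_frag_of)
  also have "\<dots> = kextend (\<lambda>s. kchain_map (p - 1) f (base_change (chain_boundary p (frag_of s)))) c"
  proof (rule kextend_cong)
    fix s assume "s \<in> Poly_Mapping.keys c"
    then have "singular_chain p X (frag_of s)"
      using assms by (auto simp: chain_space_def singular_chain_of)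
    then have "chain_boundary p (frag_of (simplex_map p f s)) = chain_map (p - 1) f (chain_boundary p (frag_of s))"
      using chain_boundary_chain_map[of p X "frag_of s" f] by simp
    then show "kboundary p (base_change (frag_of (simplex_map p f s)))
      = (kchain_map (p - 1) f (base_change (chain_boundary p (frag_of s))) :: ('k, 'b) kchain)"
      by (simp only: kboundary_base_change kchain_map_base_change)
  qed
  also have "\<dots> = kchain_map (p - 1) f (kboundary p c)"
    by (simp only: kboundary_def kchain_map_def kextend_kextend)
  finally show ?thesis .
qed

lemma kchain_map_in_chain_space:
  assumes "c \<in> carrier (chain_space K p X)" "continuous_map X Y f"
  shows "kchain_map p f c \<in> carrier (chain_space K p Y)"
proof -
  have "Poly_Mapping.keys (kchain_map p f c) \<subseteq> singular_simplex_set p Y"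
    unfolding kchain_map_def
  proof (rule order_trans[OF keys_kextend UN_least])
    fix s assume "s \<in> Poly_Mapping.keys c"
    then have "singular_simplex p X s" using assms(1) by (auto simp: chain_space_def)
    then show "Poly_Mapping.keys (Poly_Mapping.single (simplex_map p f s) 1) \<subseteq> singular_simplex_set p Y"
      using singular_simplex_simplex_map[OF _ assms(2)] by simp
  qed
  then show ?thesis by (simp add: chain_space_def)
qed

lemma kchain_map_cycle:
  assumes "c \<in> carrier (cycle_space K p X)" "continuous_map X Y f"
  shows "kchain_map p f c \<in> carrier (cycle_space K p Y)"
  using assms kchain_map_in_chain_space[of c K p X Y f] kboundary_kchain_map[of c K p X f]
  by (simp add: cycle_space_def kchain_map_linear)

lemma kchain_map_boundary:
  assumes "b \<in> boundaries K p X" "continuous_map X Y f"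
  shows "kchain_map p f b \<in> boundaries K p Y"
proof -
  obtain c where c: "c \<in> carrier (chain_space K (Suc p) X)" "b = kboundary (Suc p) c"
    using assms(1) unfolding boundaries_def by blast
  have "kchain_map p f b = kboundary (Suc p) (kchain_map (Suc p) f c)"
    using kboundary_kchain_map[OF c(1), of f] c(2) by simp
  then show ?thesis
    unfolding boundaries_def using kchain_map_in_chain_space[OF c(1) assms(2)] by blast
qed

lemmas homology_simps =
  quotient_module_simps[OF vectorspace_cycle_space submodule_boundaries, folded homology_def,
    unfolded cycle_space_sel]

lemma induced_map_coset:
  assumes c: "c \<in> carrier (cycle_space K p X)" and f: "continuous_map X Y f"
  shows "induced_map K p Y f (boundaries K p X +>\<^bsub>cycle_space K p X\<^esub> c)
    = boundaries K p Y +>\<^bsub>cycle_space K p Y\<^esub> kchain_map p f c"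
proof -
  interpret B: abelian_subgroup "boundaries K p X" "cycle_space K p X"
    by (rule submodule_abelian_subgroup[OF vectorspace_cycle_space submodule_boundaries])
  interpret B': abelian_subgroup "boundaries K p Y" "cycle_space K p Y"
    by (rule submodule_abelian_subgroup[OF vectorspace_cycle_space submodule_boundaries])
  have "boundaries K p Y +>\<^bsub>cycle_space K p Y\<^esub> kchain_map p f z
      = boundaries K p Y +>\<^bsub>cycle_space K p Y\<^esub> kchain_map p f c"
    if z: "z \<in> boundaries K p X +>\<^bsub>cycle_space K p X\<^esub> c" for z
  proof -
    obtain b where b: "b \<in> boundaries K p X" "z = b + c"
      using z by (auto simp: a_r_coset_def')
    then have "kchain_map p f z \<in> boundaries K p Y +>\<^bsub>cycle_space K p Y\<^esub> kchain_map p f c"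
      using kchain_map_boundary[OF b(1) f] by (auto simp: a_r_coset_def' kchain_map_linear)
    then show ?thesis
      using B'.a_repr_independence'[OF _ kchain_map_cycle[OF c f]] by metis
  qed
  moreover have "c \<in> boundaries K p X +>\<^bsub>cycle_space K p X\<^esub> c"
    using c by (rule B.a_rcos_self)
  ultimately show ?thesis
    unfolding induced_map_def by blast
qed

lemma induced_map_linear:
  fixes K :: "'k::field itself"
  assumes f: "continuous_map X Y f"
  shows "induced_map K p Y f \<in> module_hom class_ring (homology K p X) (homology K p Y)"
proof -
  interpret Z: vectorspace "class_ring :: 'k ring" "cycle_space K p X"
    by (rule vectorspace_cycle_space)
  have Zadd: "c + c' \<in> carrier (cycle_space K p X)"
    if "c \<in> carrier (cycle_space K p X)" "c' \<in> carrier (cycle_space K p X)" for c c'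
    using Z.M.a_closed[OF that] by simp
  have Zscale: "kscale a c \<in> carrier (cycle_space K p X)"
    if "c \<in> carrier (cycle_space K p X)" for a c
    using Z.smult_closed[of a c] that by simp
  note s = homology_simps induced_map_coset[OF _ f] kchain_map_cycle[OF _ f] kchain_map_linear
    Zadd Zscale
  show ?thesis
    unfolding module_hom_def homology_simps(1)
    by (auto simp: s)
qed

lemma id_minus_induced_linear:
  fixes K :: "'k::field itself"
  assumes f: "continuous_map X X f"
  shows "id_minus_induced K j X f \<in> module_hom class_ring (homology K j X) (homology K j X)"
proof -
  interpret H: vectorspace "class_ring :: 'k ring" "homology K j X" by (rule vectorspace_homology)
  interpret F: mod_hom "class_ring :: 'k ring" "homology K j X" "homology K j X" "induced_map K j X f"
    by (intro mod_hom.intro mod_hom_axioms.intro H.module_axioms induced_map_linear f)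
  show ?thesis
    unfolding module_hom_def id_minus_induced_def
  proof (intro CollectI conjI allI impI funcsetI; (elim conjE)?)
    fix u v assume "u \<in> carrier (homology K j X)" "v \<in> carrier (homology K j X)"
    then show "u \<oplus>\<^bsub>homology K j X\<^esub> v \<ominus>\<^bsub>homology K j X\<^esub> induced_map K j X f (u \<oplus>\<^bsub>homology K j X\<^esub> v)
      = u \<ominus>\<^bsub>homology K j X\<^esub> induced_map K j X f u \<oplus>\<^bsub>homology K j X\<^esub> (v \<ominus>\<^bsub>homology K j X\<^esub> induced_map K j X f v)"
      by (simp add: a_minus_def H.M.minus_add H.M.a_ac F.f_im)
  next
    fix a :: 'k and v assume "v \<in> carrier (homology K j X)"
    then show "a \<odot>\<^bsub>homology K j X\<^esub> v \<ominus>\<^bsub>homology K j X\<^esub> induced_map K j X f (a \<odot>\<^bsub>homology K j X\<^esub> v)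
      = a \<odot>\<^bsub>homology K j X\<^esub> (v \<ominus>\<^bsub>homology K j X\<^esub> induced_map K j X f v)"
      by (simp add: a_minus_def H.smult_r_distr H.smult_r_minus F.f_im)
  qed (simp add: F.f_im)
qed

lemma rank_nullity_id_minus:
  fixes K :: "'k::field itself"
  assumes "vectorspace.fin_dim class_ring (homology K j X)" "continuous_map X X f"
  shows "rank_id_minus K j X f + nu K j X f = betti K j X"
proof -
  interpret H: vectorspace "class_ring :: 'k ring" "homology K j X" by (rule vectorspace_homology)
  interpret T: linear_map "class_ring :: 'k ring" "homology K j X" "homology K j X" "id_minus_induced K j X f"
    by (intro linear_map.intro mod_hom.intro mod_hom_axioms.intro H.module_axioms H.vectorspace_axioms
        id_minus_induced_linear assms(2))
  show ?thesis
    using T.rank_nullity[OF assms(1)]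
    by (simp add: T.im_def T.ker_def rank_id_minus_def nu_def betti_def a_kernel_def kernel_def)
qed

lemma coeff_sum_support:
  fixes g :: "nat \<Rightarrow> nat"
  assumes "finite {j. g j \<noteq> 0}"
  shows "coeff (\<Sum>j | g j \<noteq> 0. monom (int (g j)) j) n = int (g n)"
proof -
  have "coeff (\<Sum>j | g j \<noteq> 0. monom (int (g j)) j) n = (\<Sum>j | g j \<noteq> 0. if j = n then int (g j) else 0)"
    by (simp add: coeff_sum)
  also have "\<dots> = int (g n)"
    using assms by (simp add: sum.delta)
  finally show ?thesis .
qed

lemma delta_poly_eq_ranks:
  assumes X: "finite_total_homology K X" and f: "continuous_map X X f"
  shows "delta_poly K X f =
    (\<Sum>j | rank_id_minus K j X f \<noteq> 0. monom (int (rank_id_minus K j X f)) j)"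
proof -
  have rn: "rank_id_minus K j X f + nu K j X f = betti K j X" for j
    using X f rank_nullity_id_minus unfolding finite_total_homology_def by blast
  have fin: "finite {j. betti K j X \<noteq> 0}"
    using X unfolding finite_total_homology_def by blast
  have fin1: "finite {j. nu K j X f \<noteq> 0}" and fin2: "finite {j. rank_id_minus K j X f \<noteq> 0}"
  proof -
    have "{j. nu K j X f \<noteq> 0} \<subseteq> {j. betti K j X \<noteq> 0}"
      "{j. rank_id_minus K j X f \<noteq> 0} \<subseteq> {j. betti K j X \<noteq> 0}"
      using rn by (metis (mono_tags, lifting) Collect_mono add_is_0)+
    then show "finite {j. nu K j X f \<noteq> 0}" "finite {j. rank_id_minus K j X f \<noteq> 0}"
      using fin finite_subset by blast+
  qed
  have "int (betti K n X) - int (nu K n X f) = int (rank_id_minus K n X f)" for n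
    using rn[of n] by linarith
  then show ?thesis
    unfolding poly_eq_iff delta_poly_def poincare_poly_def fixed_poly_def coeff_diff
      coeff_sum_support[OF fin] coeff_sum_support[OF fin1] coeff_sum_support[OF fin2] by blast
qed

end

theory Submission
  imports Defs "HOL-Analysis.Abstract_Topological_Spaces"
begin

text \<open>
  Write \<open>T\<close> for the mapping torus and cover it by two open sets: the open cylinder
  \<open>X \<times> (0,1)\<close>, and a neighbourhood of the fibre along which the two ends of \<open>X \<times> [0,1]\<close> are glued.
  The first retracts onto \<open>X\<close> by projection. The second retracts onto \<open>X\<close> as well, but a point just
  below height 1 reaches the glued fibre through \<open>f\<close>. The intersection consists of two disjoint copies
  of \<open>X\<close>, one near height 0 and one near height 1. The two retractions agree on the lower copy and
  differ by \<open>f\<close> on the upper one, so Mayer-Vietoris collapses to the exact sequence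

  \<open>H\<^sub>n(X) \<rightarrow> H\<^sub>n(X) \<rightarrow> H\<^sub>n(T) \<rightarrow> H\<^sub>m(X) \<rightarrow> H\<^sub>m(X)\<close> with \<open>m = n - 1\<close>,

  in which the outer maps are \<open>1 - f\<^sub>*\<close> (\<open>exact_at_base\<close>, \<open>exact_at_torus\<close>, \<open>exact_at_fibre\<close>). Hence
  \<open>dim H\<^sub>n(T)\<close> is the dimension of the cokernel of \<open>1 - f\<^sub>*\<close> in degree \<open>n\<close> plus that of its kernel in degree
  \<open>n - 1\<close>. Kernel and cokernel of an endomorphism of a finite-dimensional space have the same dimension, so this is
  \<open>\<nu>\<^sub>n + \<nu>\<^sub>m\<close> (\<open>betti_torus_Suc\<close>), the coefficient of \<open>t\<^sup>n\<close> in \<open>(1 + t) F(t)\<close>. The second formula is the first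
  one with \<open>\<Delta> = P - F\<close> substituted.

  Two things have to be provided. The first is homotopy invariance and Mayer-Vietoris for chains with
  coefficients in a field. Both come from operators on integral chains that are natural and additive, and
  such operators extend to any field of scalars (\<open>kop\<close>). For subdivision these are the barycentric
  subdivision and its chain homotopy to the identity. For homotopy invariance a natural prism operator is
  built by acyclic models (\<open>prism_step_exists\<close>).

  The second is that the homology of \<open>X\<close> is finite-dimensional, on which the dimension count rests. The
  class of spaces with finite-dimensional total homology is closed under homotopy domination and under
  Mayer-Vietoris (\<open>finite_type_dominated\<close>, \<open>finite_type_Mayer_Vietoris\<close>), and this gives in turn punctured
  discs, the attachment of one cell (\<open>finite_type_attach_cell\<close>) and finite complexes by induction on the
  number of cells.
\<close>

section \<open>Chains over a field as a vector space\<close>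

interpretation kv: vector_space "kscale :: 'k::field \<Rightarrow> ('b \<Rightarrow>\<^sub>0 'k) \<Rightarrow> ('b \<Rightarrow>\<^sub>0 'k)"
  by unfold_locales (simp_all add: kscale_simps)

text \<open>
  Chains, cycles and boundaries are taken as plain sets inside the vector space of all finitely supported
  functions, so that chains of a space and of its subspaces live in one place and can be added.
\<close>

definition kchains :: "nat \<Rightarrow> 'a topology \<Rightarrow> ('k::field, 'a) kchain set"
  where "kchains p X = {c. Poly_Mapping.keys c \<subseteq> singular_simplex_set p X}"

definition kcycles :: "nat \<Rightarrow> 'a topology \<Rightarrow> ('k::field, 'a) kchain set"
  where "kcycles p X = {c \<in> kchains p X. kboundary p c = 0}"

definition kbounds :: "nat \<Rightarrow> 'a topology \<Rightarrow> ('k::field, 'a) kchain set"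
  where "kbounds p X = kboundary (Suc p) ` kchains (Suc p) X"

lemma carrier_chain_space: "carrier (chain_space K p X) = kchains p X"
  by (simp add: chain_space_def kchains_def)

lemma carrier_cycle_space: "carrier (cycle_space K p X) = kcycles p X"
  by (simp add: cycle_space_def kcycles_def carrier_chain_space)

lemma boundaries_eq_kbounds: "boundaries K p X = kbounds p X"
  by (simp add: boundaries_def kbounds_def carrier_chain_space)

lemma kextend_diff: "kextend g (c - c') = kextend g c - kextend g c'"
  using kextend_add[of g "c - c'" c'] by simp

lemma kboundary_diff: "kboundary p (c - c') = kboundary p c - kboundary p c'"
  by (simp add: kboundary_def kextend_diff)

lemma kchain_map_diff: "kchain_map p f (c - c') = kchain_map p f c - kchain_map p f c'"
  by (simp add: kchain_map_def kextend_diff)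

lemma subspace_kchains: "kv.subspace (kchains p X)"
  using chain_space_closed[where p = p and X = X] unfolding kv.subspace_def carrier_chain_space by blast

lemma subspace_kcycles: "kv.subspace (kcycles p X)"
  using subspace_kchains[of p X] unfolding kv.subspace_def kcycles_def
  by (auto simp: kboundary_linear kscale_simps)

lemma subspace_kbounds: "kv.subspace (kbounds p X :: ('b::field, 'a) kchain set)"
  unfolding kv.subspace_def kbounds_def
proof (intro conjI ballI allI)
  note S = subspace_kchains[of "Suc p" X]
  show "0 \<in> kboundary (Suc p) ` kchains (Suc p) X"
    by (metis imageI kboundary_linear(3) kv.subspace_0[OF S])
  fix x y :: "('b, 'a) kchain" and a :: 'b
  assume x: "x \<in> kboundary (Suc p) ` kchains (Suc p) X"
  show "kscale a x \<in> kboundary (Suc p) ` kchains (Suc p) X"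
    using x by (auto simp flip: kboundary_linear(2) intro!: imageI kv.subspace_scale[OF S])
  assume y: "y \<in> kboundary (Suc p) ` kchains (Suc p) X"
  show "x + y \<in> kboundary (Suc p) ` kchains (Suc p) X"
    using x y by (auto simp flip: kboundary_linear(1) intro!: imageI kv.subspace_add[OF S])
qed

lemmas kchains_closed =
  kv.subspace_0[OF subspace_kchains] kv.subspace_add[OF subspace_kchains]
  kv.subspace_diff[OF subspace_kchains] kv.subspace_neg[OF subspace_kchains]
  kv.subspace_scale[OF subspace_kchains]

lemmas kcycles_closed =
  kv.subspace_0[OF subspace_kcycles] kv.subspace_add[OF subspace_kcycles]
  kv.subspace_diff[OF subspace_kcycles] kv.subspace_neg[OF subspace_kcycles]
  kv.subspace_scale[OF subspace_kcycles]

lemmas kbounds_closed =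
  kv.subspace_0[OF subspace_kbounds] kv.subspace_add[OF subspace_kbounds]
  kv.subspace_diff[OF subspace_kbounds] kv.subspace_neg[OF subspace_kbounds]
  kv.subspace_scale[OF subspace_kbounds]

lemma kbounds_subset_kcycles: "kbounds p X \<subseteq> kcycles p X"
  using submodule.subset[OF submodule_boundaries[of undefined p X]]
  by (simp add: boundaries_eq_kbounds carrier_cycle_space)

lemma kcycles_chains: "c \<in> kcycles p X \<Longrightarrow> c \<in> kchains p X"
  by (simp add: kcycles_def)

lemma kboundary_kchains: "c \<in> kchains (Suc p) X \<Longrightarrow> kboundary (Suc p) c \<in> kbounds p X"
  by (simp add: kbounds_def)

lemma base_change_0: "base_change 0 = 0"
  by (simp add: poly_mapping_eq_iff fun_eq_iff lookup_base_change)

lemma kboundary_0 [simp]: "kboundary 0 c = 0"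
  by (simp add: kboundary_def chain_boundary_def kextend_def kscale_simps base_change_0)

lemma kboundary_kcycle:
  assumes "c \<in> kchains p X" shows "kboundary p c \<in> kcycles (p - 1) X"
proof (cases p)
  case 0
  then show ?thesis
    by (simp add: kcycles_closed(1))
next
  case (Suc q)
  then show ?thesis
    using kboundary_kchains[of c q X] assms kbounds_subset_kcycles by auto
qed

lemma kchains_map:
  "\<lbrakk>c \<in> kchains p X; continuous_map X Y f\<rbrakk> \<Longrightarrow> kchain_map p f c \<in> kchains p Y"
  using kchain_map_in_chain_space[where K = undefined] by (simp add: carrier_chain_space)

lemma kcycles_map:
  "\<lbrakk>c \<in> kcycles p X; continuous_map X Y f\<rbrakk> \<Longrightarrow> kchain_map p f c \<in> kcycles p Y"
  using kchain_map_cycle[where K = undefined] by (simp add: carrier_cycle_space)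

lemma kbounds_map:
  "\<lbrakk>c \<in> kbounds p X; continuous_map X Y f\<rbrakk> \<Longrightarrow> kchain_map p f c \<in> kbounds p Y"
  using kchain_map_boundary[where K = undefined] by (simp add: boundaries_eq_kbounds)

lemma kboundary_map:
  "c \<in> kchains p X \<Longrightarrow> kboundary p (kchain_map p f c) = kchain_map (p - 1) f (kboundary p c)"
  using kboundary_kchain_map[where K = undefined] by (simp add: carrier_chain_space)

lemma kchain_map_compose: "kchain_map p g (kchain_map p f c) = kchain_map p (\<lambda>x. g (f x)) c"
proof -
  have "simplex_map p g (simplex_map p f s) = simplex_map p (\<lambda>x. g (f x)) s" for s
    by (auto simp: simplex_map_def)
  then show ?thesis
    unfolding kchain_map_def kextend_kextend by (simp add: kscale_simps)
qed

lemma kchain_map_eq: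
  assumes "c \<in> kchains p X" "\<And>x. x \<in> topspace X \<Longrightarrow> f x = g x"
  shows "kchain_map p f c = kchain_map p g c"
  unfolding kchain_map_def
  by (rule kextend_cong) (use assms in \<open>auto simp: kchains_def intro!: arg_cong[where f = "\<lambda>s. Poly_Mapping.single s 1"] simplex_map_eq\<close>)

lemma kextend_singles: "kextend (\<lambda>s. Poly_Mapping.single s 1) c = c"
proof -
  have "kextend (\<lambda>s. Poly_Mapping.single s 1) c =
      (\<Sum>s\<in>Poly_Mapping.keys c. Poly_Mapping.single s (Poly_Mapping.lookup c s))"
    unfolding kextend_def by (intro sum.cong refl) (simp add: poly_mapping_eq_iff fun_eq_iff lookup_single when_def)
  then show ?thesis
    by (simp add: poly_mapping_eq_iff fun_eq_iff lookup_sum lookup_single when_def sum.delta in_keys_iff)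
qed

lemma kchain_map_id:
  assumes "c \<in> kchains p X" "\<And>x. x \<in> topspace X \<Longrightarrow> f x = x"
  shows "kchain_map p f c = c"
proof -
  have "kchain_map p f c = kextend (\<lambda>s. Poly_Mapping.single s 1) c"
    unfolding kchain_map_def
    by (rule kextend_cong) (use assms simplex_map_id_gen in \<open>fastforce simp: kchains_def\<close>)
  then show ?thesis by (simp add: kextend_singles)
qed

lemma kchains_subtopology:
  "c \<in> kchains p (subtopology X S) \<longleftrightarrow>
    c \<in> kchains p X \<and> (\<forall>s\<in>Poly_Mapping.keys c. s ` standard_simplex p \<subseteq> S)"
  unfolding kchains_def by (force simp: singular_simplex_subtopology)

lemma kchains_mono:
  "\<lbrakk>c \<in> kchains p (subtopology X S); S \<subseteq> T\<rbrakk> \<Longrightarrow> c \<in> kchains p (subtopology X T)"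
  by (auto simp: kchains_subtopology)

lemma kchains_from_sub: "c \<in> kchains p (subtopology X S) \<Longrightarrow> c \<in> kchains p X"
  by (simp add: kchains_subtopology)

lemma kbounds_from_sub: "c \<in> kbounds p (subtopology X S) \<Longrightarrow> c \<in> kbounds p X"
  by (auto simp: kbounds_def kchains_subtopology)

section \<open>Linear algebra\<close>

text \<open>
  Modulo \<open>B\<close>, the subspace \<open>L\<close> sits inside the span of \<open>S\<close>, so its dimension is at most \<open>card S\<close>; the
  vectors of \<open>S\<close> are exchanged one at a time for vectors of \<open>L\<close>.
\<close>

lemma (in vector_space) subspace_spanning_subset:
  assumes "finite S" "subspace L" "L \<subseteq> span (B \<union> S)"
  shows "\<exists>S'\<subseteq>L. finite S' \<and> card S' \<le> card S \<and> L \<subseteq> span (B \<union> S')"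
  using assms
proof (induction S arbitrary: L rule: finite_induct)
  case empty
  then show ?case by (intro exI[of _ "{}"]) auto
next
  case (insert s F)
  define L' where "L' = L \<inter> span (B \<union> F)"
  have "subspace L'" unfolding L'_def by (intro subspace_inter insert.prems subspace_span)
  from insert.IH[OF this] obtain S' where S': "S' \<subseteq> L'" "finite S'" "card S' \<le> card F" "L' \<subseteq> span (B \<union> S')"
    unfolding L'_def by blast
  show ?case
  proof (cases "L \<subseteq> L'")
    case True
    then show ?thesis
      using S' insert.hyps by (intro exI[of _ S']) (auto simp: L'_def)
  next
    case False
    then obtain l where l: "l \<in> L" "l \<notin> span (B \<union> F)" unfolding L'_def by blast
    have ex: "\<exists>k. x - scale k s \<in> span (B \<union> F)" if "x \<in> L" for x
      using that insert.prems(2) span_breakdown_eq[of x s "B \<union> F"] by auto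
    from ex[OF l(1)] obtain k where k: "l - scale k s \<in> span (B \<union> F)" by blast
    with l(2) have "k \<noteq> 0" by auto
    have "x \<in> span (B \<union> insert l S')" if x: "x \<in> L" for x
    proof -
      from ex[OF x] obtain k' where k': "x - scale k' s \<in> span (B \<union> F)" by blast
      have "x - scale (k' / k) l = (x - scale k' s) - scale (k' / k) (l - scale k s)"
        using \<open>k \<noteq> 0\<close> by (simp add: algebra_simps)
      also have "\<dots> \<in> span (B \<union> F)" by (intro span_diff span_scale k k')
      finally have "x - scale (k' / k) l \<in> L'"
        unfolding L'_def using insert.prems(1) x l(1) by (simp add: subspace_diff subspace_scale)
      then have "x - scale (k' / k) l \<in> span (B \<union> S')" using S' by blast
      then show ?thesis
        using span_breakdown_eq[of x l "B \<union> S'"] by auto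
    qed
    then show ?thesis
      using S' l(1) insert.hyps card_insert_le_m1[of "card (insert s F)" S' l]
      by (intro exI[of _ "insert l S'"]) (auto simp: L'_def card_insert_if)
  qed
qed

text \<open>
  \<open>R\<close> plays the role of a linear map that is only well defined after choices, such as a connecting
  homomorphism. The dimension of its domain is bounded by those of its kernel and its range: vectors of
  the range that span it are lifted, and these lifts correct any \<open>z\<close> to an element of the kernel.
\<close>

lemma kspan_lift:
  fixes R :: "('b \<Rightarrow>\<^sub>0 'k::field) \<Rightarrow> ('c \<Rightarrow>\<^sub>0 'k) \<Rightarrow> bool"
  assumes zero: "R 0 0"
    and add: "\<And>z w z' w'. \<lbrakk>R z w; R z' w'\<rbrakk> \<Longrightarrow> R (z + z') (w + w')"
    and scale: "\<And>a z w. R z w \<Longrightarrow> R (kscale a z) (kscale a w)"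
    and total: "\<And>z. z \<in> Z \<Longrightarrow> \<exists>w. R z w"
    and range: "\<And>z w. R z w \<Longrightarrow> w \<in> kv.span (B \<union> S)"
    and kernel: "\<And>z w. \<lbrakk>R z w; w \<in> kv.span B\<rbrakk> \<Longrightarrow> z \<in> kv.span K"
    and S: "finite S"
  shows "\<exists>S'. finite S' \<and> card S' \<le> card S \<and> Z \<subseteq> kv.span (K \<union> S')"
proof -
  define L where "L = {w. \<exists>z. R z w}"
  have "kv.subspace L"
    unfolding kv.subspace_def L_def using zero add scale by blast
  moreover have "L \<subseteq> kv.span (B \<union> S)" unfolding L_def using range by blast
  ultimately obtain S' where S': "S' \<subseteq> L" "finite S'" "card S' \<le> card S" "L \<subseteq> kv.span (B \<union> S')"
    using kv.subspace_spanning_subset[OF S] by blast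
  from S'(1) have "\<forall>s\<in>S'. \<exists>z. R z s" unfolding L_def by blast
  then obtain g where g: "\<And>s. s \<in> S' \<Longrightarrow> R (g s) s"
    by (auto simp: bchoice_iff)
  have Rsum: "R (\<Sum>s\<in>F. kscale (u s) (g s)) (\<Sum>s\<in>F. kscale (u s) s)" if "finite F" "F \<subseteq> S'" for F u
    using that by (induction F rule: finite_induct) (auto intro: zero add scale g)
  have "z \<in> kv.span (K \<union> g ` S')" if z: "z \<in> Z" for z
  proof -
    from total[OF z] obtain w where w: "R z w" by blast
    then have "w \<in> kv.span (B \<union> S')" using S' unfolding L_def by blast
    then obtain b e where be: "b \<in> kv.span B" "e \<in> kv.span S'" "w = b + e"
      unfolding kv.span_Un by blast
    then obtain u where u: "e = (\<Sum>s\<in>S'. kscale (u s) s)"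
      unfolding kv.span_finite[OF S'(2)] by blast
    have "R (z + kscale (-1) (\<Sum>s\<in>S'. kscale (u s) (g s))) (w + kscale (-1) e)"
      unfolding u by (intro add scale Rsum w S') auto
    then have "R (z - (\<Sum>s\<in>S'. kscale (u s) (g s))) b" by (simp add: be)
    then have "z - (\<Sum>s\<in>S'. kscale (u s) (g s)) \<in> kv.span K" using kernel be by blast
    moreover have "(\<Sum>s\<in>S'. kscale (u s) (g s)) \<in> kv.span (g ` S')"
      by (intro kv.span_sum kv.span_scale kv.span_base) auto
    ultimately have "(z - (\<Sum>s\<in>S'. kscale (u s) (g s))) + (\<Sum>s\<in>S'. kscale (u s) (g s)) \<in> kv.span (K \<union> g ` S')"
      unfolding kv.span_Un by blast
    then show ?thesis by simp
  qed
  then show ?thesis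
    using S' card_image_le[OF S'(2), of g] by (intro exI[of _ "g ` S'"]) (auto intro: order_trans)
qed

section \<open>Extending scalars of integral chain operators\<close>

text \<open>
  The \<open>'k\<close>-linear extension of an operator on integral chains. For additive operators the extension is
  compatible with composition, sums and differences, so identities between natural integral operators
  carry over to every field.
\<close>

definition kop ::
    "('a chain \<Rightarrow> 'b chain) \<Rightarrow> ('k::field, 'a) kchain \<Rightarrow> ('k, 'b) kchain"
  where "kop A = kextend (\<lambda>s. base_change (A (frag_of s)))"

lemma kboundary_kop: "kboundary p = kop (chain_boundary p)"
  by (simp add: kboundary_def kop_def)

lemma kchain_map_kop: "kchain_map p f = kop (chain_map p f)"
  by (simp add: kchain_map_def kop_def base_change_frag_of fun_eq_iff)

lemma additive_frag_extend:
  assumes "A 0 = 0" "\<And>c c'. A (c - c') = A c - A c'"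
  shows "frag_extend (\<lambda>s. A (frag_of s)) c = A c"
  by (rule frag_induction[where S = UNIV and P = "\<lambda>c. frag_extend (\<lambda>s. A (frag_of s)) c = A c"])
    (simp_all add: assms frag_extend_diff)

lemma kop_kop:
  assumes "A 0 = 0" "\<And>c c'. A (c - c') = A c - A c'"
  shows "kop A (kop B c) = kop (\<lambda>x. A (B x)) c"
  unfolding kop_def kextend_kextend
  by (simp add: kextend_base_change additive_frag_extend[OF assms])

lemma base_change_diff: "base_change (c - c') = base_change c - base_change c'"
  by (simp add: poly_mapping_eq_iff fun_eq_iff lookup_base_change lookup_minus)

lemma base_change_add: "base_change (c + c') = base_change c + base_change c'"
  by (simp add: poly_mapping_eq_iff fun_eq_iff lookup_base_change lookup_add)

lemma kop_add: "kop (\<lambda>x. A x + B x) c = kop A c + kop B c"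
  by (simp add: kop_def kextend_def base_change_add kscale_simps sum.distrib)

lemma kop_diff: "kop (\<lambda>x. A x - B x) c = kop A c - kop B c"
  by (simp add: kop_def kextend_def base_change_diff kv.scale_right_diff_distrib sum_subtractf)

lemma kop_cong: "(\<And>s. s \<in> Poly_Mapping.keys c \<Longrightarrow> A (frag_of s) = B (frag_of s)) \<Longrightarrow> kop A c = kop B c"
  unfolding kop_def by (rule kextend_cong) simp

lemma kop_zero: "kop A 0 = 0"
  by (simp add: kop_def)

lemma kop_ident: "kop (\<lambda>x. x) c = c"
  by (simp add: kop_def base_change_frag_of kextend_singles)

lemma keys_kop:
  fixes c :: "('k::field, 'a) kchain" and A :: "'a chain \<Rightarrow> 'b chain"
  shows "Poly_Mapping.keys (kop A c) \<subseteq> (\<Union>s\<in>Poly_Mapping.keys c. Poly_Mapping.keys (A (frag_of s)))"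
proof -
  have "Poly_Mapping.keys (base_change e :: ('k, 'b) kchain) \<subseteq> Poly_Mapping.keys e" for e
    by (auto simp: in_keys_iff lookup_base_change)
  then show ?thesis
    unfolding kop_def by (intro order_trans[OF keys_kextend] UN_mono subset_refl)
qed

lemma kop_kchains:
  assumes "c \<in> kchains p X"
    and "\<And>s. singular_simplex p X s \<Longrightarrow> singular_chain q Y (A (frag_of s))"
  shows "kop A c \<in> kchains q Y"
  using keys_kop[of A c] assms unfolding kchains_def singular_chain_def by blast

section \<open>Homotopy invariance\<close>

text \<open>
  The contraction makes a cycle homologous to a cycle supported at a point, and a point has no homology in
  positive degrees.
\<close>

lemma contractible_cycle_bounds:
  assumes "contractible_space X" "1 \<le> q" "singular_relcycle q X {} c"
  shows "singular_relboundary q X {} c"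
proof -
  obtain a where hom: "homotopic_with (\<lambda>x. True) X X id (\<lambda>x. a)"
    using assms(1) unfolding contractible_space_def by blast
  have c: "singular_chain q X c" using assms(3) by (simp add: singular_cycle)
  show ?thesis
  proof (cases "topspace X = {}")
    case True
    then show ?thesis
      using c by (simp add: singular_chain_empty)
  next
    case False
    have "homotopic_with (\<lambda>h. h \<in> {} \<rightarrow> {}) X X id (\<lambda>x. a)"
      using hom by simp
    from homotopic_imp_homologous_rel_chain_maps[OF this assms(3)]
    have 1: "homologous_rel q X {} c (chain_map q (\<lambda>x. a) c)"
      by (simp add: chain_map_ident[OF c])
    have a: "a \<in> topspace X"
      using homotopic_with_imp_continuous_maps[OF hom] False by (auto simp: continuous_map_def)
    have "continuous_map X (subtopology X {a}) (\<lambda>x. a)"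
      using a by (auto simp: continuous_map_in_subtopology)
    then have "singular_relcycle q (subtopology X {a}) {} (chain_map q (\<lambda>x. a) c)"
      using singular_relcycle_chain_map[OF assms(3)] by (metis empty_subsetI image_empty image_is_empty Pi_empty UNIV_I)
    moreover have "topspace (subtopology X {a}) = {a}" using a by auto
    ultimately have "singular_relboundary q (subtopology X {a}) {} (chain_map q (\<lambda>x. a) c)"
      using singular_boundary_eq_cycle_singleton[of "subtopology X {a}" a q] assms(2) by blast
    then have "singular_relboundary q X {} (chain_map q (\<lambda>x. a) c)"
      by (metis singular_boundary_mono subtopology_topspace subtopology_UNIV UNIV_I subset_UNIV singular_boundary singular_chain_subtopology)
    with 1 show ?thesis
      unfolding homologous_rel_def
      by (metis diff_add_cancel singular_relboundary_add)
  qed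
qed

abbreviation simplex_space :: "nat \<Rightarrow> (nat \<Rightarrow> real) topology"
  where "simplex_space p \<equiv> subtopology (powertop_real UNIV) (standard_simplex p)"

abbreviation cylinder :: "'a topology \<Rightarrow> (real \<times> 'a) topology"
  where "cylinder X \<equiv> prod_topology (top_of_set {0..1}) X"

abbreviation iota :: "nat \<Rightarrow> (nat \<Rightarrow> real) \<Rightarrow> (nat \<Rightarrow> real)"
  where "iota p \<equiv> restrict id (standard_simplex p)"

lemma homotopic_straight_line:
  fixes f g :: "'a \<Rightarrow> 'i \<Rightarrow> real"
  assumes f: "continuous_map Z (powertop_real UNIV) f" and g: "continuous_map Z (powertop_real UNIV) g"
    and S: "\<And>z t. \<lbrakk>z \<in> topspace Z; 0 \<le> t; t \<le> 1\<rbrakk> \<Longrightarrow> (\<lambda>i. (1 - t) * f z i + t * g z i) \<in> S"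
  shows "homotopic_with (\<lambda>_. True) Z (subtopology (powertop_real UNIV) S) f g"
  unfolding homotopic_with_def
proof (intro exI[of _ "\<lambda>(t, z) i. (1 - t) * f z i + t * g z i"] conjI allI ballI)
  show "continuous_map (cylinder Z) (subtopology (powertop_real UNIV) S) (\<lambda>(t, z) i. (1 - t) * f z i + t * g z i)"
    unfolding continuous_map_in_subtopology
  proof
    show "continuous_map (cylinder Z) (powertop_real UNIV) (\<lambda>(t, z) i. (1 - t) * f z i + t * g z i)"
      unfolding continuous_map_componentwise_UNIV case_prod_beta
    proof
      fix i :: 'i
      have 1: "continuous_map (cylinder Z) euclideanreal fst"
        using continuous_map_fst continuous_map_into_fulltopology by blast
      have "continuous_map (cylinder Z) euclideanreal (\<lambda>z. h (snd z) i)"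
        if "continuous_map Z (powertop_real UNIV) h" for h :: "'a \<Rightarrow> 'i \<Rightarrow> real"
        using continuous_map_compose[OF continuous_map_snd, of Z euclideanreal "\<lambda>x. h x i"] that
        by (simp add: o_def continuous_map_componentwise_UNIV)
      from this[OF f] this[OF g] 1
      show "continuous_map (cylinder Z) euclideanreal (\<lambda>z. (1 - fst z) * f (snd z) i + fst z * g (snd z) i)"
        by (intro continuous_intros)
    qed
  qed (use S in auto)
qed auto

lemma contractible_simplex_space: "contractible_space (simplex_space p)"
  unfolding contractible_space_def
proof
  define a :: "nat \<Rightarrow> real" where "a = (\<lambda>i. if i = 0 then 1 else 0)"
  have a: "a \<in> standard_simplex p" unfolding a_def using basis_in_standard_simplex[of 0 p] by simp
  have "continuous_map (simplex_space p) (powertop_real UNIV) id"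
    by (intro continuous_map_from_subtopology continuous_map_id)
  then show "homotopic_with (\<lambda>x. True) (simplex_space p) (simplex_space p) id (\<lambda>x. a)"
    using convex_standard_simplex a by (intro homotopic_straight_line) auto
qed

lemma contractible_cylinder_simplex: "contractible_space (cylinder (simplex_space p))"
  by (simp add: contractible_space_prod_topology contractible_simplex_space convex_imp_contractible is_interval_1)

text \<open>
  A chain \<open>e\<close> in the cylinder over the standard simplex is a universal example: pushing it forward along
  singular simplices gives a natural operator from chains of any space to chains of its cylinder.
\<close>

definition prism :: "nat \<Rightarrow> (real \<times> (nat \<Rightarrow> real)) chain \<Rightarrow> 'a chain \<Rightarrow> (real \<times> 'a) chain"
  where "prism p e = frag_extend (\<lambda>s. chain_map (Suc p) (map_prod id s) e)"

lemma prism_0 [simp]: "prism p e 0 = 0"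
  by (simp add: prism_def)

lemma prism_diff: "prism p e (c - c') = prism p e c - prism p e c'"
  by (simp add: prism_def frag_extend_diff)

lemma continuous_map_prod_simplex:
  "singular_simplex p X s \<Longrightarrow> continuous_map (cylinder (simplex_space p)) (cylinder X) (map_prod id s)"
  unfolding map_prod_def by (simp add: continuous_map_prod_top singular_simplex_def continuous_map_into_fulltopology continuous_map_from_subtopology)

lemma singular_chain_prism:
  assumes e: "singular_chain (Suc p) (cylinder (simplex_space p)) e" and c: "singular_chain p X c"
  shows "singular_chain (Suc p) (cylinder X) (prism p e c)"
  unfolding prism_def
proof (rule singular_chain_extend)
  fix s assume "s \<in> Poly_Mapping.keys c"
  then have "singular_simplex p X s" using c by (auto simp: singular_chain_def)
  then show "singular_chain (Suc p) (cylinder X) (chain_map (Suc p) (map_prod id s) e)"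
    by (intro singular_chain_chain_map[OF e] continuous_map_prod_simplex)
qed

lemma prism_natural:
  assumes e: "singular_chain (Suc p) (cylinder (simplex_space p)) e" and c: "singular_chain p X c"
  shows "chain_map (Suc p) (map_prod id g) (prism p e c) = prism p e (chain_map p g c)"
  using c unfolding singular_chain_def
proof (induction c rule: frag_induction)
  case (one s)
  have "chain_map (Suc p) (map_prod id g) (chain_map (Suc p) (map_prod id s) e)
      = chain_map (Suc p) (map_prod id (simplex_map p g s)) e"
    unfolding chain_map_compose[symmetric, unfolded o_def fun_eq_iff, rule_format]
    by (rule chain_map_eq[OF e]) (auto simp: simplex_map_def)
  then show ?case by (simp add: prism_def id_def)
qed (auto simp: prism_diff chain_map_diff)

text \<open>
  The equation \<open>\<partial>P = top - bottom - P\<partial>\<close> of a chain homotopy, required only for the universal simplex in degree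
  \<open>p\<close>. Here \<open>e'\<close> is the universal chain one degree lower; in degree 0 the last term vanishes, as the
  boundary of a point is 0.
\<close>

definition prism_step :: "nat \<Rightarrow> (real \<times> (nat \<Rightarrow> real)) chain \<Rightarrow> (real \<times> (nat \<Rightarrow> real)) chain \<Rightarrow> bool"
  where "prism_step p e' e \<longleftrightarrow> singular_chain (Suc p) (cylinder (simplex_space p)) e \<and>
    chain_boundary (Suc p) e = chain_map p (Pair 1) (frag_of (iota p)) - chain_map p (Pair 0) (frag_of (iota p))
      - prism (p - 1) e' (chain_boundary p (frag_of (iota p)))"

lemma singular_chain_iota: "singular_chain p (simplex_space p) (frag_of (iota p))"
  by (auto simp: singular_chain_of singular_simplex_def intro: continuous_map_eq[OF continuous_map_id])

text \<open>
  Every singular simplex is the image of the universal one, so naturality spreads the equation for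
  the universal simplex to all chains.
\<close>

lemma chain_boundary_prism:
  assumes step: "prism_step p e' e" and c: "singular_chain p X c"
    and e': "0 < p \<Longrightarrow> singular_chain p (cylinder (simplex_space (p - 1))) e'"
  shows "chain_boundary (Suc p) (prism p e c)
    = chain_map p (Pair 1) c - chain_map p (Pair 0) c - prism (p - 1) e' (chain_boundary p c)"
  using c unfolding singular_chain_def
proof (induction c rule: frag_induction)
  case (one s)
  then have s: "singular_simplex p X s" by simp
  have e: "singular_chain (Suc p) (cylinder (simplex_space p)) e"
    using step by (simp add: prism_step_def)
  let ?m = "map_prod id s :: real \<times> _ \<Rightarrow> _"
  have io: "chain_map p s (frag_of (iota p)) = frag_of s"
    by (rule singular_simplex_chain_map_id[OF s])
  have pr: "chain_map p ?m (chain_map p (Pair t) (frag_of (iota p))) = chain_map p (Pair t) (frag_of s)" for t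
  proof -
    have "chain_map p (?m \<circ> Pair t) (frag_of (iota p)) = chain_map p (Pair t \<circ> s) (frag_of (iota p))"
      by (simp add: o_def)
    then show ?thesis by (simp only: chain_map_compose o_apply io)
  qed
  have bd: "chain_map p ?m (prism (p - 1) e' (chain_boundary p (frag_of (iota p))))
      = prism (p - 1) e' (chain_boundary p (frag_of s))"
  proof (cases "p = 0")
    case False
    then have "chain_map p ?m (prism (p - 1) e' (chain_boundary p (frag_of (iota p))))
        = prism (p - 1) e' (chain_map (p - 1) s (chain_boundary p (frag_of (iota p))))"
      using prism_natural[of "p - 1" e' "simplex_space p" "chain_boundary p (frag_of (iota p))" s]
        singular_chain_boundary[OF singular_chain_iota, of p] e' by simp
    also have "chain_map (p - 1) s (chain_boundary p (frag_of (iota p))) = chain_boundary p (frag_of s)"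
      using chain_boundary_chain_map[OF singular_chain_iota, of p s] io by simp
    finally show ?thesis .
  qed (simp add: chain_boundary_def)
  have "chain_boundary (Suc p) (prism p e (frag_of s)) = chain_map p ?m (chain_boundary (Suc p) e)"
    using chain_boundary_chain_map[OF e, of ?m] by (simp add: prism_def)
  also have "\<dots> = chain_map p (Pair 1) (frag_of s) - chain_map p (Pair 0) (frag_of s)
      - prism (p - 1) e' (chain_boundary p (frag_of s))"
    using step by (simp only: prism_step_def chain_map_diff pr bd)
  finally show ?case .
qed (auto simp: prism_diff chain_map_diff chain_boundary_diff algebra_simps)

lemma continuous_map_Pair_cylinder: "t \<in> {0..1} \<Longrightarrow> continuous_map X (cylinder X) (Pair t)"
  by (simp add: continuous_map_pairwise o_def)

text \<open>
  The acyclic model argument: the prescribed boundary is a cycle, by the chain homotopy equation one degree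
  lower, and it bounds because the cylinder over a simplex is contractible.
\<close>

lemma prism_step_exists:
  assumes step: "prism_step p e' e" 
    and e': "0 < p \<Longrightarrow> singular_chain p (cylinder (simplex_space (p - 1))) e'"
  shows "\<exists>e''. prism_step (Suc p) e e''"
proof -
  let ?i = "frag_of (iota (Suc p))"
  let ?M = "cylinder (simplex_space (Suc p))"
  have e: "singular_chain (Suc p) (cylinder (simplex_space p)) e"
    using step by (simp add: prism_step_def)
  define r where "r = chain_map (Suc p) (Pair 1) ?i - chain_map (Suc p) (Pair 0) ?i
      - prism p e (chain_boundary (Suc p) ?i)"
  have i: "singular_chain (Suc p) (simplex_space (Suc p)) ?i" by (rule singular_chain_iota)
  note bi = singular_chain_boundary_alt[OF i]
  have "singular_chain (Suc p) ?M r"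
    unfolding r_def
    by (intro singular_chain_diff singular_chain_prism e bi singular_chain_chain_map[OF i] continuous_map_Pair_cylinder) auto
  moreover have "chain_boundary (Suc p) r = 0"
    using chain_boundary_prism[OF step bi e']
    by (simp add: r_def chain_boundary_diff chain_boundary_chain_map[OF i] chain_boundary_boundary_alt[OF i] del: chain_map_of)
  ultimately have "singular_relboundary (Suc p) ?M {} r"
    by (intro contractible_cycle_bounds contractible_cylinder_simplex) (auto simp: singular_cycle)
  then show ?thesis
    unfolding singular_boundary prism_step_def r_def by auto
qed

lemma prism_sequence_exists:
  "\<exists>e. \<forall>p. prism_step p (e (p - 1)) (e p)"
proof -
  let ?P = "\<lambda>p e. singular_chain (Suc p) (cylinder (simplex_space p)) e \<and>
    (\<exists>e'. (0 < p \<longrightarrow> singular_chain p (cylinder (simplex_space (p - 1))) e') \<and> prism_step p e' e)"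
  have "\<exists>e. ?P 0 e"
  proof -
    have "homotopic_with (\<lambda>h. h \<in> {} \<rightarrow> {}) (simplex_space 0) (cylinder (simplex_space 0)) (Pair 0) (Pair 1)"
      unfolding homotopic_with_def by (intro exI[of _ "\<lambda>z. z"]) auto
    moreover have "singular_relcycle 0 (simplex_space 0) {} (frag_of (iota 0))"
      by (simp add: singular_cycle singular_chain_iota chain_boundary_def)
    ultimately have "homologous_rel 0 (cylinder (simplex_space 0)) {}
        (chain_map 0 (Pair 1) (frag_of (iota 0))) (chain_map 0 (Pair 0) (frag_of (iota 0)))"
      using homotopic_imp_homologous_rel_chain_maps homologous_rel_sym by blast
    then show ?thesis
      by (auto simp: homologous_rel_def singular_boundary prism_step_def chain_boundary_def[of 0] cong: conj_cong)
  qed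
  moreover have "\<exists>e''. ?P (Suc p) e'' \<and> prism_step (Suc p) e e''" if e: "?P p e" for p e
  proof -
    from e obtain e' where "0 < p \<longrightarrow> singular_chain p (cylinder (simplex_space (p - 1))) e'" "prism_step p e' e"
      by blast
    then obtain e'' where "prism_step (Suc p) e e''" using prism_step_exists by blast
    then show ?thesis using e unfolding prism_step_def by auto
  qed
  ultimately obtain e where e: "\<And>p. ?P p (e p) \<and> prism_step (Suc p) (e p) (e (Suc p))"
    using dependent_nat_choice[of ?P "\<lambda>p. prism_step (Suc p)"] by blast
  have "prism_step p (e (p - 1)) (e p)" for p
  proof (cases p)
    case 0
    then show ?thesis using e[of 0] by (auto simp: prism_step_def chain_boundary_def[of 0])
  next
    case (Suc q)
    then show ?thesis using e[of q] by simp
  qed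
  then show ?thesis by blast
qed

theorem kchain_map_homotopic:
  fixes c :: "('k::field, 'a) kchain" and Y :: "'b topology"
  assumes hom: "homotopic_with (\<lambda>_. True) X Y f g" and c: "c \<in> kcycles p X"
  shows "kchain_map p g c - kchain_map p f c \<in> kbounds p Y"
proof -
  obtain h where h: "continuous_map (cylinder X) Y h" "\<And>x. h (0, x) = f x" "\<And>x. h (1, x) = g x"
    using hom unfolding homotopic_with_def by blast
  obtain e where e: "\<And>p. prism_step p (e (p - 1)) (e p)"
    using prism_sequence_exists by blast
  have esc: "singular_chain (Suc p) (cylinder (simplex_space p)) (e p)" for p
    using e by (simp add: prism_step_def)
  define D :: "nat \<Rightarrow> 'a chain \<Rightarrow> (real \<times> 'a) chain" where "D = (\<lambda>p. prism p (e p))"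
  have cc: "c \<in> kchains p X" and c0: "kop (chain_boundary p) c = 0"
    using c by (auto simp: kcycles_def kboundary_kop)
  have Dc: "kop (D p) c \<in> kchains (Suc p) (cylinder X)"
    by (rule kop_kchains[OF cc]) (simp add: D_def singular_chain_prism[OF esc] singular_chain_of)
  have "kboundary (Suc p) (kop (D p) c) = kop (\<lambda>x. chain_boundary (Suc p) (D p x)) c"
    unfolding kboundary_kop by (rule kop_kop) (auto simp: chain_boundary_diff)
  also have "\<dots> = kop (\<lambda>x. chain_map p (Pair 1) x - chain_map p (Pair 0) x - D (p - 1) (chain_boundary p x)) c"
  proof (rule kop_cong)
    fix s assume "s \<in> Poly_Mapping.keys c"
    then have s: "singular_chain p X (frag_of s)" using cc by (auto simp: kchains_def singular_chain_of)
    show "chain_boundary (Suc p) (D p (frag_of s)) = chain_map p (Pair 1) (frag_of s)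
        - chain_map p (Pair 0) (frag_of s) - D (p - 1) (chain_boundary p (frag_of s))"
      unfolding D_def using chain_boundary_prism[OF e s] esc[of "p - 1"] by (cases p) (simp_all del: chain_map_of)
  qed
  also have "\<dots> = kchain_map p (Pair 1) c - kchain_map p (Pair 0) c - kop (D (p - 1)) (kop (chain_boundary p) c)"
    by (simp add: kop_diff kchain_map_kop kop_kop D_def prism_diff)
  finally have bd: "kboundary (Suc p) (kop (D p) c) = kchain_map p (Pair 1) c - kchain_map p (Pair 0) c"
    by (simp only: c0 kop_zero diff_zero)
  have "kboundary (Suc p) (kchain_map (Suc p) h (kop (D p) c)) = kchain_map p g c - kchain_map p f c"
    using kboundary_map[OF Dc, of h] by (simp add: bd kchain_map_diff kchain_map_compose h)
  then show ?thesis
    using kboundary_kchains[OF kchains_map[OF Dc h(1)]] by simp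
qed


section \<open>Mayer-Vietoris for open covers\<close>

lemma kchains_split:
  assumes e: "e \<in> kchains p T"
    and sub: "\<And>s. s \<in> Poly_Mapping.keys e \<Longrightarrow> s ` standard_simplex p \<subseteq> U \<or> s ` standard_simplex p \<subseteq> V"
  obtains a b where "e = a + b" "a \<in> kchains p (subtopology T U)" "b \<in> kchains p (subtopology T V)"
proof -
  let ?S = "{s \<in> Poly_Mapping.keys e. s ` standard_simplex p \<subseteq> U}"
  let ?f = "\<lambda>s. kscale (Poly_Mapping.lookup e s) (Poly_Mapping.single s 1)"
  have "e = sum ?f (Poly_Mapping.keys e)"
    using kextend_singles[of e] by (simp add: kextend_def)
  also have "\<dots> = sum ?f (Poly_Mapping.keys e - ?S) + sum ?f ?S"
    by (rule sum.subset_diff) auto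
  finally have "e = sum ?f ?S + sum ?f (Poly_Mapping.keys e - ?S)" by (simp add: add.commute)
  moreover have "sum ?f ?S \<in> kchains p (subtopology T U)"
    using e by (intro kv.subspace_sum[OF subspace_kchains] kchains_closed)
      (auto simp: kchains_def singular_simplex_subtopology)
  moreover have "sum ?f (Poly_Mapping.keys e - ?S) \<in> kchains p (subtopology T V)"
    using e sub by (intro kv.subspace_sum[OF subspace_kchains] kchains_closed)
      (auto simp: kchains_def singular_simplex_subtopology)
  ultimately show ?thesis using that by blast
qed

definition ksubdivision :: "nat \<Rightarrow> nat \<Rightarrow> ('k::field, 'a) kchain \<Rightarrow> ('k, 'a) kchain"
  where "ksubdivision p n = kop (singular_subdivision p ^^ n)"

text \<open>
  Each of the finitely many simplices of \<open>c\<close> becomes small after some number of subdivisions, and the sum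
  of these numbers is large enough for all of them.
\<close>

lemma ksubdivision_small:
  assumes U: "openin T U" and V: "openin T V" and cover: "topspace T \<subseteq> U \<union> V"
    and c: "c \<in> kchains p T"
  obtains n a b where "ksubdivision p n c = a + b"
    "a \<in> kchains p (subtopology T U)" "b \<in> kchains p (subtopology T V)"
proof -
  have sc: "singular_chain p T (frag_of s)" if "s \<in> Poly_Mapping.keys c" for s
    using c that by (auto simp: kchains_def singular_chain_of)
  have "\<forall>s\<in>Poly_Mapping.keys c. \<exists>n. \<forall>m t. n \<le> m \<and>
      t \<in> Poly_Mapping.keys ((singular_subdivision p ^^ m) (frag_of s)) \<longrightarrow>
      t ` standard_simplex p \<subseteq> U \<or> t ` standard_simplex p \<subseteq> V"
  proof
    fix s assume s: "s \<in> Poly_Mapping.keys c"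
    obtain n where "\<And>m t. \<lbrakk>n \<le> m; t \<in> Poly_Mapping.keys ((singular_subdivision p ^^ m) (frag_of s))\<rbrakk>
        \<Longrightarrow> \<exists>W\<in>{U, V}. t \<in> standard_simplex p \<rightarrow> W"
      using sufficient_iterated_singular_subdivision_exists[OF _ _ sc[OF s], of "{U, V}"] U V cover
      by auto
    then show "\<exists>n. \<forall>m t. n \<le> m \<and>
      t \<in> Poly_Mapping.keys ((singular_subdivision p ^^ m) (frag_of s)) \<longrightarrow>
      t ` standard_simplex p \<subseteq> U \<or> t ` standard_simplex p \<subseteq> V"
      by (intro exI[of _ n]) (fastforce simp: Pi_iff)
  qed
  then obtain N where N: "\<And>s m t. \<lbrakk>s \<in> Poly_Mapping.keys c; N s \<le> m;
      t \<in> Poly_Mapping.keys ((singular_subdivision p ^^ m) (frag_of s))\<rbrakk> \<Longrightarrow>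
      t ` standard_simplex p \<subseteq> U \<or> t ` standard_simplex p \<subseteq> V"
    unfolding bchoice_iff by metis
  define n where "n = (\<Sum>s\<in>Poly_Mapping.keys c. N s)"
  have n: "N s \<le> n" if "s \<in> Poly_Mapping.keys c" for s
    unfolding n_def by (rule member_le_sum[OF that]) auto
  have sd: "singular_chain p T ((singular_subdivision p ^^ n) (frag_of s))" if "singular_simplex p T s" for s n
    using that by (induction n) (auto simp: singular_chain_of singular_chain_singular_subdivision)
  have 1: "ksubdivision p n c \<in> kchains p T"
    unfolding ksubdivision_def by (rule kop_kchains[OF c]) (erule sd)
  have 2: "t ` standard_simplex p \<subseteq> U \<or> t ` standard_simplex p \<subseteq> V"
    if t: "t \<in> Poly_Mapping.keys (ksubdivision p n c)" for t
  proof -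
    obtain s where "s \<in> Poly_Mapping.keys c" "t \<in> Poly_Mapping.keys ((singular_subdivision p ^^ n) (frag_of s))"
      using t keys_kop unfolding ksubdivision_def by fast
    then show ?thesis using N n by blast
  qed
  show ?thesis using kchains_split[OF 1 2] that by metis
qed

text \<open>
  One operator \<open>H\<close> serves all spaces \<open>X\<close>, so it preserves the chains of every subspace. This is what keeps the
  chains in \<open>small_boundary\<close> inside \<open>U\<close> and \<open>V\<close>.
\<close>

lemma ksubdivision_homotopy:
  obtains H :: "nat \<Rightarrow> ('k::field, 'a) kchain \<Rightarrow> ('k, 'a) kchain"
  where "\<And>p c c'. H p (c + c') = H p c + H p c'" "\<And>p. H p 0 = 0"
    and "\<And>p X c. c \<in> kchains p X \<Longrightarrow> H p c \<in> kchains (Suc p) X"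
    and "\<And>p X c. c \<in> kchains p X \<Longrightarrow>
      kboundary (Suc p) (H p c) + H (p - 1) (kboundary p c) = ksubdivision p n c - c"
proof -
  obtain h where h: "\<And>p. h p 0 = (0 :: 'a chain)" "\<And>p c1 c2. h p (c1 - c2) = h p c1 - h p c2"
    "\<And>p X c. singular_chain p X c \<Longrightarrow> singular_chain (Suc p) X (h p c)"
    "\<And>p X c. singular_chain p X c \<Longrightarrow>
      chain_boundary (Suc p) (h p c) + h (p - Suc 0) (chain_boundary p c) = (singular_subdivision p ^^ n) c - c"
    using chain_homotopic_iterated_singular_subdivision[where n = n] by metis
  show ?thesis
  proof (rule that[of "\<lambda>p. kop (h p)"])
    show "kop (h p) (c + c') = kop (h p) c + kop (h p) c'" for p and c c' :: "('k, 'a) kchain"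
      by (simp add: kop_def kextend_add)
    show "kop (h p) 0 = (0 :: ('k, 'a) kchain)" for p by (rule kop_zero)
  next
    fix p X and c :: "('k, 'a) kchain" assume c: "c \<in> kchains p X"
    show "kop (h p) c \<in> kchains (Suc p) X"
      by (rule kop_kchains[OF c]) (simp add: h singular_chain_of)
    have "kboundary (Suc p) (kop (h p) c) + kop (h (p - 1)) (kboundary p c)
        = kop (\<lambda>x. chain_boundary (Suc p) (h p x) + h (p - 1) (chain_boundary p x)) c"
      by (simp add: kboundary_kop kop_kop h chain_boundary_diff kop_add)
    also have "\<dots> = kop (\<lambda>x. (singular_subdivision p ^^ n) x - x) c"
      by (rule kop_cong) (use c h(4)[of p X] in \<open>auto simp: kchains_def singular_chain_of\<close>)
    also have "\<dots> = ksubdivision p n c - c"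
      by (simp add: kop_diff ksubdivision_def kop_ident)
    finally show "kboundary (Suc p) (kop (h p) c) + kop (h (p - 1)) (kboundary p c) = ksubdivision p n c - c" .
  qed
qed

lemma kboundary_boundary: "c \<in> kchains (Suc p) X \<Longrightarrow> kboundary p (kboundary (Suc p) c) = 0"
  using kboundary_kcycle[of c "Suc p" X] by (simp add: kcycles_def)

text \<open>
  Together with \<open>small_boundary\<close> this says that the sums of chains of \<open>U\<close> and chains of \<open>V\<close> compute
  the homology of \<open>T\<close>, which is the content of the Mayer-Vietoris sequence.
\<close>

lemma cycle_homologous_to_small:
  assumes U: "openin T U" and V: "openin T V" and cover: "topspace T \<subseteq> U \<union> V"
    and z: "z \<in> kcycles p T"
  obtains u v where "u \<in> kchains p (subtopology T U)" "v \<in> kchains p (subtopology T V)"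
    "z - (u + v) \<in> kbounds p T"
proof -
  have zc: "z \<in> kchains p T" using z by (rule kcycles_chains)
  obtain n u v where nuv: "ksubdivision p n z = u + v"
    "u \<in> kchains p (subtopology T U)" "v \<in> kchains p (subtopology T V)"
    using ksubdivision_small[OF U V cover zc] by blast
  obtain H :: "nat \<Rightarrow> ('b, 'a) kchain \<Rightarrow> ('b, 'a) kchain" where
    H: "\<And>p. H p 0 = 0" "\<And>p X c. c \<in> kchains p X \<Longrightarrow> H p c \<in> kchains (Suc p) X"
    "\<And>p X c. c \<in> kchains p X \<Longrightarrow> kboundary (Suc p) (H p c) + H (p - 1) (kboundary p c) = ksubdivision p n c - c"
    using ksubdivision_homotopy[where n = n] by metis
  have "kboundary (Suc p) (H p z) = u + v - z"
    using H(3)[OF zc] z by (simp add: kcycles_def H(1) nuv)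
  then have "u + v - z \<in> kbounds p T"
    using kboundary_kchains[OF H(2)[OF zc]] by simp
  then have "z - (u + v) \<in> kbounds p T"
    using kbounds_closed(4) by fastforce
  then show ?thesis using that nuv by blast
qed

text \<open>
  If \<open>u + v = \<partial>c\<close>, then \<open>c\<close> may be replaced by its subdivision minus \<open>H(u + v)\<close>, which has the same boundary by
  the chain homotopy equation and is a sum of chains of the two parts.
\<close>

lemma small_boundary:
  assumes U: "openin T U" and V: "openin T V" and cover: "topspace T \<subseteq> U \<union> V"
    and u: "u \<in> kchains p (subtopology T U)" and v: "v \<in> kchains p (subtopology T V)"
    and uv: "u + v \<in> kbounds p T"
  obtains a b where "a \<in> kchains (Suc p) (subtopology T U)" "b \<in> kchains (Suc p) (subtopology T V)"
    "u + v = kboundary (Suc p) (a + b)"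
proof -
  obtain c where c: "c \<in> kchains (Suc p) T" "u + v = kboundary (Suc p) c"
    using uv by (auto simp: kbounds_def)
  obtain n a b where nab: "ksubdivision (Suc p) n c = a + b"
    "a \<in> kchains (Suc p) (subtopology T U)" "b \<in> kchains (Suc p) (subtopology T V)"
    using ksubdivision_small[OF U V cover c(1)] by blast
  obtain H :: "nat \<Rightarrow> ('b, 'a) kchain \<Rightarrow> ('b, 'a) kchain" where
    H: "\<And>p c c'. H p (c + c') = H p c + H p c'" "\<And>p X c. c \<in> kchains p X \<Longrightarrow> H p c \<in> kchains (Suc p) X"
    "\<And>p X c. c \<in> kchains p X \<Longrightarrow> kboundary (Suc p) (H p c) + H (p - 1) (kboundary p c) = ksubdivision p n c - c"
    using ksubdivision_homotopy[where n = n] by metis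
  have "kboundary (Suc p) (kboundary (Suc (Suc p)) (H (Suc p) c) + H p (kboundary (Suc p) c))
      = kboundary (Suc p) (a + b - c)"
    using H(3)[OF c(1)] by (simp add: nab)
  then have "kboundary (Suc p) (H p u + H p v) = kboundary (Suc p) (a + b) - (u + v)"
    by (simp add: kboundary_linear kboundary_diff kboundary_boundary[OF H(2)[OF c(1)]] flip: c(2) H(1))
  then have "u + v = kboundary (Suc p) ((a - H p u) + (b - H p v))"
    by (simp add: kboundary_linear kboundary_diff algebra_simps)
  then show ?thesis
    using that[of "a - H p u" "b - H p v"] nab u v by (simp add: H kchains_closed)
qed

section \<open>Spaces with finite-dimensional total homology\<close>

text \<open>
  A bound for the dimension of the homology in degree \<open>n\<close>. The set \<open>S\<close> may contain arbitrary chains, which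
  makes bounds easy to transport and to add; by \<open>subspace_spanning_subset\<close> it could be chosen among cycles.
\<close>

definition betti_le :: "'k::field itself \<Rightarrow> nat \<Rightarrow> nat \<Rightarrow> 'a topology \<Rightarrow> bool"
  where "betti_le K m n Y \<longleftrightarrow> (\<exists>S :: ('k, 'a) kchain set. finite S \<and> card S \<le> m \<and>
    kcycles n Y \<subseteq> kv.span (kbounds n Y \<union> S))"

definition finite_type :: "'k::field itself \<Rightarrow> 'a topology \<Rightarrow> bool"
  where "finite_type K Y \<longleftrightarrow> (\<exists>b. (\<forall>n. betti_le K (b n) n Y) \<and> finite {n. b n \<noteq> 0})"

text \<open>
  The homotopy makes every cycle \<open>z\<close> homologous to \<open>i(r(z))\<close>, so the images of chains spanning the homology of \<open>A\<close>
  span that of \<open>Y\<close>.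
\<close>

lemma betti_le_dominated:
  fixes K :: "'k::field itself"
  assumes r: "continuous_map Y A r" and i: "continuous_map A Y i"
    and hom: "homotopic_with (\<lambda>_. True) Y Y (\<lambda>y. i (r y)) (\<lambda>y. y)"
    and A: "betti_le K m n A"
  shows "betti_le K m n Y"
proof -
  obtain S :: "('k, 'b) kchain set" where S: "finite S" "card S \<le> m" "kcycles n A \<subseteq> kv.span (kbounds n A \<union> S)"
    using A unfolding betti_le_def by blast
  let ?i = "kchain_map n i :: ('k, 'b) kchain \<Rightarrow> ('k, 'a) kchain"
  let ?W = "kv.span (kbounds n Y \<union> ?i ` S)"
  have "kv.subspace {c. ?i c \<in> ?W}"
    unfolding kv.subspace_def by (auto simp: kchain_map_linear kv.span_add kv.span_scale kv.span_zero)
  then have "kv.span (kbounds n A \<union> S) \<subseteq> {c. ?i c \<in> ?W}"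
    by (intro kv.span_minimal) (auto intro: kv.span_base kbounds_map[OF _ i])
  then have 1: "?i c \<in> ?W" if "c \<in> kcycles n A" for c using that S(3) by blast
  have "z \<in> ?W" if z: "z \<in> kcycles n Y" for z
  proof -
    have "?i (kchain_map n r z) \<in> ?W" by (intro 1 kcycles_map[OF z r])
    moreover have "z - ?i (kchain_map n r z) \<in> kbounds n Y"
      using kchain_map_homotopic[OF hom z] kchain_map_id[OF kcycles_chains[OF z], of "\<lambda>y. y"]
      by (simp add: kchain_map_compose)
    then have "z - ?i (kchain_map n r z) \<in> ?W" by (simp add: kv.span_base)
    ultimately show ?thesis using kv.span_add by fastforce
  qed
  then show ?thesis
    unfolding betti_le_def using S card_image_le[OF S(1), of ?i]
    by (intro exI[of _ "?i ` S"]) (auto intro: order_trans)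
qed

lemma finite_type_dominated:
  assumes "continuous_map Y A r" "continuous_map A Y i"
    and "homotopic_with (\<lambda>_. True) Y Y (\<lambda>y. i (r y)) (\<lambda>y. y)" "finite_type K A"
  shows "finite_type K Y"
  using assms betti_le_dominated unfolding finite_type_def by blast

lemma finite_type_homeomorphic:
  assumes f: "homeomorphic_map Z Y f" and Z: "finite_type K Z"
  shows "finite_type K Y"
proof -
  obtain g where g: "homeomorphic_maps Z Y f g" using f homeomorphic_map_maps by blast
  then have "homotopic_with (\<lambda>_. True) Y Y (\<lambda>y. f (g y)) (\<lambda>y. y)"
    by (intro homotopic_with_equal)
      (auto simp: homeomorphic_maps_def intro: continuous_map_compose[unfolded o_def])
  then show ?thesis
    using g Z finite_type_dominated[of Y Z g f] by (simp add: homeomorphic_maps_def)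
qed

text \<open>
  Exactness of the Mayer-Vietoris sequence at the homology of \<open>Y\<close>. A cycle is homologous to some \<open>u + v\<close>, and
  sending it to \<open>\<partial>u\<close>, a cycle of the intersection, is a linear relation \<open>R\<close>. If \<open>\<partial>u\<close> bounds in the intersection,
  then \<open>u\<close> and \<open>v\<close> can be corrected to cycles.
\<close>

lemma betti_le_Mayer_Vietoris:
  fixes K :: "'k::field itself"
  assumes U: "openin Y U" and V: "openin Y V" and cover: "topspace Y \<subseteq> U \<union> V"
    and bU: "betti_le K m\<^sub>1 n (subtopology Y U)" and bV: "betti_le K m\<^sub>2 n (subtopology Y V)"
    and bUV: "betti_le K m\<^sub>3 (n - 1) (subtopology Y (U \<inter> V))"
  shows "betti_le K (m\<^sub>1 + m\<^sub>2 + m\<^sub>3) n Y"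
proof -
  let ?U = "subtopology Y U" and ?V = "subtopology Y V" and ?W = "subtopology Y (U \<inter> V)"
  obtain SU :: "('k, 'a) kchain set" where SU: "finite SU" "card SU \<le> m\<^sub>1" "kcycles n ?U \<subseteq> kv.span (kbounds n ?U \<union> SU)"
    using bU unfolding betti_le_def by blast
  obtain SV :: "('k, 'a) kchain set" where SV: "finite SV" "card SV \<le> m\<^sub>2" "kcycles n ?V \<subseteq> kv.span (kbounds n ?V \<union> SV)"
    using bV unfolding betti_le_def by blast
  obtain S :: "('k, 'a) kchain set" where S: "finite S" "card S \<le> m\<^sub>3" "kcycles (n - 1) ?W \<subseteq> kv.span (kbounds (n - 1) ?W \<union> S)"
    using bUV unfolding betti_le_def by blast
  let ?K = "kbounds n Y \<union> (SU \<union> SV)"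
  define R where "R = (\<lambda>z w. \<exists>u v. u \<in> kchains n ?U \<and> v \<in> kchains n ?V \<and> z - (u + v) \<in> kbounds n Y \<and>
    kboundary n (u + v) = 0 \<and> w = (kboundary n u :: ('k, 'a) kchain))"
  have Rcycle: "w \<in> kcycles (n - 1) ?W" if Rzw: "R z w" for z w
  proof -
    obtain u v where uv: "u \<in> kchains n ?U" "v \<in> kchains n ?V" "kboundary n (u + v) = 0" "w = kboundary n u"
      using Rzw unfolding R_def by blast
    then have "w = - kboundary n v" by (simp add: kboundary_linear eq_neg_iff_add_eq_0)
    then have "w \<in> kcycles (n - 1) ?V" using kboundary_kcycle[OF uv(2)] by (simp add: kcycles_closed)
    moreover have "w \<in> kcycles (n - 1) ?U" using kboundary_kcycle[OF uv(1)] uv by simp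
    ultimately show ?thesis by (auto simp: kcycles_def kchains_subtopology)
  qed
  have "\<exists>S'. finite S' \<and> card S' \<le> card S \<and> kcycles n Y \<subseteq> kv.span (?K \<union> S')"
  proof (rule kspan_lift[where R = R and B = "kbounds (n - 1) ?W"])
    show "R 0 0" unfolding R_def
      by (intro exI[of _ 0]) (simp add: kchains_closed kbounds_closed kboundary_linear)
    show "R (z + z') (w + w')" if "R z w" "R z' w'" for z w z' w'
    proof -
      obtain u v u' v' where uv: "u \<in> kchains n ?U" "v \<in> kchains n ?V" "z - (u + v) \<in> kbounds n Y"
        "kboundary n (u + v) = 0" "w = kboundary n u"
        "u' \<in> kchains n ?U" "v' \<in> kchains n ?V" "z' - (u' + v') \<in> kbounds n Y"
        "kboundary n (u' + v') = 0" "w' = kboundary n u'"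
        using \<open>R z w\<close> \<open>R z' w'\<close> unfolding R_def by blast
      have "z + z' - ((u + u') + (v + v')) = (z - (u + v)) + (z' - (u' + v'))" by simp
      then have "z + z' - ((u + u') + (v + v')) \<in> kbounds n Y" using uv kbounds_closed(2) by metis
      moreover have "kboundary n ((u + u') + (v + v')) = kboundary n (u + v) + kboundary n (u' + v')"
        by (simp add: kboundary_linear)
      then have "kboundary n ((u + u') + (v + v')) = 0" using uv by simp
      moreover have "w + w' = kboundary n (u + u')" using uv by (simp add: kboundary_linear)
      ultimately show ?thesis
        unfolding R_def using uv kchains_closed(2) by blast
    qed
    show "R (kscale a z) (kscale a w)" if Rzw: "R z w" for a z w
    proof -
      obtain u v where uv: "u \<in> kchains n ?U" "v \<in> kchains n ?V" "z - (u + v) \<in> kbounds n Y"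
        "kboundary n (u + v) = 0" "w = kboundary n u"
        using Rzw unfolding R_def by blast
      then have "kscale a (z - (u + v)) \<in> kbounds n Y" "kscale a (kboundary n (u + v)) = 0"
        by (simp_all add: kbounds_closed kscale_simps)
      then show ?thesis unfolding R_def using uv
        by (rule_tac exI[of _ "kscale a u"], rule_tac exI[of _ "kscale a v"])
          (simp add: kchains_closed kboundary_linear kscale_simps kv.scale_right_diff_distrib)
    qed
    show "\<exists>w. R z w" if z: "z \<in> kcycles n Y" for z
    proof -
      obtain u v where uv: "u \<in> kchains n ?U" "v \<in> kchains n ?V" "z - (u + v) \<in> kbounds n Y"
        using cycle_homologous_to_small[OF U V cover z] by blast
      then have "kboundary n (z - (u + v)) = 0" using kbounds_subset_kcycles by (auto simp: kcycles_def)
      then have "kboundary n (u + v) = 0" using z by (simp add: kboundary_diff kcycles_def)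
      then show ?thesis unfolding R_def using uv by blast
    qed
    show "w \<in> kv.span (kbounds (n - 1) ?W \<union> S)" if "R z w" for z w
      using Rcycle[OF that] S by blast
    show "z \<in> kv.span ?K" if "R z w" and "w \<in> kv.span (kbounds (n - 1) ?W)" for z w
    proof -
      have w: "w \<in> kbounds (n - 1) ?W"
        using that(2) by (simp add: kv.span_eq_iff[THEN iffD2, OF subspace_kbounds])
      obtain u v where uv: "u \<in> kchains n ?U" "v \<in> kchains n ?V" "z - (u + v) \<in> kbounds n Y"
        "kboundary n (u + v) = 0" "w = kboundary n u"
        using \<open>R z w\<close> unfolding R_def by blast
      obtain x where x: "x \<in> kchains n ?W" "kboundary n x = w"
      proof (cases n)
        case 0
        then show ?thesis using that[of 0] uv by (simp add: kchains_closed)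
      next
        case (Suc q)
        then show ?thesis using that w by (auto simp: kbounds_def)
      qed
      have "u - x \<in> kcycles n ?U"
        using uv x kchains_mono[OF x(1), of U] by (simp add: kcycles_def kchains_closed kboundary_diff)
      then have 1: "u - x \<in> kv.span (kbounds n ?U \<union> SU)" using SU by blast
      have "v + x \<in> kcycles n ?V"
        using uv x kchains_mono[OF x(1), of V]
        by (simp add: kcycles_def kchains_closed kboundary_linear add.commute)
      then have 2: "v + x \<in> kv.span (kbounds n ?V \<union> SV)" using SV by blast
      have sub: "kv.span (kbounds n ?U \<union> SU) \<subseteq> kv.span ?K" "kv.span (kbounds n ?V \<union> SV) \<subseteq> kv.span ?K"
        by (intro kv.span_mono; use kbounds_from_sub in blast)+
      have "(z - (u + v)) + ((u - x) + (v + x)) \<in> kv.span ?K"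
        by (intro kv.span_add subsetD[OF sub(1) 1] subsetD[OF sub(2) 2]) (simp add: kv.span_base uv(3))
      then show ?thesis by simp
    qed
  qed (rule S(1))
  then obtain S' where S': "finite S'" "card S' \<le> card S" "kcycles n Y \<subseteq> kv.span (?K \<union> S')" by blast
  have "card (SU \<union> SV \<union> S') \<le> m\<^sub>1 + m\<^sub>2 + m\<^sub>3"
    using card_Un_le[of "SU \<union> SV" S'] card_Un_le[of SU SV] SU SV S S' by linarith
  then show ?thesis
    unfolding betti_le_def using SU SV S'
    by (intro exI[of _ "SU \<union> SV \<union> S'"]) (simp add: Un_assoc)
qed

lemma finite_type_Mayer_Vietoris:
  assumes "openin Y U" "openin Y V" "topspace Y \<subseteq> U \<union> V"
    and "finite_type K (subtopology Y U)" "finite_type K (subtopology Y V)"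
    and "finite_type K (subtopology Y (U \<inter> V))"
  shows "finite_type K Y"
proof -
  obtain b\<^sub>1 b\<^sub>2 b\<^sub>3 where b: "\<And>n. betti_le K (b\<^sub>1 n) n (subtopology Y U)" "finite {n. b\<^sub>1 n \<noteq> 0}"
    "\<And>n. betti_le K (b\<^sub>2 n) n (subtopology Y V)" "finite {n. b\<^sub>2 n \<noteq> 0}"
    "\<And>n. betti_le K (b\<^sub>3 n) n (subtopology Y (U \<inter> V))" "finite {n. b\<^sub>3 n \<noteq> 0}"
    using assms(4-6) unfolding finite_type_def by blast
  have "{n. b\<^sub>1 n + b\<^sub>2 n + b\<^sub>3 (n - 1) \<noteq> 0} \<subseteq> {n. b\<^sub>1 n \<noteq> 0} \<union> {n. b\<^sub>2 n \<noteq> 0} \<union> ({0} \<union> Suc ` {n. b\<^sub>3 n \<noteq> 0})"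
  proof
    fix n assume "n \<in> {n. b\<^sub>1 n + b\<^sub>2 n + b\<^sub>3 (n - 1) \<noteq> 0}"
    then show "n \<in> {n. b\<^sub>1 n \<noteq> 0} \<union> {n. b\<^sub>2 n \<noteq> 0} \<union> ({0} \<union> Suc ` {n. b\<^sub>3 n \<noteq> 0})"
      by (cases n) auto
  qed
  then have "finite {n. b\<^sub>1 n + b\<^sub>2 n + b\<^sub>3 (n - 1) \<noteq> 0}"
    using b by (meson finite.emptyI finite_Un finite_imageI finite_insert finite_subset)
  then show ?thesis
    unfolding finite_type_def using betti_le_Mayer_Vietoris[OF assms(1-3) b(1,3,5)]
    by (intro exI[of _ "\<lambda>n. b\<^sub>1 n + b\<^sub>2 n + b\<^sub>3 (n - 1)"] conjI allI)
qed

lemma finite_type_empty: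
  fixes K :: "'k::field itself"
  assumes "topspace Y = {}"
  shows "finite_type K Y"
proof -
  have "(kcycles n Y :: ('k, 'a) kchain set) \<subseteq> {0}" for n
  proof -
    have "singular_simplex_set n Y = {}" using singular_simplex_empty[OF assms] by blast
    then show ?thesis by (simp only: kcycles_def kchains_def subset_empty) auto
  qed
  then have "betti_le K 0 n Y" for n
    unfolding betti_le_def using kv.span_zero by (intro exI[of _ "{}"]) fastforce
  then show ?thesis unfolding finite_type_def by (intro exI[of _ "\<lambda>_. 0"]) auto
qed

text \<open>
  In each degree the chains are the multiples of one simplex, and its boundary is alternately zero and the
  simplex one degree lower.
\<close>

lemma finite_type_singleton:
  fixes K :: "'k::field itself"
  assumes Y: "topspace Y = {a}"
  shows "finite_type K Y"
proof -
  define s where "s = (\<lambda>n. restrict (\<lambda>x. a) (standard_simplex n))"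
  let ?e = "\<lambda>n. Poly_Mapping.single (s n) 1 :: ('k, 'a) kchain"
  have ss: "singular_simplex n Y t \<longleftrightarrow> t = s n" for n t
    using singular_simplex_singleton[OF Y] by (simp add: s_def)
  have e: "?e n \<in> kchains n Y" for n by (simp add: kchains_def ss)
  have ex: "\<exists>k. z = kscale k (?e n)" if "z \<in> kchains n Y" for z n
  proof
    have "Poly_Mapping.lookup z t = Poly_Mapping.lookup (kscale (Poly_Mapping.lookup z (s n)) (?e n)) t" for t
    proof (cases "t = s n")
      case False
      then have "t \<notin> Poly_Mapping.keys z" using that by (auto simp: kchains_def ss)
      then show ?thesis using False by (simp add: in_keys_iff lookup_single)
    qed simp
    then show "z = kscale (Poly_Mapping.lookup z (s n)) (?e n)" by (rule poly_mapping_eqI)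
  qed
  have bd: "kboundary n (?e n) = (if n = 0 \<or> odd n then 0 else ?e (n - 1))" for n
  proof -
    have "chain_boundary n (frag_of (s n)) = (if n = 0 \<or> odd n then 0 else frag_of (s (n - 1)))"
      using chain_boundary_of_singleton[OF Y, of n "frag_of (s n)"]
      by (simp add: singular_chain_of ss) (simp add: s_def)
    then show ?thesis
      by (simp add: kboundary_def kscale_simps base_change_frag_of base_change_0)
  qed
  have "betti_le K (if n = 0 then 1 else 0) n Y" for n
  proof (cases "n = 0")
    case True
    have "z \<in> kv.span (kbounds n Y \<union> {?e 0})" if z: "z \<in> kcycles n Y" for z :: "('k, 'a) kchain"
    proof -
      obtain k where "z = kscale k (?e 0)" using ex[of z 0] z True by (auto simp: kcycles_def)
      then show ?thesis by (simp only:) (rule kv.span_scale, rule kv.span_base, simp)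
    qed
    then show ?thesis
      unfolding betti_le_def True by (intro exI[of _ "{?e 0}"]) (auto simp: True)
  next
    case False
    have "z \<in> kbounds n Y" if z: "z \<in> kcycles n Y" for z :: "('k, 'a) kchain"
    proof -
      obtain k where k: "z = kscale k (?e n)" using ex z by (auto simp: kcycles_def)
      show ?thesis
      proof (cases "odd n")
        case True
        then have "z = kboundary (Suc n) (kscale k (?e (Suc n)))"
          by (simp add: k kboundary_linear bd)
        then show ?thesis using kboundary_kchains kchains_closed(5)[OF e] by metis
      next
        case even: False
        then have "kscale k (?e (n - 1)) = 0"
          using z False by (simp add: kcycles_def k kboundary_linear bd)
        then have "k = 0"
          by (metis lookup_kscale lookup_single_eq lookup_zero mult.right_neutral)
        then show ?thesis by (simp add: k kscale_simps kbounds_closed)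
      qed
    qed
    then show ?thesis
      unfolding betti_le_def using False by (intro exI[of _ "{}"]) (auto intro: kv.span_base)
  qed
  moreover have "finite {n::nat. (if n = 0 then 1 else 0::nat) \<noteq> 0}" by simp
  ultimately show ?thesis unfolding finite_type_def by (intro exI[of _ "\<lambda>n. if n = 0 then 1 else 0"]) blast
qed

lemma finite_type_contractible:
  assumes "contractible_space Y" shows "finite_type K Y"
proof (cases "topspace Y = {}")
  case False
  obtain a where hom: "homotopic_with (\<lambda>x. True) Y Y id (\<lambda>x. a)"
    using assms unfolding contractible_space_def by blast
  have a: "a \<in> topspace Y"
    using homotopic_with_imp_continuous_maps[OF hom] False by (auto simp: continuous_map_def)
  show ?thesis
  proof (rule finite_type_dominated)
    show "continuous_map Y (subtopology Y {a}) (\<lambda>x. a)" "continuous_map (subtopology Y {a}) Y (\<lambda>x. x)"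
      using a by (auto simp: continuous_map_in_subtopology intro: continuous_map_from_subtopology)
    show "homotopic_with (\<lambda>_. True) Y Y (\<lambda>y. a) (\<lambda>y. y)"
      using hom homotopic_with_symD by (fastforce simp: id_def)
    show "finite_type K (subtopology Y {a})" using a by (intro finite_type_singleton) auto
  qed
qed (rule finite_type_empty)

lemma contractible_star_shaped:
  assumes c: "c \<in> S" and S: "\<And>x t. \<lbrakk>x \<in> S; 0 \<le> t; t \<le> 1\<rbrakk> \<Longrightarrow> (\<lambda>i. (1 - t) * x i + t * c i) \<in> S"
  shows "contractible_space (subtopology (powertop_real UNIV) S)"
proof -
  have "continuous_map (subtopology (powertop_real UNIV) S) (powertop_real UNIV) id"
    by (intro continuous_map_from_subtopology continuous_map_id)
  then show ?thesis
    unfolding contractible_space_def using S c by (intro exI[of _ c] homotopic_straight_line) auto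
qed

section \<open>Discs and punctured discs\<close>

lemma open_disc_iff: "x \<in> open_disc n \<longleftrightarrow> (\<forall>i\<ge>n. x i = 0) \<and> (\<Sum>i<n. x i ^ 2) < 1"
  by (auto simp: open_disc_def topspace_Euclidean_space)

lemma closed_disc_iff: "x \<in> closed_disc n \<longleftrightarrow> (\<forall>i\<ge>n. x i = 0) \<and> (\<Sum>i<n. x i ^ 2) \<le> 1"
  by (auto simp: closed_disc_def topspace_Euclidean_space)

lemma subtopology_Euclidean_disc:
  "subtopology (Euclidean_space n) (open_disc n) = subtopology (powertop_real UNIV) (open_disc n)"
  "subtopology (Euclidean_space n) (closed_disc n) = subtopology (powertop_real UNIV) (closed_disc n)"
  by (auto simp: Euclidean_space_def subtopology_subtopology open_disc_iff closed_disc_iff intro!: arg_cong2[where f = subtopology])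

lemma sum_squares_convex:
  fixes x y :: "nat \<Rightarrow> real"
  assumes "0 \<le> t" "t \<le> 1"
  shows "(\<Sum>i<n. ((1 - t) * x i + t * y i) ^ 2) \<le> (1 - t) * (\<Sum>i<n. x i ^ 2) + t * (\<Sum>i<n. y i ^ 2)"
proof -
  have "((1 - t) * a + t * b) ^ 2 \<le> (1 - t) * a ^ 2 + t * b ^ 2" for a b :: real
  proof -
    have "(1 - t) * a ^ 2 + t * b ^ 2 - ((1 - t) * a + t * b) ^ 2 = t * (1 - t) * (a - b) ^ 2"
      by (simp add: power2_eq_square algebra_simps)
    moreover have "\<dots> \<ge> 0" using assms by simp
    ultimately show ?thesis by linarith
  qed
  then have "(\<Sum>i<n. ((1 - t) * x i + t * y i) ^ 2) \<le> (\<Sum>i<n. (1 - t) * x i ^ 2 + t * y i ^ 2)"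
    by (intro sum_mono) auto
  then show ?thesis by (simp add: sum.distrib sum_distrib_left)
qed

lemma open_disc_convex:
  assumes "x \<in> open_disc n" "y \<in> open_disc n" "0 \<le> t" "t \<le> 1"
  shows "(\<lambda>i. (1 - t) * x i + t * y i) \<in> open_disc n"
proof -
  have "(1 - t) * (\<Sum>i<n. x i ^ 2) + t * (\<Sum>i<n. y i ^ 2) < 1"
    using convex_bound_lt[of "\<Sum>i<n. x i ^ 2" 1 "\<Sum>i<n. y i ^ 2" "1 - t" t] assms by (auto simp: open_disc_iff)
  then show ?thesis
    using sum_squares_convex[OF assms(3,4), where x = x and y = y and n = n] assms by (auto simp: open_disc_iff)
qed

lemma closed_disc_convex:
  assumes "x \<in> closed_disc n" "y \<in> closed_disc n" "0 \<le> t" "t \<le> 1"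
  shows "(\<lambda>i. (1 - t) * x i + t * y i) \<in> closed_disc n"
proof -
  have "(1 - t) * (\<Sum>i<n. x i ^ 2) + t * (\<Sum>i<n. y i ^ 2) \<le> 1"
    using convex_bound_le[of "\<Sum>i<n. x i ^ 2" 1 "\<Sum>i<n. y i ^ 2" "1 - t" t] assms by (auto simp: closed_disc_iff)
  then show ?thesis
    using sum_squares_convex[OF assms(3,4), where x = x and y = y and n = n] assms by (auto simp: closed_disc_iff)
qed

lemma finite_type_open_disc: "finite_type K (subtopology (powertop_real UNIV) (open_disc n))"
  by (intro finite_type_contractible contractible_star_shaped[where c = "\<lambda>_. 0"] open_disc_convex)
    (auto simp: open_disc_iff)

text \<open>
  Deleting either half of the last coordinate axis from the punctured disc leaves an open set that is
  star-shaped around a point of the other half. The intersection of the two sets retracts onto the punctured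
  disc of one dimension less by forgetting the last coordinate.
\<close>

lemma finite_type_punctured_disc:
  "finite_type K (subtopology (powertop_real UNIV) (open_disc n - {\<lambda>_. 0}))"
proof (induction n)
  case 0
  have "open_disc 0 - {\<lambda>_. 0} = {}" by (auto simp: open_disc_iff)
  then show ?case by (intro finite_type_empty) auto
next
  case (Suc n)
  let ?P = "powertop_real UNIV :: (nat \<Rightarrow> real) topology"
  let ?D = "open_disc (Suc n) - {\<lambda>_. 0}"
  define W where "W = {x \<in> open_disc (Suc n). \<exists>i<n. x i \<noteq> 0}"
  \<comment> \<open>for \<open>e = 1\<close> the negative half of the last axis is deleted, for \<open>e = -1\<close> the positive half\<close>
  define A where "A = (\<lambda>e::real. {x \<in> open_disc (Suc n). (\<exists>i<n. x i \<noteq> 0) \<or> e * x n > 0})"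
  have AD: "A e \<subseteq> ?D" for e unfolding A_def by auto
  have op: "openin (subtopology ?P ?D) (A e)" for e
  proof -
    have pr: "continuous_map (subtopology ?P ?D) euclideanreal (\<lambda>x. x i)" for i
      by (intro continuous_map_from_subtopology continuous_map_product_projection) auto
    let ?Y = "subtopology ?P ?D"
    have 1: "openin ?Y {x \<in> topspace ?Y. x i \<in> - {0}}" for i
      by (rule openin_continuous_map_preimage[OF pr]) auto
    have 2: "openin ?Y {x \<in> topspace ?Y. e * x n \<in> {0<..}}"
      by (rule openin_continuous_map_preimage[OF continuous_map_real_mult_left[OF pr]]) auto
    have "openin ?Y (\<Union>((\<lambda>i. {x \<in> topspace ?Y. x i \<in> - {0}}) ` {..<n}) \<union> {x \<in> topspace ?Y. e * x n \<in> {0<..}})"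
      by (rule openin_Un[OF openin_Union 2]) (use 1 in blast)
    also have "\<Union>((\<lambda>i. {x \<in> topspace ?Y. x i \<in> - {0}}) ` {..<n}) \<union> {x \<in> topspace ?Y. e * x n \<in> {0<..}} = A e"
      using AD[of e] by (auto simp: A_def)
    finally show ?thesis .
  qed
  have ctr: "finite_type K (subtopology (subtopology ?P ?D) (A e))" if e: "e = 1 \<or> e = -1" for e
  proof -
    define c where "c = (\<lambda>i. if i = n then e / 2 else 0)"
    have c: "c \<in> open_disc (Suc n)"
      using e by (auto simp: open_disc_iff c_def power2_eq_square)
    have "contractible_space (subtopology ?P (A e))"
    proof (rule contractible_star_shaped[where c = c])
      show "c \<in> A e" using c e by (auto simp: A_def c_def)
      fix x t assume x: "x \<in> A e" and t: "0 \<le> t" "t \<le> (1::real)"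
      have "(\<lambda>i. (1 - t) * x i + t * c i) \<in> open_disc (Suc n)"
        using x c t by (intro open_disc_convex) (auto simp: A_def)
      moreover have "(\<exists>i<n. (1 - t) * x i + t * c i \<noteq> 0) \<or> e * ((1 - t) * x n + t * c n) > 0"
      proof (cases "t < 1 \<and> (\<exists>i<n. x i \<noteq> 0)")
        case True
        then show ?thesis by (auto simp: c_def)
      next
        case False
        have 1: "e * ((1 - t) * x n + t * c n) = (1 - t) * (e * x n) + t / 2"
          using e by (auto simp: c_def algebra_simps)
        have "t = 1 \<or> e * x n > 0" using False x t by (auto simp: A_def)
        then show ?thesis unfolding 1 using t
          by (cases "t = 1") (auto intro!: disjI2 add_pos_nonneg mult_pos_pos)
      qed
      ultimately show "(\<lambda>i. (1 - t) * x i + t * c i) \<in> A e" by (auto simp: A_def)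
    qed
    then show ?thesis
      using AD[of e] by (simp add: subtopology_subtopology Int_absorb1 finite_type_contractible)
  qed
  have WA: "A 1 \<inter> A (-1) = W" unfolding W_def A_def by auto
  have WD: "W \<subseteq> ?D" unfolding W_def by auto
  have "finite_type K (subtopology ?P W)"
  proof (rule finite_type_dominated)
    let ?r = "\<lambda>x i. if i < n then x i else (0::real)"
    have contr: "continuous_map (subtopology ?P S) ?P ?r" for S
      unfolding continuous_map_componentwise_UNIV
      by (intro allI continuous_map_from_subtopology) (auto intro: continuous_map_product_projection)
    have r: "?r x \<in> open_disc n - {\<lambda>_. 0}" if x: "x \<in> W" for x
    proof -
      have "(\<Sum>i<n. x i ^ 2) \<le> (\<Sum>i<Suc n. x i ^ 2)" by simp
      also have "\<dots> < 1" using x by (simp add: W_def open_disc_iff)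
      finally have "(\<Sum>i<n. x i ^ 2) < 1" .
      moreover have "(\<Sum>i<n. ?r x i ^ 2) = (\<Sum>i<n. x i ^ 2)" by (intro sum.cong) auto
      ultimately show ?thesis using x by (auto simp: W_def open_disc_iff fun_eq_iff)
    qed
    show "continuous_map (subtopology ?P W) (subtopology ?P (open_disc n - {\<lambda>_. 0})) ?r"
      using contr r unfolding continuous_map_in_subtopology by auto
    have sub: "open_disc n - {\<lambda>_. 0} \<subseteq> W"
    proof
      fix x assume x: "x \<in> open_disc n - {\<lambda>_. 0}"
      then obtain i where "x i \<noteq> 0" by auto
      moreover from this have "i < n" using x by (force simp: open_disc_iff)
      ultimately show "x \<in> W" using x by (auto simp: W_def open_disc_iff)
    qed
    show "continuous_map (subtopology ?P (open_disc n - {\<lambda>_. 0})) (subtopology ?P W) (\<lambda>x. x)"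
      using sub unfolding continuous_map_in_subtopology by (auto intro: continuous_map_from_subtopology)
    show "homotopic_with (\<lambda>_. True) (subtopology ?P W) (subtopology ?P W) ?r (\<lambda>x. x)"
    proof (rule homotopic_straight_line[OF contr])
      show "continuous_map (subtopology ?P W) ?P (\<lambda>x. x)" by (intro continuous_map_from_subtopology) auto
      fix x and t :: real assume x: "x \<in> topspace (subtopology ?P W)" and t: "0 \<le> t" "t \<le> 1"
      then have xW: "x \<in> W" by auto
      obtain i where i: "i < n" "x i \<noteq> 0" using xW by (auto simp: W_def)
      have "(\<lambda>i. (1 - t) * ?r x i + t * x i) \<in> open_disc (Suc n)"
        using r[OF xW] sub xW t by (intro open_disc_convex) (auto simp: W_def)
      moreover have "(1 - t) * ?r x i + t * x i \<noteq> 0" using i by (simp add: algebra_simps)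
      ultimately show "(\<lambda>i. (1 - t) * ?r x i + t * x i) \<in> W" using i unfolding W_def by blast
    qed
    show "finite_type K (subtopology ?P (open_disc n - {\<lambda>_. 0}))" by (rule Suc.IH)
  qed
  then have "finite_type K (subtopology (subtopology ?P ?D) (A 1 \<inter> A (-1)))"
    using WD by (simp add: WA subtopology_subtopology Int_absorb1)
  moreover have "topspace (subtopology ?P ?D) \<subseteq> A 1 \<union> A (-1)"
  proof
    fix x assume "x \<in> topspace (subtopology ?P ?D)"
    then have x: "x \<in> ?D" by auto
    then obtain i where "x i \<noteq> 0" by auto
    moreover from this have "i \<le> n" using x by (force simp: open_disc_iff)
    ultimately show "x \<in> A 1 \<union> A (-1)" using x by (cases "i = n") (auto simp: A_def)
  qed
  ultimately show ?case
    using finite_type_Mayer_Vietoris[OF op op] ctr by blast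
qed

section \<open>Attaching cells\<close>

lemma compactin_closed_disc: "compactin (powertop_real UNIV) (closed_disc n)"
proof (rule closed_compactin)
  let ?X = "powertop_real UNIV :: (nat \<Rightarrow> real) topology"
  show "compactin ?X (UNIV \<rightarrow>\<^sub>E {-1..1})"
    by (simp add: compactin_PiE)
  show "closed_disc n \<subseteq> UNIV \<rightarrow>\<^sub>E {-1..1}"
  proof
    fix x assume x: "x \<in> closed_disc n"
    have "\<bar>x i\<bar> \<le> 1" for i
    proof (cases "i < n")
      case True
      then have "x i ^ 2 \<le> (\<Sum>i<n. x i ^ 2)" by (intro member_le_sum) auto
      then show ?thesis using x by (simp add: closed_disc_iff flip: abs_square_le_1)
    qed (use x in \<open>auto simp: closed_disc_iff\<close>)
    then show "x \<in> UNIV \<rightarrow>\<^sub>E {-1..1}" by (auto simp: abs_le_iff minus_le_iff)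
  qed
  have eq: "closed_disc n = (\<Inter>i\<in>{n..}. {x \<in> topspace ?X. x i \<in> {0}}) \<inter> {x \<in> topspace ?X. (\<Sum>i<n. x i ^ 2) \<in> {..1}}"
    by (auto simp: closed_disc_iff)
  show "closedin ?X (closed_disc n)"
    unfolding eq
    by (rule closedin_Int closedin_Inter continuous_map_sum continuous_map_real_pow
             continuous_map_product_projection closedin_continuous_map_preimage | force | clarify)+
qed

text \<open>
  The deformation of the punctured closed disc onto its boundary sphere that moves points along rays.
\<close>

definition radial :: "nat \<Rightarrow> real \<times> (nat \<Rightarrow> real) \<Rightarrow> (nat \<Rightarrow> real)"
  where "radial n = (\<lambda>(t, v) i. (1 - t) * v i + t * (v i / sqrt (\<Sum>i<n. v i ^ 2)))"

lemma punctured_disc_norm_pos: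
  assumes "v \<in> closed_disc n - {\<lambda>_. 0}" shows "0 < (\<Sum>i<n. v i ^ 2)"
proof -
  obtain i where i: "v i \<noteq> 0" using assms by auto
  then have "i < n" using assms by (force simp: closed_disc_iff)
  then show ?thesis using i by (intro sum_pos2[of _ i]) auto
qed

lemma radial_unit:
  assumes v: "v \<in> closed_disc n - {\<lambda>_. 0}"
  shows "radial n (1, v) \<in> closed_disc n - open_disc n"
proof -
  have "(\<Sum>i<n. (v i / sqrt (\<Sum>i<n. v i ^ 2)) ^ 2) = (\<Sum>i<n. v i ^ 2) / (\<Sum>i<n. v i ^ 2)"
    using punctured_disc_norm_pos[OF v] by (simp add: power_divide flip: sum_divide_distrib)
  then show ?thesis
    using v punctured_disc_norm_pos[OF v] by (auto simp: radial_def closed_disc_iff open_disc_iff)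
qed

lemma radial_closed:
  assumes v: "v \<in> closed_disc n - {\<lambda>_. 0}" and t: "0 \<le> t" "t \<le> 1"
  shows "radial n (t, v) \<in> closed_disc n - {\<lambda>_. 0}"
proof -
  let ?s = "sqrt (\<Sum>i<n. v i ^ 2)"
  have s: "?s > 0" using punctured_disc_norm_pos[OF v] by simp
  have "radial n (t, v) = (\<lambda>i. (1 - t) * v i + t * radial n (1, v) i)"
    by (simp add: radial_def)
  then have "radial n (t, v) \<in> closed_disc n"
    using closed_disc_convex[of v n "radial n (1, v)" t] radial_unit[OF v] v t by simp
  moreover obtain i where i: "v i \<noteq> 0" using v by auto
  have "radial n (t, v) i = ((1 - t) + t / ?s) * v i"
    by (simp add: radial_def algebra_simps)
  moreover have "(1 - t) + t / ?s > 0"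
    using t s by (cases "t = 1") (auto intro: add_pos_nonneg)
  ultimately have "radial n (t, v) i \<noteq> 0" using i by simp
  then have "radial n (t, v) \<noteq> (\<lambda>_. 0)" by metis
  with \<open>radial n (t, v) \<in> closed_disc n\<close> show ?thesis by simp
qed

lemma radial_sphere:
  assumes "v \<in> closed_disc n - open_disc n" shows "radial n (t, v) = v"
proof -
  have "(\<Sum>i<n. v i ^ 2) = 1" using assms by (auto simp: closed_disc_iff open_disc_iff)
  then show ?thesis by (simp add: radial_def algebra_simps)
qed

lemma continuous_map_radial:
  "continuous_map (cylinder (subtopology (powertop_real UNIV) (closed_disc n - {\<lambda>_. 0})))
    (subtopology (powertop_real UNIV) (closed_disc n - {\<lambda>_. 0})) (radial n)"
  (is "continuous_map ?C (subtopology ?P ?D) _")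
  unfolding continuous_map_in_subtopology
proof
  have t: "continuous_map ?C euclideanreal fst"
    using continuous_map_fst continuous_map_into_fulltopology by blast
  have v: "continuous_map ?C euclideanreal (\<lambda>z. snd z i)" for i
  proof -
    have "continuous_map (subtopology ?P ?D) euclideanreal (\<lambda>x. x i)"
      by (intro continuous_map_from_subtopology continuous_map_product_projection) auto
    then show ?thesis
      using continuous_map_compose[OF continuous_map_snd, of "subtopology ?P ?D" euclideanreal "\<lambda>x. x i"]
      by (simp add: o_def)
  qed
  have "(\<Sum>i<n. snd z i ^ 2) \<noteq> 0" if "z \<in> topspace ?C" for z
    using punctured_disc_norm_pos[of "snd z" n] that by auto
  then show "continuous_map ?C ?P (radial n)"
    unfolding continuous_map_componentwise_UNIV radial_def case_prod_beta
    by (intro allI continuous_intros t v) auto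
  show "radial n \<in> topspace ?C \<rightarrow> ?D" using radial_closed[of _ n] by auto
qed

text \<open>
  Mayer-Vietoris for the complement \<open>U\<close> of the centre of the cell and the open cell. The set \<open>U\<close> deforms onto \<open>A\<close>
  by pushing the punctured cell radially to its boundary. This deformation \<open>H\<close> is defined piecewise on \<open>A\<close> and
  on the image of the punctured closed disc, and it is continuous because both pieces, multiplied by
  \<open>[0,1]\<close>, map to \<open>[0,1] \<times> U\<close> by closed maps. For the disc, closedness comes from its compactness.
\<close>

lemma finite_type_attach_cell:
  fixes \<phi> :: "(nat \<Rightarrow> real) \<Rightarrow> 'a"
  assumes haus: "Hausdorff_space Y"
    and phi: "continuous_map (subtopology (powertop_real UNIV) (closed_disc n)) Y \<phi>"
    and emb: "homeomorphic_map (subtopology (powertop_real UNIV) (open_disc n)) (subtopology Y (\<phi> ` open_disc n)) \<phi>"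
    and A: "closedin Y A" and cover: "topspace Y = A \<union> \<phi> ` open_disc n" and disj: "A \<inter> \<phi> ` open_disc n = {}"
    and bdry: "\<phi> ` (closed_disc n - open_disc n) \<subseteq> A"
    and ft: "finite_type K (subtopology Y A)"
  shows "finite_type K Y"
proof -
  let ?P = "powertop_real UNIV :: (nat \<Rightarrow> real) topology"
  let ?o = "(\<lambda>_. 0) :: nat \<Rightarrow> real"
  let ?D = "closed_disc n - {?o}"
  have oD: "?o \<in> open_disc n" by (simp add: open_disc_iff)
  have sub: "open_disc n \<subseteq> closed_disc n" by (auto simp: open_disc_iff closed_disc_iff)
  have inj: "inj_on \<phi> (open_disc n)"
    using homeomorphic_imp_injective_map[OF emb] by simp
  have inA: "\<phi> w \<in> A \<longleftrightarrow> w \<notin> open_disc n" if "w \<in> closed_disc n" for w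
    using that bdry disj by blast
  have ne: "\<phi> w = \<phi> ?o \<longleftrightarrow> w = ?o" if "w \<in> closed_disc n" for w
    using inA[OF that] inA[of ?o] inj oD sub by (metis inj_on_eq_iff subsetD)
  have im: "\<phi> w \<in> topspace Y" if "w \<in> closed_disc n" for w
    using that phi by (auto simp: continuous_map_def)
  define U where "U = topspace Y - {\<phi> ?o}"
  let ?V = "\<phi> ` open_disc n"
  have U: "openin Y U"
    unfolding U_def using haus im oD sub by (intro openin_diff openin_topspace) (auto simp: closedin_Hausdorff_sing_eq)
  have "?V = topspace Y - A" using cover disj by blast
  then have V: "openin Y ?V" using A by (simp add: openin_diff)
  have ftV: "finite_type K (subtopology Y ?V)"
    by (rule finite_type_homeomorphic[OF emb finite_type_open_disc])
  have UV: "U \<inter> ?V = \<phi> ` (open_disc n - {?o})"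
    using cover ne sub unfolding U_def by auto
  have "homeomorphic_map (subtopology (subtopology ?P (open_disc n)) (open_disc n - {?o}))
      (subtopology (subtopology Y ?V) (U \<inter> ?V)) \<phi>"
    by (rule homeomorphic_map_subtopologies[OF emb]) (use UV cover in auto)
  then have "homeomorphic_map (subtopology ?P (open_disc n - {?o})) (subtopology Y (U \<inter> ?V)) \<phi>"
    by (simp add: subtopology_subtopology Int_absorb1 Int_absorb2 Int_left_absorb inf_commute)
  then have ftUV: "finite_type K (subtopology Y (U \<inter> ?V))"
    by (rule finite_type_homeomorphic[OF _ finite_type_punctured_disc])
  define \<psi> where "\<psi> = inv_into (open_disc n) \<phi>"
  define H where "H = (\<lambda>(t, y). if y \<in> A then y else \<phi> (radial n (t, \<psi> y)))"
  have AU: "A \<subseteq> U" using cover disj oD unfolding U_def by blast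
  have phiU: "\<phi> v \<in> U" if "v \<in> ?D" for v using that ne im unfolding U_def by auto
  have Hphi: "H (t, \<phi> v) = \<phi> (radial n (t, v))" if v: "v \<in> ?D" for t v
    using v inA[of v] radial_sphere[of v n t] inj by (auto simp: H_def \<psi>_def)
  have U_cases: "y \<in> A \<or> (\<exists>v \<in> ?D. y = \<phi> v)" if "y \<in> U" for y
    using that cover sub unfolding U_def by auto
  have cont: "continuous_map (cylinder (subtopology Y U)) (subtopology Y U) H"
    unfolding continuous_map_closedin
  proof (intro conjI allI impI)
    show "H \<in> topspace (cylinder (subtopology Y U)) \<rightarrow> topspace (subtopology Y U)"
    proof
      fix z assume "z \<in> topspace (cylinder (subtopology Y U))"
      then obtain t y where z: "z = (t, y)" "0 \<le> t" "t \<le> 1" "y \<in> U" by auto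
      from U_cases[OF z(4)] have "H z \<in> U"
      proof
        assume "y \<in> A" then show ?thesis using AU by (auto simp: H_def z(1))
      next
        assume "\<exists>v\<in>?D. y = \<phi> v"
        then obtain v where v: "v \<in> ?D" "y = \<phi> v" by blast
        show ?thesis unfolding z(1) v(2) Hphi[OF v(1)] by (intro phiU radial_closed v z)
      qed
      then show "H z \<in> topspace (subtopology Y U)" unfolding U_def by auto
    qed
    fix C assume C: "closedin (subtopology Y U) C"
    let ?C = "cylinder (subtopology Y U)" and ?CD = "cylinder (subtopology ?P ?D)"
    have "closed_map (cylinder (subtopology ?P (closed_disc n))) (cylinder Y) (map_prod id \<phi>)"
    proof -
      have "compact_space (cylinder (subtopology ?P (closed_disc n)))"
        using compactin_closed_disc by (simp add: compact_space_prod_topology compact_space_subtopology)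
      moreover have "Hausdorff_space (cylinder Y)"
        using haus by (simp add: Hausdorff_space_prod_topology Hausdorff_space_subtopology)
      moreover have "continuous_map (cylinder (subtopology ?P (closed_disc n))) (cylinder Y) (map_prod id \<phi>)"
        unfolding map_prod_def using phi by (simp add: continuous_map_prod_top)
      ultimately show ?thesis
        unfolding closed_map_def by (blast intro: closedin_compact_space image_compactin compactin_imp_closedin)
    qed
    then have "closed_map (subtopology (cylinder (subtopology ?P (closed_disc n))) ({0..1} \<times> ?D))
        (subtopology (cylinder Y) ({0..1} \<times> U)) (map_prod id \<phi>)"
    proof (rule closed_map_restriction)
      show "{x \<in> topspace (cylinder (subtopology ?P (closed_disc n))). map_prod id \<phi> x \<in> {0..1} \<times> U} = {0..1} \<times> ?D"
        using phiU im ne unfolding U_def by auto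
    qed
    then have clm: "closed_map ?CD ?C (map_prod id \<phi>)"
      by (simp only: subtopology_Times subtopology_subtopology Int_absorb Int_absorb1[OF Diff_subset])
    have 1: "closedin ?C {z \<in> topspace ?C. snd z \<in> A \<inter> C}"
    proof (rule closedin_continuous_map_preimage[OF continuous_map_snd])
      have "A \<inter> C = (A \<inter> U) \<inter> C" using closedin_subset[OF C] by auto
      moreover have "closedin (subtopology Y U) (A \<inter> U)" using A by (auto simp: closedin_subtopology)
      ultimately show "closedin (subtopology Y U) (A \<inter> C)" using C by (simp add: closedin_Int)
    qed
    have "closedin ?CD {w \<in> topspace ?CD. \<phi> (radial n w) \<in> C}"
    proof (rule closedin_continuous_map_preimage[OF _ C])
      have "continuous_map (subtopology ?P ?D) (subtopology Y U) \<phi>"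
        unfolding continuous_map_in_subtopology
        using phiU continuous_map_from_subtopology_mono[OF phi, of ?D] by auto
      from continuous_map_compose[OF continuous_map_radial this]
      show "continuous_map ?CD (subtopology Y U) (\<lambda>w. \<phi> (radial n w))" by (simp add: o_def)
    qed
    then have 2: "closedin ?C (map_prod id \<phi> ` {w \<in> topspace ?CD. \<phi> (radial n w) \<in> C})"
      using clm unfolding closed_map_def by blast
    have "{z \<in> topspace ?C. H z \<in> C} =
        {z \<in> topspace ?C. snd z \<in> A \<inter> C} \<union> map_prod id \<phi> ` {w \<in> topspace ?CD. \<phi> (radial n w) \<in> C}" (is "?L = ?R")
    proof
      show "?L \<subseteq> ?R"
      proof
        fix z assume z: "z \<in> ?L"
        then obtain t y where ty: "z = (t, y)" "t \<in> {0..1}" "y \<in> U" by auto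
        from U_cases[OF ty(3)] show "z \<in> ?R"
        proof
          assume "y \<in> A" then show ?thesis using z ty by (auto simp: H_def)
        next
          assume "\<exists>v\<in>?D. y = \<phi> v"
          then obtain v where v: "v \<in> ?D" "y = \<phi> v" by blast
          then have "(t, v) \<in> {w \<in> topspace ?CD. \<phi> (radial n w) \<in> C}"
            using z ty Hphi[OF v(1), of t] by auto
          then show ?thesis using v ty by (auto intro!: image_eqI[of _ _ "(t, v)"])
        qed
      qed
      show "?R \<subseteq> ?L"
        using Hphi phiU im by (auto simp: H_def)
    qed
    then show "closedin ?C {z \<in> topspace ?C. H z \<in> C}" using 1 2 by (simp add: closedin_Un)
  qed
  have "finite_type K (subtopology Y U)"
  proof (rule finite_type_dominated)
    let ?r = "\<lambda>y. H (1, y)"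
    have "continuous_map (subtopology Y U) (subtopology Y U) ?r"
      using continuous_map_compose[OF continuous_map_Pair_cylinder cont, of 1] by (simp add: o_def)
    moreover have rA: "?r y \<in> A" if "y \<in> U" for y
      using U_cases[OF that]
    proof
      assume "\<exists>v\<in>?D. y = \<phi> v"
      then obtain v where v: "v \<in> ?D" "y = \<phi> v" by blast
      have "\<phi> (radial n (1, v)) \<in> A" by (rule subsetD[OF bdry imageI[OF radial_unit[OF v(1)]]])
      then show ?thesis by (simp only: v(2) Hphi[OF v(1)])
    qed (simp add: H_def)
    ultimately show "continuous_map (subtopology Y U) (subtopology Y A) ?r"
      by (auto simp: continuous_map_in_subtopology)
    show "continuous_map (subtopology Y A) (subtopology Y U) (\<lambda>y. y)"
      using AU by (auto simp: continuous_map_in_subtopology intro: continuous_map_from_subtopology)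
    have H0: "H (0, y) = y" if "y \<in> U" for y
      using U_cases[OF that]
    proof
      assume "\<exists>v\<in>?D. y = \<phi> v"
      then obtain v where v: "v \<in> ?D" "y = \<phi> v" by blast
      then show ?thesis by (simp only: v(2) Hphi[OF v(1)]) (simp add: radial_def)
    qed (simp add: H_def)
    have "homotopic_with (\<lambda>_. True) (subtopology Y U) (subtopology Y U) (\<lambda>y. H (0, y)) ?r"
      unfolding homotopic_with_def using cont by (intro exI[of _ H]) auto
    then have "homotopic_with (\<lambda>_. True) (subtopology Y U) (subtopology Y U) (\<lambda>y. y) ?r"
      by (rule homotopic_with_eq) (use H0 in auto)
    then show "homotopic_with (\<lambda>_. True) (subtopology Y U) (subtopology Y U) ?r (\<lambda>y. y)"
      by (rule homotopic_with_symD)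
    show "finite_type K (subtopology Y A)" by (rule ft)
  qed
  moreover have "topspace Y \<subseteq> U \<union> ?V" using oD unfolding U_def by auto
  ultimately show ?thesis
    using finite_type_Mayer_Vietoris[OF U V _ _ ftV ftUV] by blast
qed

section \<open>Finite CW complexes\<close>

context finite_cw_complex
begin

lemma closure_finite_down_closed:
  assumes "J \<subseteq> I" and down: "\<And>i j. \<lbrakk>i \<in> J; j \<in> I; d j < d i\<rbrakk> \<Longrightarrow> j \<in> J" and i: "i \<in> J"
  shows "\<phi> i ` (closed_disc (d i) - open_disc (d i)) \<subseteq> (\<Union>j\<in>J - {i}. \<phi> j ` open_disc (d j))"
proof -
  obtain J' where J': "J' \<subseteq> I" "\<forall>j\<in>J'. d j < d i"
    "\<phi> i ` (closed_disc (d i) - open_disc (d i)) \<subseteq> (\<Union>j\<in>J'. \<phi> j ` open_disc (d j))"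
    using closure_finite[of i] assms by blast
  then have "J' \<subseteq> J - {i}" using down[OF i] by blast
  then show ?thesis using J' by blast
qed

lemma characteristic_map_powertop:
  "i \<in> I \<Longrightarrow> continuous_map (subtopology (powertop_real UNIV) (closed_disc (d i))) X (\<phi> i)"
  using characteristic_map by (simp add: subtopology_Euclidean_disc)

lemma closedin_subcomplex:
  assumes J: "J \<subseteq> I" and down: "\<And>i j. \<lbrakk>i \<in> J; j \<in> I; d j < d i\<rbrakk> \<Longrightarrow> j \<in> J"
  shows "closedin X (\<Union>i\<in>J. \<phi> i ` open_disc (d i))"
proof -
  have "compactin X (\<phi> i ` closed_disc (d i))" if "i \<in> J" for i
    using that J compactin_closed_disc
    by (intro image_compactin[OF _ characteristic_map_powertop]) (auto simp: compactin_subtopology)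
  then have "compactin X (\<Union>i\<in>J. \<phi> i ` closed_disc (d i))"
    using finite_subset[OF J finite_cells] by (intro compactin_Union) auto
  moreover have "(\<Union>i\<in>J. \<phi> i ` closed_disc (d i)) = (\<Union>i\<in>J. \<phi> i ` open_disc (d i))"
  proof
    show "(\<Union>i\<in>J. \<phi> i ` closed_disc (d i)) \<subseteq> (\<Union>i\<in>J. \<phi> i ` open_disc (d i))"
    proof (rule UN_least)
      fix i assume i: "i \<in> J"
      have "\<phi> i ` closed_disc (d i) \<subseteq> \<phi> i ` (closed_disc (d i) - open_disc (d i)) \<union> \<phi> i ` open_disc (d i)"
        by auto
      also have "\<dots> \<subseteq> (\<Union>j\<in>J - {i}. \<phi> j ` open_disc (d j)) \<union> \<phi> i ` open_disc (d i)"
        by (rule Un_mono[OF closure_finite_down_closed[OF J down i] subset_refl])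
      also have "\<dots> \<subseteq> (\<Union>i\<in>J. \<phi> i ` open_disc (d i))" using i by auto
      finally show "\<phi> i ` closed_disc (d i) \<subseteq> (\<Union>i\<in>J. \<phi> i ` open_disc (d i))" .
    qed
    have "open_disc m \<subseteq> closed_disc m" for m by (auto simp: open_disc_iff closed_disc_iff)
    then show "(\<Union>i\<in>J. \<phi> i ` open_disc (d i)) \<subseteq> (\<Union>i\<in>J. \<phi> i ` closed_disc (d i))"
      by (intro UN_mono image_mono) auto
  qed
  ultimately show ?thesis using compactin_imp_closedin[OF hausdorff] by metis
qed

text \<open>
  A set of cells that contains with each cell all cells of smaller dimension forms a closed subcomplex, and
  it stays so when a cell of maximal dimension is removed.
\<close>

lemma finite_type_subcomplex:
  assumes J: "J \<subseteq> I" and down: "\<And>i j. \<lbrakk>i \<in> J; j \<in> I; d j < d i\<rbrakk> \<Longrightarrow> j \<in> J"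
  shows "finite_type K (subtopology X (\<Union>i\<in>J. \<phi> i ` open_disc (d i)))"
  using assms
proof (induction "card J" arbitrary: J)
  case 0
  then have "J = {}" using finite_subset[OF _ finite_cells] by auto
  then show ?case by (intro finite_type_empty) auto
next
  case (Suc m)
  have finJ: "finite J" using finite_subset[OF Suc.prems(1) finite_cells] .
  have "J \<noteq> {}" using Suc.hyps(2) by auto
  then obtain i where i: "i \<in> J" "\<And>j. j \<in> J \<Longrightarrow> d j \<le> d i"
  proof -
    have "Max (d ` J) \<in> d ` J" using finJ \<open>J \<noteq> {}\<close> by simp
    then obtain i where "i \<in> J" "d i = Max (d ` J)" by auto
    then show ?thesis using that[of i] finJ by simp
  qed
  let ?e = "\<phi> i ` open_disc (d i)"
  let ?A = "\<Union>j\<in>J - {i}. \<phi> j ` open_disc (d j)"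
  let ?Y = "subtopology X (\<Union>j\<in>J. \<phi> j ` open_disc (d j))"
  have iI: "i \<in> I" using i Suc.prems by blast
  have down': "j \<in> J - {i}" if "k \<in> J - {i}" "j \<in> I" "d j < d k" for j k
    using Suc.prems(2)[of k j] that i(2)[of k] by auto
  have un: "(\<Union>j\<in>J. \<phi> j ` open_disc (d j)) = ?A \<union> ?e" using i by blast
  have subX: "(\<Union>j\<in>J. \<phi> j ` open_disc (d j)) \<subseteq> topspace X" using Suc.prems(1) cells_cover by blast
  have bd: "\<phi> i ` (closed_disc (d i) - open_disc (d i)) \<subseteq> ?A"
    by (rule closure_finite_down_closed[OF Suc.prems i(1)])
  show ?case
  proof (rule finite_type_attach_cell[where \<phi> = "\<phi> i" and n = "d i" and A = ?A])
    show "Hausdorff_space ?Y" by (intro Hausdorff_space_subtopology hausdorff)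
    show "continuous_map (subtopology (powertop_real UNIV) (closed_disc (d i))) ?Y (\<phi> i)"
      using characteristic_map_powertop[OF iI] bd unfolding un continuous_map_in_subtopology by auto
    show "homeomorphic_map (subtopology (powertop_real UNIV) (open_disc (d i))) (subtopology ?Y ?e) (\<phi> i)"
      using homeomorphism_onto_cell[OF iI] i(1)
      by (simp add: subtopology_Euclidean_disc subtopology_subtopology un Int_absorb1)
    have JI: "J - {i} \<subseteq> I" using Suc.prems(1) by blast
    have "closedin X ?A" by (rule closedin_subcomplex[OF JI down'])
    then show "closedin ?Y ?A" unfolding un by (simp add: closedin_subset_topspace)
    show "topspace ?Y = ?A \<union> ?e" using subX un by auto
    show "?A \<inter> ?e = {}"
      using disjoint_family_onD[OF disjoint_cells _ iI] Suc.prems(1) by (simp add: Int_UN_distrib2) blast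
    show "\<phi> i ` (closed_disc (d i) - open_disc (d i)) \<subseteq> ?A" by (rule bd)
    have "finite_type K (subtopology X ?A)"
      by (rule Suc.hyps(1)[OF _ JI down']) (use Suc.hyps(2) i finJ in auto)
    then show "finite_type K (subtopology ?Y ?A)"
      by (simp add: subtopology_subtopology un Int_absorb1)
  qed
qed

lemma finite_type_cw: "finite_type K X"
  using finite_type_subcomplex[of I] by (simp add: cells_cover)

end

section \<open>The topology of the mapping torus\<close>

locale self_map =
  fixes X :: "'a topology" and f :: "'a \<Rightarrow> 'a"
  assumes f_cont: "continuous_map X X f"
begin

abbreviation torus :: "('a \<times> real) set topology"
  where "torus \<equiv> mapping_torus X f"

definition q :: "'a \<times> real \<Rightarrow> ('a \<times> real) set"
  where "q a = torus_rel X f `` {a}"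

text \<open>
  Each class of the gluing relation contains exactly one point of height less than 1, its normal form.
  The functions \<open>base\<close> and \<open>height\<close> are the coordinates of this point; they are continuous away from the glued
  fibre.
\<close>

definition normal :: "'a \<times> real \<Rightarrow> 'a \<times> real"
  where "normal = (\<lambda>(x, t). if t = 1 then (f x, 0) else (x, t))"

definition base :: "('a \<times> real) set \<Rightarrow> 'a"
  where "base C = fst (normal (SOME a. a \<in> C))"

definition height :: "('a \<times> real) set \<Rightarrow> real"
  where "height C = snd (normal (SOME a. a \<in> C))"

lemma f_in: "x \<in> topspace X \<Longrightarrow> f x \<in> topspace X"
  using f_cont by (auto simp: continuous_map_def)

lemma torus_rel_iff:
  "(a, b) \<in> torus_rel X f \<longleftrightarrow> a \<in> topspace X \<times> {0..1} \<and> b \<in> topspace X \<times> {0..1} \<and> normal a = normal b"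
proof -
  have "normal a = normal b" if "equivclp (torus_glue X f) a b" for a b
    using that by (induction rule: equivclp_induct) (auto simp: torus_glue_def normal_def)
  moreover have "equivclp (torus_glue X f) a (normal a)" if "a \<in> topspace X \<times> {0..1}" for a
    using that by (cases a) (auto simp: normal_def torus_glue_def intro!: r_into_equivclp)
  then have "equivclp (torus_glue X f) a b"
    if "a \<in> topspace X \<times> {0..1}" "b \<in> topspace X \<times> {0..1}" "normal a = normal b" for a b
    using that by (metis equivclp_sym equivclp_trans)
  ultimately show ?thesis unfolding torus_rel_def by blast
qed

lemma q_eq_iff:
  assumes "a \<in> topspace X \<times> {0..1}" "b \<in> topspace X \<times> {0..1}"
  shows "q a = q b \<longleftrightarrow> normal a = normal b"
  using assms equiv_class_eq_iff[OF equiv_torus_rel, of a b X f] eq_equiv_class_iff[OF equiv_torus_rel, of a X b f]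
  unfolding q_def torus_rel_iff by simp

lemma normal_some: "a \<in> topspace X \<times> {0..1} \<Longrightarrow> normal (SOME b. b \<in> q a) = normal a"
  by (rule someI2[of _ a]) (auto simp: q_def torus_rel_iff)

lemma base_q: "\<lbrakk>x \<in> topspace X; 0 \<le> t; t < 1\<rbrakk> \<Longrightarrow> base (q (x, t)) = x"
  and base_q1: "x \<in> topspace X \<Longrightarrow> base (q (x, 1)) = f x"
  and height_q: "\<lbrakk>x \<in> topspace X; 0 \<le> t; t \<le> 1\<rbrakk> \<Longrightarrow> height (q (x, t)) = (if t = 1 then 0 else t)"
  by (auto simp: base_def height_def normal_some) (auto simp: normal_def)

lemma q_1: "x \<in> topspace X \<Longrightarrow> q (x, 1) = q (f x, 0)"
  by (subst q_eq_iff) (auto simp: f_in normal_def)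

lemma quotient_q: "quotient_map (prod_topology X (top_of_set {0..1})) torus q"
  unfolding mapping_torus_def q_def by (rule quotient_map_quotient_topology[OF equiv_torus_rel])

lemma torus_cases:
  assumes "C \<in> topspace torus"
  obtains x t where "x \<in> topspace X" "0 \<le> t" "t < 1" "C = q (x, t)"
proof -
  have "C \<in> q ` (topspace X \<times> {0..1})"
    using assms quotient_imp_surjective_map[OF quotient_q] by auto
  then obtain x t where xt: "x \<in> topspace X" "0 \<le> t" "t \<le> 1" "C = q (x, t)" by auto
  show ?thesis
  proof (cases "t = 1")
    case True
    then show ?thesis using that[of "f x" 0] xt q_1 f_in by simp
  next
    case False
    then show ?thesis using that xt by simp
  qed
qed

lemma q_in: "\<lbrakk>x \<in> topspace X; 0 \<le> t; t \<le> 1\<rbrakk> \<Longrightarrow> q (x, t) \<in> topspace torus"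
  using quotient_imp_surjective_map[OF quotient_q] by auto

definition slab :: "real set \<Rightarrow> ('a \<times> real) set set"
  where "slab J = {q (x, t) |x t. x \<in> topspace X \<and> t \<in> J}"

text \<open>
  Under this condition \<open>X \<times> J\<close> is a union of classes of the gluing relation, so it is the full preimage of
  \<open>slab J\<close>.
\<close>

definition saturated :: "real set \<Rightarrow> bool"
  where "saturated J \<longleftrightarrow> J \<subseteq> {0..1} \<and> (0 \<in> J \<longleftrightarrow> 1 \<in> J)"

lemma q_in_slab:
  assumes "saturated J" "x \<in> topspace X" "0 \<le> t" "t \<le> 1"
  shows "q (x, t) \<in> slab J \<longleftrightarrow> t \<in> J"
proof
  assume "q (x, t) \<in> slab J"
  then obtain y s where ys: "q (x, t) = q (y, s)" "y \<in> topspace X" "s \<in> J" unfolding slab_def by auto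
  have s: "0 \<le> s" "s \<le> 1" using assms(1) ys(3) by (auto simp: saturated_def)
  have "(if t = 1 then 0 else t) = (if s = 1 then 0 else s)"
    using height_q[OF assms(2-4)] height_q[OF ys(2) s] ys(1) by metis
  then show "t \<in> J" using assms ys by (auto simp: saturated_def split: if_splits)
qed (use assms in \<open>auto simp: slab_def\<close>)

lemma slab_subset: "saturated J \<Longrightarrow> slab J \<subseteq> topspace torus"
  by (auto simp: slab_def saturated_def intro!: q_in)

lemma preimage_slab:
  assumes "saturated J"
  shows "{a \<in> topspace (prod_topology X (top_of_set {0..1})). q a \<in> slab J} = topspace X \<times> J"
proof -
  have "0 \<le> t" "t \<le> 1" if "t \<in> J" for t using assms that by (auto simp: saturated_def)
  then show ?thesis using q_in_slab[OF assms] by auto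
qed

lemma openin_slab:
  assumes J: "saturated J" and op: "openin (top_of_set {0..1}) J"
  shows "openin torus (slab J)"
proof -
  have "openin (prod_topology X (top_of_set {0..1})) (topspace X \<times> J)"
    using op by (simp add: openin_prod_Times_iff)
  then show ?thesis
    using quotient_q slab_subset[OF J] unfolding quotient_map_def preimage_slab[OF J, symmetric] by blast
qed

lemma quotient_slab:
  assumes J: "saturated J" and op: "openin (top_of_set {0..1}) J"
  shows "quotient_map (prod_topology X (top_of_set J)) (subtopology torus (slab J)) q"
proof -
  have "quotient_map (subtopology (prod_topology X (top_of_set {0..1})) (topspace X \<times> J)) (subtopology torus (slab J)) q"
    by (rule quotient_map_restriction[OF quotient_q preimage_slab[OF J]]) (use openin_slab[OF J op] in simp)
  moreover have "{0..1} \<inter> J = J" using J by (auto simp: saturated_def)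
  ultimately show ?thesis by (simp add: subtopology_Times subtopology_subtopology)
qed

lemma continuous_map_slab:
  assumes J: "saturated J" and op: "openin (top_of_set {0..1}) J"
    and g: "continuous_map (prod_topology X (top_of_set J)) Z (\<lambda>a. g (q a))"
  shows "continuous_map (subtopology torus (slab J)) Z g"
  using continuous_compose_quotient_map[OF quotient_slab[OF J op]] g by (simp add: o_def)

lemma continuous_map_q_slab:
  assumes J: "saturated J"
    and g: "continuous_map Z X g" and t: "continuous_map Z (top_of_set J) t"
  shows "continuous_map Z (subtopology torus (slab J)) (\<lambda>z. q (g z, t z))"
  unfolding continuous_map_in_subtopology
proof
  have "continuous_map Z (top_of_set {0..1}) t"
    using t J unfolding continuous_map_in_subtopology saturated_def by auto
  then have "continuous_map Z (prod_topology X (top_of_set {0..1})) (\<lambda>z. (g z, t z))"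
    using g by (simp add: continuous_map_pairwise o_def)
  from continuous_map_compose[OF this quotient_imp_continuous_map[OF quotient_q]]
  show "continuous_map Z torus (\<lambda>z. q (g z, t z))" by (simp add: o_def)
  show "(\<lambda>z. q (g z, t z)) \<in> topspace Z \<rightarrow> slab J"
    using g t unfolding slab_def by (fastforce simp: continuous_map_def)
qed

lemma continuous_map_base_height:
  assumes J: "saturated J" and op: "openin (top_of_set {0..1}) J" and 0: "0 \<notin> J"
  shows "continuous_map (subtopology torus (slab J)) X base"
    and "continuous_map (subtopology torus (slab J)) (top_of_set J) height"
proof -
  have J1: "0 \<le> t" "t < 1" if "t \<in> J" for t
    using that J 0 by (auto simp: saturated_def less_le)
  have "continuous_map (prod_topology X (top_of_set J)) X (\<lambda>a. base (q a))"
    by (rule continuous_map_eq[OF continuous_map_fst]) (use J1 in \<open>auto simp: base_q\<close>)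
  then show "continuous_map (subtopology torus (slab J)) X base" by (rule continuous_map_slab[OF J op])
  have "continuous_map (prod_topology X (top_of_set J)) (top_of_set J) (\<lambda>a. height (q a))"
    by (rule continuous_map_eq[OF continuous_map_snd]) (use J1 in \<open>fastforce simp: height_q\<close>)
  then show "continuous_map (subtopology torus (slab J)) (top_of_set J) height" by (rule continuous_map_slab[OF J op])
qed

lemma homotopic_slices:
  assumes J: "saturated J" and seg: "\<And>s. \<lbrakk>0 \<le> s; s \<le> 1\<rbrakk> \<Longrightarrow> (1 - s) * a + s * b \<in> J"
  shows "homotopic_with (\<lambda>_. True) X (subtopology torus (slab J)) (\<lambda>x. q (x, a)) (\<lambda>x. q (x, b))"
  unfolding homotopic_with_def
proof (intro exI[of _ "\<lambda>z. q (snd z, (1 - fst z) * a + fst z * b)"] conjI allI ballI)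
  have 1: "continuous_map (cylinder X) euclideanreal fst"
    using continuous_map_fst continuous_map_into_fulltopology by blast
  show "continuous_map (cylinder X) (subtopology torus (slab J)) (\<lambda>z. q (snd z, (1 - fst z) * a + fst z * b))"
    by (intro continuous_map_q_slab J continuous_map_snd continuous_map_into_subtopology continuous_intros 1)
      (use seg in auto)
qed auto

lemma q_base_height: "C \<in> topspace torus \<Longrightarrow> q (base C, height C) = C"
  by (erule torus_cases) (simp add: base_q height_q)

lemma homotopic_slab_slice:
  assumes J: "saturated J" and op: "openin (top_of_set {0..1}) J" and 0: "0 \<notin> J"
    and conv: "convex J" and a: "a \<in> J"
  shows "homotopic_with (\<lambda>_. True) (subtopology torus (slab J)) (subtopology torus (slab J))
    (\<lambda>C. q (base C, a)) (\<lambda>C. C)"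
proof (rule homotopic_with_eq)
  let ?S = "subtopology torus (slab J)"
  have 1: "continuous_map (cylinder ?S) euclideanreal fst"
    using continuous_map_fst continuous_map_into_fulltopology by blast
  have 2: "continuous_map (cylinder ?S) X (\<lambda>z. base (snd z))"
    using continuous_map_compose[OF continuous_map_snd continuous_map_base_height(1)[OF J op 0]] by (simp add: o_def)
  have 3: "continuous_map (cylinder ?S) (top_of_set J) (\<lambda>z. height (snd z))"
    using continuous_map_compose[OF continuous_map_snd continuous_map_base_height(2)[OF J op 0]] by (simp add: o_def)
  then have 4: "continuous_map (cylinder ?S) euclideanreal (\<lambda>z. height (snd z))" "\<And>z. z \<in> topspace (cylinder ?S) \<Longrightarrow> height (snd z) \<in> J"
    by (auto simp: continuous_map_in_subtopology)
  have "continuous_map (cylinder ?S) ?S (\<lambda>z. q (base (snd z), (1 - fst z) * a + fst z * height (snd z)))"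
  proof (intro continuous_map_q_slab J 2 continuous_map_into_subtopology)
    show "continuous_map (cylinder ?S) euclideanreal (\<lambda>z. (1 - fst z) * a + fst z * height (snd z))"
      by (intro continuous_intros 1 4) auto
    show "(\<lambda>z. (1 - fst z) * a + fst z * height (snd z)) \<in> topspace (cylinder ?S) \<rightarrow> J"
    proof
      fix z assume z: "z \<in> topspace (cylinder ?S)"
      then have "0 \<le> fst z" "fst z \<le> 1" by auto
      then show "(1 - fst z) * a + fst z * height (snd z) \<in> J"
        using convexD[OF conv a 4(2)[OF z], of "1 - fst z" "fst z"] by simp
    qed
  qed
  then show "homotopic_with (\<lambda>_. True) ?S ?S (\<lambda>C. q (base C, a)) (\<lambda>C. q (base C, height C))"
    unfolding homotopic_with_def
    by (intro exI[of _ "\<lambda>z. q (base (snd z), (1 - fst z) * a + fst z * height (snd z))"]) auto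
qed (use q_base_height in auto)

text \<open>
  The heights near the glued fibre, approached from both sides.
\<close>

definition seam :: "real set"
  where "seam = {0..<1/3} \<union> {2/3<..1}"

text \<open>
  The retraction of \<open>slab seam\<close> onto the glued fibre, which is identified with \<open>X\<close> at height 0. Points
  below height 1 move up and arrive at height 0 through \<open>f\<close>. The value \<open>1/2\<close> separates the two parts of
  \<open>seam\<close>; classes of points at height 1 have height 0, and their base is already an image under \<open>f\<close>.
\<close>

definition collapse :: "('a \<times> real) set \<Rightarrow> 'a"
  where "collapse C = (if height C \<le> 1/2 then base C else f (base C))"

lemma saturated_seam: "saturated seam"
  by (auto simp: saturated_def seam_def)

lemma openin_seam: "openin (top_of_set {0..1}) seam"
proof -
  have "openin (top_of_set {0..1}) ({0..1} \<inter> ({..<1/3} \<union> {2/3<..}) :: real set)"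
    by (intro openin_open_Int open_Un open_lessThan open_greaterThan)
  also have "{0..1} \<inter> ({..<1/3} \<union> {2/3<..}) = seam" by (auto simp: seam_def)
  finally show ?thesis .
qed

lemma collapse_q:
  "\<lbrakk>x \<in> topspace X; t \<in> seam\<rbrakk> \<Longrightarrow> collapse (q (x, t)) = (if t \<le> 1/2 then x else f x)"
  by (cases "t = 1") (auto simp: collapse_def seam_def base_q base_q1 height_q)

lemma continuous_map_collapse: "continuous_map (subtopology torus (slab seam)) X collapse"
proof (rule continuous_map_slab[OF saturated_seam openin_seam])
  let ?P = "prod_topology X (top_of_set seam)"
  have "continuous_map ?P X (\<lambda>a. if snd a \<le> 1/2 then fst a else f (fst a))"
  proof (rule continuous_map_cases_le)
    show "continuous_map ?P euclideanreal snd"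
      using continuous_map_snd continuous_map_into_fulltopology by blast
    show "continuous_map (subtopology ?P {x \<in> topspace ?P. snd x \<le> 1 / 2}) X fst"
      by (intro continuous_map_from_subtopology continuous_map_fst)
    show "continuous_map (subtopology ?P {x \<in> topspace ?P. 1 / 2 \<le> snd x}) X (\<lambda>x. f (fst x))"
      using continuous_map_compose[OF continuous_map_fst f_cont]
      by (intro continuous_map_from_subtopology) (simp add: o_def)
  qed (auto simp: seam_def)
  then show "continuous_map ?P X (\<lambda>a. collapse (q a))"
    by (rule continuous_map_eq) (auto simp: collapse_q)
qed

text \<open>
  Points move linearly to the nearer end of the interval. Before gluing this is clearly continuous; it descends
  to the quotient because the product of a quotient map with the locally compact interval is again a
  quotient map.
\<close>

lemma homotopic_collapse:
  "homotopic_with (\<lambda>_. True) (subtopology torus (slab seam)) (subtopology torus (slab seam))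
    (\<lambda>C. q (collapse C, 0)) (\<lambda>C. C)"
proof (rule homotopic_with_eq)
  \<comment> \<open>the nearer end of the interval, written so that continuity is evident\<close>
  define chi :: "real \<Rightarrow> real" where "chi t = max 0 (min 1 (3 * t - 1))" for t
  let ?S = "subtopology torus (slab seam)" and ?P = "prod_topology X (top_of_set seam)"
  let ?H = "\<lambda>z. q (base (snd z), (1 - fst z) * chi (height (snd z)) + fst z * height (snd z))"
  have chi: "chi t = (if t \<le> 1/2 then 0 else 1)" if "t \<in> seam" for t
    using that by (auto simp: chi_def seam_def)
  have "continuous_map (cylinder ?S) ?S ?H"
  proof (rule continuous_compose_quotient_map)
    show "quotient_map (cylinder ?P) (cylinder ?S) (\<lambda>(s, a). (s, q a))"
      by (rule quotient_map_prod_right[OF _ _ quotient_slab[OF saturated_seam openin_seam]])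
        (auto intro: compact_imp_locally_compact_space simp: compact_space_subtopology Hausdorff_space_subtopology)
    have fst: "continuous_map (cylinder ?P) euclideanreal fst"
      using continuous_map_fst continuous_map_into_fulltopology by blast
    have sndsnd: "continuous_map (cylinder ?P) euclideanreal (\<lambda>z. snd (snd z))"
      using continuous_map_compose[OF continuous_map_snd continuous_map_snd] continuous_map_into_fulltopology
      by (fastforce simp: o_def)
    have fstsnd: "continuous_map (cylinder ?P) X (\<lambda>z. fst (snd z))"
      using continuous_map_compose[OF continuous_map_snd continuous_map_fst] by (simp add: o_def)
    have "continuous_map (cylinder ?P) ?S
        (\<lambda>z. q (fst (snd z), (1 - fst z) * chi (snd (snd z)) + fst z * snd (snd z)))"
    proof (intro continuous_map_q_slab saturated_seam fstsnd continuous_map_into_subtopology)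
      show "continuous_map (cylinder ?P) euclideanreal (\<lambda>z. (1 - fst z) * chi (snd (snd z)) + fst z * snd (snd z))"
        unfolding chi_def by (intro continuous_intros fst sndsnd) auto
      have "(1 - s) * chi t + s * t \<in> seam" if t: "t \<in> seam" and s: "0 \<le> s" "s \<le> 1" for s t
      proof (cases "t \<le> 1/2")
        case True
        then have "0 \<le> t" "t < 1/3" using t by (auto simp: seam_def)
        moreover have "s * t \<le> t" using s \<open>0 \<le> t\<close> by (simp add: mult_left_le_one_le)
        ultimately show ?thesis using s by (simp add: chi[OF t] True seam_def)
      next
        case False
        then have t': "2/3 < t" "t \<le> 1" using t by (auto simp: seam_def)
        have "(1 - s) * 1 + s * t \<ge> (1 - s) * t + s * t" "(1 - s) * 1 + s * t \<le> (1 - s) * 1 + s * 1"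
          using s t' by (intro add_mono mult_left_mono; simp)+
        then show ?thesis using t' False by (simp add: chi[OF t] seam_def algebra_simps)
      qed
      then show "(\<lambda>z. (1 - fst z) * chi (snd (snd z)) + fst z * snd (snd z)) \<in> topspace (cylinder ?P) \<rightarrow> seam"
        by auto
    qed
    then show "continuous_map (cylinder ?P) ?S (?H \<circ> (\<lambda>(s, a). (s, q a)))"
    proof (rule continuous_map_eq)
      fix z assume "z \<in> topspace (cylinder ?P)"
      then obtain s x t where z: "z = (s, x, t)" "0 \<le> s" "s \<le> 1" "x \<in> topspace X" "t \<in> seam" by auto
      show "q (fst (snd z), (1 - fst z) * chi (snd (snd z)) + fst z * snd (snd z))
          = (?H \<circ> (\<lambda>(s, a). (s, q a))) z"
      proof (cases "t = 1")
        case True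
        then show ?thesis using z by (simp add: base_q height_q chi_def q_1 f_in)
      next
        case False
        then have "0 \<le> t" "t < 1" using z by (auto simp: seam_def)
        then show ?thesis using z False by (simp add: base_q height_q)
      qed
    qed
  qed
  then show "homotopic_with (\<lambda>_. True) ?S ?S (\<lambda>C. q (base C, chi (height C))) (\<lambda>C. q (base C, height C))"
    unfolding homotopic_with_def by (intro exI[of _ ?H]) auto
  fix C assume "C \<in> topspace ?S"
  then obtain x t where C: "C = q (x, t)" "x \<in> topspace X" "t \<in> seam" by (auto simp: slab_def)
  show "q (collapse C, 0) = q (base C, chi (height C))"
  proof (cases "t = 1")
    case True
    then show ?thesis using C by (simp add: base_q1 height_q chi_def collapse_q)
  next
    case False
    then have "0 \<le> t" "t < 1" using C by (auto simp: seam_def)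
    then show ?thesis using C by (simp add: base_q height_q collapse_q chi q_1)
  qed
qed (use q_base_height in auto)

end

section \<open>Chains in the mapping torus\<close>

lemma kboundary_in_kbounds: "c \<in> kchains n Y \<Longrightarrow> kboundary n c \<in> kbounds (n - 1) Y"
  by (cases n) (auto simp: kbounds_closed intro: kboundary_kchains)

lemma kboundary_in_kchains: "c \<in> kchains n Y \<Longrightarrow> kboundary n c \<in> kchains (n - 1) Y"
  using kboundary_kcycle kcycles_chains by blast

lemma kboundary_kboundary_pred: "c \<in> kchains n Y \<Longrightarrow> kboundary (n - 1) (kboundary n c) = 0"
  using kboundary_kcycle[of c n Y] by (simp add: kcycles_def)

text \<open>
  A simplex is connected, so it lies in one of the two disjoint open sets.
\<close>

lemma kchains_disjoint_union:
  assumes A: "openin T A" and B: "openin T B" and AB: "A \<inter> B = {}"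
    and e: "e \<in> kchains n (subtopology T (A \<union> B))"
  obtains a b where "e = a + b" "a \<in> kchains n (subtopology T A)" "b \<in> kchains n (subtopology T B)"
proof (rule kchains_split)
  show "e \<in> kchains n T" using e by (rule kchains_from_sub)
  fix s assume s: "s \<in> Poly_Mapping.keys e"
  let ?I = "s ` standard_simplex n"
  have sub: "?I \<subseteq> A \<union> B" using e s by (simp add: kchains_subtopology)
  have "continuous_map (simplex_space n) T s"
    using kchains_from_sub[OF e] s by (auto simp: kchains_def singular_simplex_def)
  moreover have "connectedin (simplex_space n) (standard_simplex n)"
    by (simp add: connectedin_subtopology connectedin_standard_simplex)
  ultimately have "connectedin T ?I" by (rule connectedin_continuous_map_image)
  then have "\<not> (A \<inter> ?I \<noteq> {} \<and> B \<inter> ?I \<noteq> {})"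
    using A B AB sub unfolding connectedin by (metis inf_bot_left)
  then have "A \<inter> ?I = {} \<or> B \<inter> ?I = {}" by simp
  then show "?I \<subseteq> A \<or> ?I \<subseteq> B" using sub by auto
qed (use that in blast)

lemma kchains_disjoint_zero:
  assumes AB: "A \<inter> B = {}" and a: "a \<in> kchains n (subtopology T A)" and b: "b \<in> kchains n (subtopology T B)"
    and sum: "a + b = 0"
  shows "a = 0"
proof -
  have "Poly_Mapping.keys a = Poly_Mapping.keys b"
    using sum by (metis add_eq_0_iff keys_minus)
  moreover have "s \<notin> Poly_Mapping.keys b" if "s \<in> Poly_Mapping.keys a" for s
  proof
    assume "s \<in> Poly_Mapping.keys b"
    then have "s ` standard_simplex n \<subseteq> A \<inter> B" using that a b by (simp add: kchains_subtopology)
    then show False using AB nonempty_standard_simplex[of n] by simp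
  qed
  ultimately have "Poly_Mapping.keys a = {}" by blast
  then show ?thesis by simp
qed

lemma kchains_disjoint_unique:
  assumes "A \<inter> B = {}" "a \<in> kchains n (subtopology T A)" "b \<in> kchains n (subtopology T B)"
    and "a' \<in> kchains n (subtopology T A)" "b' \<in> kchains n (subtopology T B)" "a + b = a' + b'"
  shows "a = a'" "b = b'"
proof -
  have "(a - a') + (b - b') = 0" using assms(6) by (simp add: algebra_simps)
  then show "a = a'"
    using kchains_disjoint_zero[of A B "a - a'" n T "b - b'"] assms by (simp add: kchains_closed)
  then show "b = b'" using assms(6) by simp
qed

context self_map
begin

abbreviation mid :: "real set" where "mid \<equiv> {0<..<1}"
abbreviation low :: "real set" where "low \<equiv> {0<..<1/3}"
abbreviation high :: "real set" where "high \<equiv> {2/3<..<1}"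

abbreviation part :: "real set \<Rightarrow> ('a \<times> real) set topology"
  where "part J \<equiv> subtopology torus (slab J)"

abbreviation slice :: "nat \<Rightarrow> real \<Rightarrow> ('k::field, 'a) kchain \<Rightarrow> ('k, ('a \<times> real) set) kchain"
  where "slice n t \<equiv> kchain_map n (\<lambda>x. q (x, t))"

lemma openin_subinterval: "openin (top_of_set {0..1}) {a<..<b}" if "0 \<le> a" "b \<le> 1" for a b :: real
proof -
  have "openin (top_of_set {0..1}) ({0..1} \<inter> {a<..<b})" by (intro openin_open_Int open_greaterThanLessThan)
  moreover have "{0..1} \<inter> {a<..<b} = {a<..<b}" using that by auto
  ultimately show ?thesis by simp
qed

lemma saturated_subinterval: "saturated {a<..<b}" if "0 \<le> a" "b \<le> 1" for a b :: real
  using that by (auto simp: saturated_def)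

lemma slab_Int:
  assumes "saturated J" "saturated J'" shows "slab J \<inter> slab J' = slab (J \<inter> J')"
proof
  show "slab J \<inter> slab J' \<subseteq> slab (J \<inter> J')"
  proof
    fix C assume C: "C \<in> slab J \<inter> slab J'"
    then obtain x t where xt: "C = q (x, t)" "x \<in> topspace X" "t \<in> J" by (auto simp: slab_def)
    then have "0 \<le> t" "t \<le> 1" using assms(1) by (auto simp: saturated_def)
    then have "t \<in> J'" using C xt q_in_slab[OF assms(2)] by blast
    then show "C \<in> slab (J \<inter> J')" using xt by (auto simp: slab_def)
  qed
qed (auto simp: slab_def)

lemma slab_Un: "slab (J \<union> J') = slab J \<union> slab J'"
  by (auto simp: slab_def)

lemma slab_mono: "J \<subseteq> J' \<Longrightarrow> slab J \<subseteq> slab J'"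
  by (auto simp: slab_def)

lemma slab_low_high: "slab low \<inter> slab high = {}"
proof -
  have "slab low \<inter> slab high = slab (low \<inter> high)"
    by (rule slab_Int[OF saturated_subinterval saturated_subinterval]) auto
  also have "low \<inter> high = {}" by auto
  finally show ?thesis by (simp add: slab_def)
qed

lemma slab_mid_seam: "slab mid \<inter> slab seam = slab low \<union> slab high"
proof -
  have "mid \<inter> seam = low \<union> high" by (auto simp: seam_def)
  then show ?thesis by (simp add: slab_Int saturated_subinterval saturated_seam slab_Un)
qed

lemma torus_cover: "topspace torus \<subseteq> slab mid \<union> slab seam"
proof
  fix C assume "C \<in> topspace torus"
  then obtain x t where "x \<in> topspace X" "0 \<le> t" "t < 1" "C = q (x, t)" by (rule torus_cases)
  moreover from this have "t \<in> mid \<or> t \<in> seam" by (cases "t = 0") (auto simp: seam_def)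
  ultimately show "C \<in> slab mid \<union> slab seam" unfolding slab_def by blast
qed

lemma openin_slab_mid: "openin torus (slab mid)"
  by (intro openin_slab saturated_subinterval openin_subinterval) auto

lemma openin_slab_seam: "openin torus (slab seam)"
  by (intro openin_slab saturated_seam openin_seam)

lemma openin_slab_low_high: "openin torus (slab low)" "openin torus (slab high)"
  by (intro openin_slab saturated_subinterval openin_subinterval; simp)+

lemma continuous_map_slice: "t \<in> J \<Longrightarrow> saturated J \<Longrightarrow> continuous_map X (part J) (\<lambda>x. q (x, t))"
  by (intro continuous_map_q_slab) auto

lemma continuous_map_slice_torus: "0 \<le> t \<Longrightarrow> t \<le> 1 \<Longrightarrow> continuous_map X torus (\<lambda>x. q (x, t))"
  using continuous_map_slice[of t "{0..1}"] by (auto simp: saturated_def continuous_map_in_subtopology)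

lemma continuous_map_base: "0 \<le> a \<Longrightarrow> b \<le> 1 \<Longrightarrow> continuous_map (part {a<..<b}) X base"
  by (intro continuous_map_base_height saturated_subinterval openin_subinterval) auto

lemma slices_homologous:
  assumes "saturated J" "\<And>s. \<lbrakk>0 \<le> s; s \<le> 1\<rbrakk> \<Longrightarrow> (1 - s) * a + s * b \<in> J" "c \<in> kcycles n X"
  shows "slice n b c - slice n a c \<in> kbounds n (part J)"
  using kchain_map_homotopic[OF homotopic_slices[OF assms(1,2)] assms(3)] .

lemma slices_homologous_torus:
  assumes "a \<in> {0..1}" "b \<in> {0..1}" "c \<in> kcycles n X"
  shows "slice n b c - slice n a c \<in> kbounds n torus"
proof -
  have "slice n b c - slice n a c \<in> kbounds n (part {0..1})"
    using assms convexD[of "{0..1::real}" a b] by (intro slices_homologous) (auto simp: saturated_def)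
  then show ?thesis by (rule kbounds_from_sub)
qed

lemma homologous_slice_base:
  assumes ab: "0 \<le> a" "b \<le> 1" "a < t" "t < b" and w: "w \<in> kcycles n (part {a<..<b})"
  shows "w - slice n t (kchain_map n base w) \<in> kbounds n (part {a<..<b})"
proof -
  have "homotopic_with (\<lambda>_. True) (part {a<..<b}) (part {a<..<b}) (\<lambda>C. q (base C, t)) (\<lambda>C. C)"
    using ab by (intro homotopic_slab_slice saturated_subinterval openin_subinterval) (auto simp: convex_real_interval)
  from kchain_map_homotopic[OF this w] show ?thesis
    using kchain_map_id[OF kcycles_chains[OF w], of "\<lambda>C. C"] by (simp add: kchain_map_compose)
qed

lemma homologous_collapse:
  assumes v: "v \<in> kcycles n (part seam)"
  shows "v - slice n 0 (kchain_map n collapse v) \<in> kbounds n (part seam)"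
  using kchain_map_homotopic[OF homotopic_collapse v]
    kchain_map_id[OF kcycles_chains[OF v], of "\<lambda>C. C"] by (simp add: kchain_map_compose)

text \<open>
  Here and in \<open>collapse_high\<close> the map \<open>f\<close> enters the homology of the torus.
\<close>

lemma slice_1: "c \<in> kchains n X \<Longrightarrow> slice n 1 c = slice n 0 (kchain_map n f c)"
  unfolding kchain_map_compose by (rule kchain_map_eq) (auto simp: q_1)

lemma base_slice: "\<lbrakk>c \<in> kchains n X; 0 \<le> t; t < 1\<rbrakk> \<Longrightarrow> kchain_map n base (slice n t c) = c"
  unfolding kchain_map_compose by (rule kchain_map_id) (auto simp: base_q)

lemma collapse_low:
  assumes "w \<in> kchains n (part low)" shows "kchain_map n collapse w = kchain_map n base w"
  using assms by (rule kchain_map_eq) (auto simp: slab_def collapse_q base_q seam_def)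

lemma collapse_high:
  assumes "w \<in> kchains n (part high)" shows "kchain_map n collapse w = kchain_map n f (kchain_map n base w)"
  unfolding kchain_map_compose using assms by (rule kchain_map_eq) (auto simp: slab_def collapse_q base_q seam_def)

text \<open>
  The Mayer-Vietoris connecting homomorphism as a relation: \<open>z\<close> is homologous to \<open>u + v\<close>, the boundary of \<open>u\<close> lies
  in the two disjoint parts of the intersection, and \<open>w\<close> is the projection to \<open>X\<close> of its upper part. The
  projection of its lower part is homologous to \<open>- w\<close>.
\<close>

definition connecting :: "nat \<Rightarrow> ('k::field, ('a \<times> real) set) kchain \<Rightarrow> ('k, 'a) kchain \<Rightarrow> bool"
  where "connecting n z w \<longleftrightarrow> (\<exists>u v w\<^sub>0 w\<^sub>1. u \<in> kchains n (part mid) \<and> v \<in> kchains n (part seam) \<and>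
    z - (u + v) \<in> kbounds n torus \<and> kboundary n (u + v) = 0 \<and>
    w\<^sub>0 \<in> kcycles (n - 1) (part low) \<and> w\<^sub>1 \<in> kcycles (n - 1) (part high) \<and>
    kboundary n u = w\<^sub>0 + w\<^sub>1 \<and> w = kchain_map (n - 1) base w\<^sub>1)"

lemma connectingE:
  assumes "connecting n z w"
  obtains u v w\<^sub>0 w\<^sub>1 where "u \<in> kchains n (part mid)" "v \<in> kchains n (part seam)"
    "z - (u + v) \<in> kbounds n torus" "kboundary n (u + v) = 0"
    "w\<^sub>0 \<in> kcycles (n - 1) (part low)" "w\<^sub>1 \<in> kcycles (n - 1) (part high)"
    "kboundary n u = w\<^sub>0 + w\<^sub>1" "w = kchain_map (n - 1) base w\<^sub>1"
  using assms unfolding connecting_def by blast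

lemma connecting_add:
  assumes "connecting n z w" "connecting n z' w'" shows "connecting n (z + z') (w + w')"
proof -
  obtain u v w\<^sub>0 w\<^sub>1 where uv: "u \<in> kchains n (part mid)" "v \<in> kchains n (part seam)"
    "z - (u + v) \<in> kbounds n torus" "kboundary n (u + v) = 0"
    "w\<^sub>0 \<in> kcycles (n - 1) (part low)" "w\<^sub>1 \<in> kcycles (n - 1) (part high)"
    "kboundary n u = w\<^sub>0 + w\<^sub>1" "w = kchain_map (n - 1) base w\<^sub>1"
    using assms(1) by (rule connectingE)
  obtain u' v' w\<^sub>0' w\<^sub>1' where uv': "u' \<in> kchains n (part mid)" "v' \<in> kchains n (part seam)"
    "z' - (u' + v') \<in> kbounds n torus" "kboundary n (u' + v') = 0"
    "w\<^sub>0' \<in> kcycles (n - 1) (part low)" "w\<^sub>1' \<in> kcycles (n - 1) (part high)"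
    "kboundary n u' = w\<^sub>0' + w\<^sub>1'" "w' = kchain_map (n - 1) base w\<^sub>1'"
    using assms(2) by (rule connectingE)
  have "z + z' - ((u + u') + (v + v')) = (z - (u + v)) + (z' - (u' + v'))" by simp
  then have 1: "z + z' - ((u + u') + (v + v')) \<in> kbounds n torus"
    using kbounds_closed(2)[OF uv(3) uv'(3)] by metis
  have "kboundary n ((u + u') + (v + v')) = kboundary n (u + v) + kboundary n (u' + v')"
    by (simp add: kboundary_linear)
  then have 2: "kboundary n ((u + u') + (v + v')) = 0" using uv uv' by simp
  have 3: "kboundary n (u + u') = (w\<^sub>0 + w\<^sub>0') + (w\<^sub>1 + w\<^sub>1')"
    "w + w' = kchain_map (n - 1) base (w\<^sub>1 + w\<^sub>1')"
    using uv uv' by (simp_all add: kboundary_linear kchain_map_linear)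
  show ?thesis
    unfolding connecting_def
    using 1 2 3 kchains_closed(2)[OF uv(1) uv'(1)] kchains_closed(2)[OF uv(2) uv'(2)]
      kcycles_closed(2)[OF uv(5) uv'(5)] kcycles_closed(2)[OF uv(6) uv'(6)] by blast
qed

lemma connecting_scale:
  assumes "connecting n z w" shows "connecting n (kscale a z) (kscale a w)"
proof -
  obtain u v w\<^sub>0 w\<^sub>1 where uv: "u \<in> kchains n (part mid)" "v \<in> kchains n (part seam)"
    "z - (u + v) \<in> kbounds n torus" "kboundary n (u + v) = 0"
    "w\<^sub>0 \<in> kcycles (n - 1) (part low)" "w\<^sub>1 \<in> kcycles (n - 1) (part high)"
    "kboundary n u = w\<^sub>0 + w\<^sub>1" "w = kchain_map (n - 1) base w\<^sub>1"
    using assms(1) by (rule connectingE)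
  have "kscale a z - (kscale a u + kscale a v) = kscale a (z - (u + v))"
    by (simp add: kscale_simps kv.scale_right_diff_distrib)
  then have 1: "kscale a z - (kscale a u + kscale a v) \<in> kbounds n torus"
    using kbounds_closed(5)[OF uv(3)] by metis
  have "kboundary n (kscale a u + kscale a v) = kscale a (kboundary n (u + v))"
    by (simp add: kboundary_linear kscale_simps)
  then have 2: "kboundary n (kscale a u + kscale a v) = 0" by (simp only: uv(4) kscale_simps)
  have 3: "kboundary n (kscale a u) = kscale a w\<^sub>0 + kscale a w\<^sub>1"
    "kscale a w = kchain_map (n - 1) base (kscale a w\<^sub>1)"
    using uv by (simp_all add: kboundary_linear kchain_map_linear kscale_simps)
  show ?thesis
    unfolding connecting_def
    by (intro exI conjI)
      (rule kchains_closed(5)[OF uv(1)] kchains_closed(5)[OF uv(2)] 1 2 3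
        kcycles_closed(5)[OF uv(5)] kcycles_closed(5)[OF uv(6)])+
qed

lemma connecting_diff:
  assumes "connecting n z w" "connecting n z' w'" shows "connecting n (z - z') (w - w')"
  using connecting_add[OF assms(1) connecting_scale[OF assms(2), of "-1"]] by simp

lemma split_low_high:
  assumes "u \<in> kchains n (part mid)" "v \<in> kchains n (part seam)" "u = v"
  obtains e\<^sub>0 e\<^sub>1 where "u = e\<^sub>0 + e\<^sub>1" "e\<^sub>0 \<in> kchains n (part low)" "e\<^sub>1 \<in> kchains n (part high)"
proof (rule kchains_disjoint_union[OF openin_slab_low_high slab_low_high])
  show "u \<in> kchains n (subtopology torus (slab low \<union> slab high))"
    using assms unfolding slab_mid_seam[symmetric] by (auto simp: kchains_subtopology)
qed (use that in blast)

lemma connecting_exists: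
  assumes z: "z \<in> kcycles n torus" shows "\<exists>w. connecting n z w"
proof -
  obtain u v where uv: "u \<in> kchains n (part mid)" "v \<in> kchains n (part seam)" "z - (u + v) \<in> kbounds n torus"
    using cycle_homologous_to_small[OF openin_slab_mid openin_slab_seam torus_cover z] by blast
  have "kboundary n (z - (u + v)) = 0" using uv(3) kbounds_subset_kcycles by (auto simp: kcycles_def)
  then have 0: "kboundary n (u + v) = 0" using z by (simp add: kboundary_diff kcycles_def)
  then have eq: "kboundary n u = - kboundary n v" by (simp add: kboundary_linear eq_neg_iff_add_eq_0)
  obtain w\<^sub>0 w\<^sub>1 where w: "kboundary n u = w\<^sub>0 + w\<^sub>1" "w\<^sub>0 \<in> kchains (n - 1) (part low)" "w\<^sub>1 \<in> kchains (n - 1) (part high)"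
    by (rule split_low_high[OF kboundary_in_kchains[OF uv(1)] kchains_closed(4)[OF kboundary_in_kchains[OF uv(2)]] eq])
  have "kboundary (n - 1) w\<^sub>0 + kboundary (n - 1) w\<^sub>1 = 0"
    using kboundary_kboundary_pred[OF uv(1)] w(1) by (simp add: kboundary_linear)
  note 1 = kchains_disjoint_zero[OF slab_low_high kboundary_in_kchains[OF w(2)] kboundary_in_kchains[OF w(3)] this]
  then have "kboundary (n - 1) w\<^sub>1 = 0" using \<open>kboundary (n - 1) w\<^sub>0 + kboundary (n - 1) w\<^sub>1 = 0\<close> by simp
  with 1 have "w\<^sub>0 \<in> kcycles (n - 1) (part low)" "w\<^sub>1 \<in> kcycles (n - 1) (part high)"
    using w by (auto simp: kcycles_def)
  then show ?thesis unfolding connecting_def using uv 0 w(1)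
    by (intro exI[of _ "kchain_map (n - 1) base w\<^sub>1"] exI conjI) (assumption | rule refl)+
qed

lemma connecting_cycle:
  assumes "connecting n z w" shows "w \<in> kcycles (n - 1) X"
proof -
  obtain w\<^sub>1 where "w\<^sub>1 \<in> kcycles (n - 1) (part high)" "w = kchain_map (n - 1) base w\<^sub>1"
    using assms unfolding connecting_def by blast
  moreover have "continuous_map (part high) X base" by (rule continuous_map_base) auto
  ultimately show ?thesis by (simp only: kcycles_map)
qed

text \<open>
  The relation is single-valued on homology. If \<open>u + v\<close> bounds, it bounds a small chain \<open>a + b\<close>; then \<open>u - \<partial>a\<close> is a chain
  of both sets, and its upper part has boundary \<open>w\<^sub>1\<close>.
\<close>

lemma connecting_bounds:
  assumes c: "connecting n z w" and z: "z \<in> kbounds n torus"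
  shows "w \<in> kbounds (n - 1) X"
proof -
  obtain u v w\<^sub>0 w\<^sub>1 where uv: "u \<in> kchains n (part mid)" "v \<in> kchains n (part seam)"
    "z - (u + v) \<in> kbounds n torus" "kboundary n (u + v) = 0"
    "w\<^sub>0 \<in> kcycles (n - 1) (part low)" "w\<^sub>1 \<in> kcycles (n - 1) (part high)"
    "kboundary n u = w\<^sub>0 + w\<^sub>1" "w = kchain_map (n - 1) base w\<^sub>1"
    using c by (rule connectingE)
  have "u + v \<in> kbounds n torus" using kbounds_closed(3)[OF z uv(3)] by (simp add: add.commute)
  then obtain a b where ab: "a \<in> kchains (Suc n) (part mid)" "b \<in> kchains (Suc n) (part seam)"
    "u + v = kboundary (Suc n) (a + b)"
    using small_boundary[OF openin_slab_mid openin_slab_seam torus_cover uv(1,2)] by blast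
  have da: "kboundary (Suc n) a \<in> kchains n (part mid)" "kboundary (Suc n) b \<in> kchains n (part seam)"
    using kboundary_in_kchains[OF ab(1)] kboundary_in_kchains[OF ab(2)] by simp_all
  have eq: "u - kboundary (Suc n) a = kboundary (Suc n) b - v"
    using ab(3) by (simp add: kboundary_linear algebra_simps)
  obtain e\<^sub>0 e\<^sub>1 where e: "u - kboundary (Suc n) a = e\<^sub>0 + e\<^sub>1"
    "e\<^sub>0 \<in> kchains n (part low)" "e\<^sub>1 \<in> kchains n (part high)"
    by (rule split_low_high[OF kchains_closed(3)[OF uv(1) da(1)] kchains_closed(3)[OF da(2) uv(2)] eq])
  have "w\<^sub>0 + w\<^sub>1 = kboundary n (u - kboundary (Suc n) a)"
    by (simp add: kboundary_diff kboundary_boundary[OF ab(1)] uv(7))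
  then have "w\<^sub>0 + w\<^sub>1 = kboundary n e\<^sub>0 + kboundary n e\<^sub>1" by (simp add: e(1) kboundary_linear)
  then have "w\<^sub>1 = kboundary n e\<^sub>1"
    by (rule kchains_disjoint_unique(2)[OF slab_low_high kcycles_chains[OF uv(5)] kcycles_chains[OF uv(6)]
        kboundary_in_kchains[OF e(2)] kboundary_in_kchains[OF e(3)]])
  then have "w\<^sub>1 \<in> kbounds (n - 1) (part high)" using kboundary_in_kbounds[OF e(3)] by simp
  then show ?thesis unfolding uv(8) by (rule kbounds_map) (simp add: continuous_map_base)
qed

lemma base_part_boundary:
  assumes "u \<in> kchains n (part mid)" "kboundary n u = w\<^sub>0 + w\<^sub>1"
  shows "kchain_map (n - 1) base w\<^sub>0 + kchain_map (n - 1) base w\<^sub>1 \<in> kbounds (n - 1) X"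
proof -
  have "kboundary n (kchain_map n base u) = kchain_map (n - 1) base w\<^sub>0 + kchain_map (n - 1) base w\<^sub>1"
    using kboundary_map[OF assms(1), of base] assms(2) by (simp add: kchain_map_linear)
  moreover have "kboundary n (kchain_map n base u) \<in> kbounds (n - 1) X"
    by (intro kboundary_in_kbounds kchains_map[OF assms(1)] continuous_map_base) auto
  ultimately show ?thesis by simp
qed

text \<open>
  If \<open>w\<close> bounds, then both parts of \<open>\<partial>u\<close> bound in their copies of \<open>X\<close>, so \<open>u\<close> and \<open>v\<close> can be corrected to cycles. The two
  open sets retract onto fibres, and all fibres are homologous in the torus.
\<close>

lemma connecting_kernel:
  assumes c: "connecting n z w" and w: "w \<in> kbounds (n - 1) X"
  obtains c where "c \<in> kcycles n X" "z - slice n (1/2) c \<in> kbounds n torus"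
proof -
  obtain u v w\<^sub>0 w\<^sub>1 where uv: "u \<in> kchains n (part mid)" "v \<in> kchains n (part seam)"
    "z - (u + v) \<in> kbounds n torus" "kboundary n (u + v) = 0"
    "w\<^sub>0 \<in> kcycles (n - 1) (part low)" "w\<^sub>1 \<in> kcycles (n - 1) (part high)"
    "kboundary n u = w\<^sub>0 + w\<^sub>1" "w = kchain_map (n - 1) base w\<^sub>1"
    using c by (rule connectingE)
  have fill: "x \<in> kbounds m (part {a<..<b})"
    if "x \<in> kcycles m (part {a<..<b})" "kchain_map m base x \<in> kbounds m X" "0 \<le> a" "b \<le> 1" "a < b" for x a b m
  proof -
    have "slice m ((a + b) / 2) (kchain_map m base x) \<in> kbounds m (part {a<..<b})"
      using that by (intro kbounds_map[OF that(2)] continuous_map_slice saturated_subinterval) auto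
    moreover have "x - slice m ((a + b) / 2) (kchain_map m base x) \<in> kbounds m (part {a<..<b})"
      using that by (intro homologous_slice_base) auto
    ultimately show ?thesis using kbounds_closed(2) by fastforce
  qed
  have 1: "w\<^sub>1 \<in> kbounds (n - 1) (part high)"
    using uv w by (intro fill) auto
  have "kchain_map (n - 1) base w\<^sub>0 \<in> kbounds (n - 1) X"
    using kbounds_closed(3)[OF base_part_boundary[OF uv(1,7)] w[unfolded uv(8)]] by simp
  then have 0: "w\<^sub>0 \<in> kbounds (n - 1) (part low)"
    using uv by (intro fill) auto
  obtain e\<^sub>0 e\<^sub>1 where e: "e\<^sub>0 \<in> kchains n (part low)" "e\<^sub>1 \<in> kchains n (part high)" "kboundary n (e\<^sub>0 + e\<^sub>1) = w\<^sub>0 + w\<^sub>1"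
  proof (cases n)
    case 0
    then show ?thesis using that[of 0 0] uv(7) by (simp add: kchains_closed)
  next
    case (Suc m)
    then show ?thesis using that 0 1 by (auto simp: kbounds_def kboundary_linear)
  qed
  have e': "e\<^sub>0 + e\<^sub>1 \<in> kchains n (part mid)" "e\<^sub>0 + e\<^sub>1 \<in> kchains n (part seam)"
  proof -
    have "slab low \<subseteq> slab mid" "slab high \<subseteq> slab mid" "slab low \<subseteq> slab seam" "slab high \<subseteq> slab seam"
      by (intro slab_mono; force simp: seam_def)+
    then show "e\<^sub>0 + e\<^sub>1 \<in> kchains n (part mid)" "e\<^sub>0 + e\<^sub>1 \<in> kchains n (part seam)"
      using e kchains_mono by (blast intro: kchains_closed(2))+
  qed
  define u' where "u' = u - (e\<^sub>0 + e\<^sub>1)"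
  define v' where "v' = v + (e\<^sub>0 + e\<^sub>1)"
  have u': "u' \<in> kcycles n (part mid)"
    using kchains_closed(3)[OF uv(1) e'(1)] e(3) uv(7) by (simp add: u'_def kcycles_def kboundary_diff)
  have v': "v' \<in> kcycles n (part seam)"
    using kchains_closed(2)[OF uv(2) e'(2)] e(3) uv(4,7)
    by (simp add: v'_def kcycles_def kboundary_linear add.commute)
  let ?p = "kchain_map n base u'" and ?r = "kchain_map n collapse v'"
  have p: "?p \<in> kcycles n X" by (rule kcycles_map[OF u']) (simp add: continuous_map_base)
  have r: "?r \<in> kcycles n X" by (rule kcycles_map[OF v' continuous_map_collapse])
  have "u' - slice n (1/2) ?p \<in> kbounds n torus"
    by (rule kbounds_from_sub, rule homologous_slice_base) (use u' in auto)
  moreover have "v' - slice n 0 ?r \<in> kbounds n torus"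
    by (rule kbounds_from_sub, rule homologous_collapse[OF v'])
  moreover have "slice n 0 ?r - slice n (1/2) ?r \<in> kbounds n torus"
    by (rule slices_homologous_torus[OF _ _ r]) auto
  ultimately have "(z - (u + v)) + ((u' - slice n (1/2) ?p) + ((v' - slice n 0 ?r) + (slice n 0 ?r - slice n (1/2) ?r))) \<in> kbounds n torus"
    using uv(3) by (intro kbounds_closed(2))
  then have "z - slice n (1/2) (?p + ?r) \<in> kbounds n torus"
    by (simp add: u'_def v'_def kchain_map_linear algebra_simps)
  then show ?thesis using that kcycles_closed(2)[OF p r] by blast
qed

lemma connecting_slice:
  assumes c: "c \<in> kcycles n X" shows "connecting n (slice n (1/2) c) 0"
proof -
  have "slice n (1/2) c \<in> kcycles n (part mid)"
    by (intro kcycles_map[OF c] continuous_map_slice saturated_subinterval) auto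
  then show ?thesis
    unfolding connecting_def
    by (intro exI[of _ "slice n (1/2) c"] exI[of _ 0])
      (auto simp: kcycles_def kchains_closed kbounds_closed kchain_map_linear kboundary_linear)
qed

text \<open>
  The two parts of \<open>\<partial>u\<close> are together null-homologous in the open cylinder and, as \<open>- \<partial>v\<close>, also near the seam.
  Projecting the first fact and collapsing the second gives two relations in \<open>X\<close> whose difference is \<open>w - f(w)\<close>.
\<close>

lemma connecting_invariant:
  assumes "connecting n z w" shows "w - kchain_map (n - 1) f w \<in> kbounds (n - 1) X"
proof -
  obtain u v w\<^sub>0 w\<^sub>1 where uv: "u \<in> kchains n (part mid)" "v \<in> kchains n (part seam)"
    "z - (u + v) \<in> kbounds n torus" "kboundary n (u + v) = 0"
    "w\<^sub>0 \<in> kcycles (n - 1) (part low)" "w\<^sub>1 \<in> kcycles (n - 1) (part high)"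
    "kboundary n u = w\<^sub>0 + w\<^sub>1" "w = kchain_map (n - 1) base w\<^sub>1"
    using assms by (rule connectingE)
  have 1: "kchain_map (n - 1) base w\<^sub>0 + w \<in> kbounds (n - 1) X"
    unfolding uv(8) by (rule base_part_boundary[OF uv(1,7)])
  have "kboundary n v = - (w\<^sub>0 + w\<^sub>1)"
    using uv(4) by (simp only: kboundary_linear(1) uv(7) add_eq_0_iff)
  then have "kchain_map (n - 1) collapse (w\<^sub>0 + w\<^sub>1) = - kboundary n (kchain_map n collapse v)"
    using kboundary_map[OF uv(2), of collapse] kchain_map_diff[of "n - 1" collapse 0 "w\<^sub>0 + w\<^sub>1"]
    by (simp add: kchain_map_linear)
  also have "\<dots> \<in> kbounds (n - 1) X"
    by (intro kbounds_closed(4) kboundary_in_kbounds kchains_map[OF uv(2)] continuous_map_collapse)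
  finally have "kchain_map (n - 1) base w\<^sub>0 + kchain_map (n - 1) f w \<in> kbounds (n - 1) X"
    by (simp only: kchain_map_linear collapse_low[OF kcycles_chains[OF uv(5)]]
        collapse_high[OF kcycles_chains[OF uv(6)]] uv(8))
  then have "(kchain_map (n - 1) base w\<^sub>0 + w) - (kchain_map (n - 1) base w\<^sub>0 + kchain_map (n - 1) f w) \<in> kbounds (n - 1) X"
    by (rule kbounds_closed(3)[OF 1])
  then show ?thesis by simp
qed

text \<open>
  The copies of \<open>c\<close> at heights \<open>5/6\<close> and \<open>1/6\<close> are joined by a chain \<open>u\<close> in the open cylinder. Near the seam they move
  to heights 1 and 0, where they become \<open>f(c)\<close> and \<open>c\<close> in the same fibre, so they are joined by a chain \<open>v\<close> as
  well, and \<open>u + v\<close> is the required cycle.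
\<close>

lemma connecting_onto:
  assumes c: "c \<in> kcycles m X" and inv: "c - kchain_map m f c \<in> kbounds m X"
  obtains z where "z \<in> kcycles (Suc m) torus" "connecting (Suc m) z c"
proof -
  let ?w1 = "slice m (5/6) c" and ?w0 = "- slice m (1/6) c"
  have w1: "?w1 \<in> kcycles m (part high)"
    by (intro kcycles_map[OF c] continuous_map_slice saturated_subinterval) auto
  have w0: "?w0 \<in> kcycles m (part low)"
    by (intro kcycles_closed(4) kcycles_map[OF c] continuous_map_slice saturated_subinterval) auto
  have seg: "(1 - s) * (1/6) + s * (5/6) \<in> mid" "(1 - s) * (5/6) + s * 1 \<in> seam" "(1 - s) * 0 + s * (1/6) \<in> seam"
    if "0 \<le> s" "s \<le> 1" for s :: real
  proof -
    have "0 < (1 - s) * (1/6) + s * (5/6)" "(1 - s) * (1/6) + s * (5/6) < 1"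
      "2/3 < (1 - s) * (5/6) + s * 1" "(1 - s) * (5/6) + s * 1 \<le> 1"
      "0 \<le> (1 - s) * 0 + s * (1/6)" "(1 - s) * 0 + s * (1/6) < 1/3"
      using that by (simp_all add: field_simps)
    then show "(1 - s) * (1/6) + s * (5/6) \<in> mid" "(1 - s) * (5/6) + s * 1 \<in> seam" "(1 - s) * 0 + s * (1/6) \<in> seam"
      unfolding seam_def by (simp_all only: greaterThanLessThan_iff Un_iff atLeastLessThan_iff greaterThanAtMost_iff simp_thms)
  qed
  have "?w1 - slice m (1/6) c \<in> kbounds m (part mid)"
    by (intro slices_homologous[OF _ _ c] saturated_subinterval seg) auto
  then obtain u where u: "u \<in> kchains (Suc m) (part mid)" "kboundary (Suc m) u = ?w0 + ?w1"
    by (auto simp: kbounds_def algebra_simps)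
  have "slice m 1 c - ?w1 \<in> kbounds m (part seam)"
    by (intro slices_homologous[OF _ _ c] saturated_seam seg)
  moreover have "slice m (1/6) c - slice m 0 c \<in> kbounds m (part seam)"
    by (intro slices_homologous[OF _ _ c] saturated_seam seg)
  moreover have "slice m 0 (c - kchain_map m f c) \<in> kbounds m (part seam)"
    by (intro kbounds_map[OF inv] continuous_map_slice saturated_seam) (auto simp: seam_def)
  ultimately have "(slice m 1 c - ?w1) + ((slice m (1/6) c - slice m 0 c) + slice m 0 (c - kchain_map m f c)) \<in> kbounds m (part seam)"
    by (intro kbounds_closed(2))
  then have "- (?w0 + ?w1) \<in> kbounds m (part seam)"
    by (simp add: slice_1[OF kcycles_chains[OF c]] kchain_map_diff algebra_simps)
  then obtain v where v: "v \<in> kchains (Suc m) (part seam)" "kboundary (Suc m) v = - (?w0 + ?w1)"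
    by (auto simp: kbounds_def)
  have 0: "kboundary (Suc m) (u + v) = 0" using u v by (simp add: kboundary_linear)
  have "u + v \<in> kcycles (Suc m) torus"
    using 0 u(1) v(1) kchains_from_sub by (auto simp: kcycles_def intro!: kchains_closed(2))
  moreover have "connecting (Suc m) (u + v) c"
    unfolding connecting_def diff_Suc_1
  proof (intro exI conjI)
    show "u + v - (u + v) \<in> kbounds (Suc m) torus" by (simp add: kbounds_closed)
    show "c = kchain_map m base ?w1" using base_slice[OF kcycles_chains[OF c], of "5/6"] by simp
  qed (fact u v 0 w0 w1)+
  ultimately show ?thesis using that by blast
qed

text \<open>
  If the copy of \<open>c\<close> at height \<open>1/2\<close> bounds a small chain \<open>a + b\<close>, then it differs from \<open>\<partial>a\<close> by the cycle \<open>\<partial>b\<close>, which lies in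
  both open sets. Projecting identifies \<open>c\<close> with the sum of the two parts of this cycle, and collapsing \<open>\<partial>b\<close> makes
  the lower part homologous to minus the image under \<open>f\<close> of the upper one.
\<close>

lemma slice_bounds_imp:
  assumes c: "c \<in> kcycles n X" and b: "slice n (1/2) c \<in> kbounds n torus"
  obtains e where "e \<in> kcycles n X" "c - (e - kchain_map n f e) \<in> kbounds n X"
proof -
  have s: "slice n (1/2) c \<in> kcycles n (part mid)"
    by (intro kcycles_map[OF c] continuous_map_slice saturated_subinterval) auto
  obtain a b where ab: "a \<in> kchains (Suc n) (part mid)" "b \<in> kchains (Suc n) (part seam)"
    "slice n (1/2) c + 0 = kboundary (Suc n) (a + b)"
    by (rule small_boundary[OF openin_slab_mid openin_slab_seam torus_cover kcycles_chains[OF s] kchains_closed(1)])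
      (use b in simp)
  have eq: "slice n (1/2) c - kboundary (Suc n) a = kboundary (Suc n) b"
    using ab(3) by (simp add: kboundary_linear)
  have mem: "slice n (1/2) c - kboundary (Suc n) a \<in> kchains n (part mid)"
    "kboundary (Suc n) b \<in> kchains n (part seam)"
    using kboundary_in_kchains[OF ab(1)] kboundary_in_kchains[OF ab(2)] kcycles_chains[OF s] by (simp_all add: kchains_closed)
  obtain e\<^sub>0 e\<^sub>1 where e: "slice n (1/2) c - kboundary (Suc n) a = e\<^sub>0 + e\<^sub>1"
    "e\<^sub>0 \<in> kchains n (part low)" "e\<^sub>1 \<in> kchains n (part high)"
    by (rule split_low_high[OF mem eq])
  have b_e: "kboundary (Suc n) b = e\<^sub>0 + e\<^sub>1" using e(1) eq by simp
  let ?e = "kchain_map n base e\<^sub>1"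
  have "kboundary n e\<^sub>0 + kboundary n e\<^sub>1 = 0"
    using kboundary_boundary[OF ab(2)] by (simp add: b_e kboundary_linear)
  moreover from this have "kboundary n e\<^sub>0 = 0"
    using kchains_disjoint_zero[OF slab_low_high kboundary_in_kchains[OF e(2)] kboundary_in_kchains[OF e(3)]] by blast
  ultimately have "e\<^sub>1 \<in> kcycles n (part high)" using e(3) by (simp add: kcycles_def)
  then have ec: "?e \<in> kcycles n X" by (rule kcycles_map) (simp add: continuous_map_base)
  have "kchain_map n base (kboundary (Suc n) a) \<in> kbounds n X"
    by (intro kbounds_map[OF kboundary_kchains[OF ab(1)]] continuous_map_base) auto
  moreover have "kchain_map n base (kboundary (Suc n) a) = c - (kchain_map n base e\<^sub>0 + ?e)"
  proof -
    have "kboundary (Suc n) a = slice n (1/2) c - (e\<^sub>0 + e\<^sub>1)" using e(1) by (simp add: algebra_simps)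
    then show ?thesis by (simp add: kchain_map_diff kchain_map_linear base_slice[OF kcycles_chains[OF c]])
  qed
  moreover have "kchain_map n collapse (kboundary (Suc n) b) \<in> kbounds n X"
    by (intro kbounds_map[OF kboundary_kchains[OF ab(2)]] continuous_map_collapse)
  moreover have "kchain_map n collapse (kboundary (Suc n) b) = kchain_map n base e\<^sub>0 + kchain_map n f ?e"
    by (simp add: b_e kchain_map_linear collapse_low[OF e(2)] collapse_high[OF e(3)])
  ultimately have "(c - (kchain_map n base e\<^sub>0 + ?e)) + (kchain_map n base e\<^sub>0 + kchain_map n f ?e) \<in> kbounds n X"
    by (simp only: kbounds_closed(2))
  then have "c - (?e - kchain_map n f ?e) \<in> kbounds n X" by (simp add: algebra_simps)
  then show ?thesis using that ec by blast
qed

text \<open>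
  Move the copy of \<open>e\<close> from height \<open>1/2\<close> up to height 1, where it becomes the copy of \<open>f(e)\<close> at height 0, and then
  move that up to height \<open>1/2\<close>.
\<close>

lemma slice_bounds:
  assumes e: "e \<in> kcycles n X" shows "slice n (1/2) (e - kchain_map n f e) \<in> kbounds n torus"
proof -
  have fe: "kchain_map n f e \<in> kcycles n X" by (rule kcycles_map[OF e f_cont])
  have "slice n (1/2) e - slice n 1 e \<in> kbounds n torus"
    by (rule slices_homologous_torus[OF _ _ e]) auto
  moreover have "slice n 0 (kchain_map n f e) - slice n (1/2) (kchain_map n f e) \<in> kbounds n torus"
    by (rule slices_homologous_torus[OF _ _ fe]) auto
  ultimately have "(slice n (1/2) e - slice n 1 e) + (slice n 0 (kchain_map n f e) - slice n (1/2) (kchain_map n f e)) \<in> kbounds n torus"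
    by (rule kbounds_closed(2))
  then show ?thesis by (simp add: slice_1[OF kcycles_chains[OF e]] kchain_map_diff)
qed

end

section \<open>Homology classes\<close>

abbreviation hclass :: "'k::field itself \<Rightarrow> nat \<Rightarrow> 'a topology \<Rightarrow> ('k, 'a) kchain \<Rightarrow> ('k, 'a) kchain set"
  where "hclass K n X c \<equiv> boundaries K n X +>\<^bsub>cycle_space K n X\<^esub> c"

lemma carrier_homology: "carrier (homology K n X) = hclass K n X ` kcycles n X"
  using homology_simps(1)[of K n X] by (simp add: carrier_cycle_space)

lemma zero_homology: "\<zero>\<^bsub>homology K n X\<^esub> = hclass K n X 0"
  using homology_simps(2)[of K n X] by simp

lemma add_homology:
  "\<lbrakk>x \<in> kcycles n X; y \<in> kcycles n X\<rbrakk> \<Longrightarrow> hclass K n X x \<oplus>\<^bsub>homology K n X\<^esub> hclass K n X y = hclass K n X (x + y)"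
  using homology_simps(3)[of x K n X y] by (simp add: carrier_cycle_space)

lemma smult_homology:
  fixes K :: "'k::field itself"
  shows "x \<in> kcycles n X \<Longrightarrow> a \<odot>\<^bsub>homology K n X\<^esub> hclass K n X x = hclass K n X (kscale a x)"
  using homology_simps(4)[of a x K n X] by (simp add: carrier_cycle_space)

lemma mem_hclass_iff: "x \<in> hclass K n X y \<longleftrightarrow> x - y \<in> kbounds n X"
proof
  assume "x \<in> hclass K n X y"
  then obtain b where "b \<in> kbounds n X" "x = b + y" by (auto simp: a_r_coset_def' boundaries_eq_kbounds)
  then show "x - y \<in> kbounds n X" by simp
next
  assume "x - y \<in> kbounds n X"
  then show "x \<in> hclass K n X y"
    by (auto simp: a_r_coset_def' boundaries_eq_kbounds intro!: bexI[of _ "x - y"])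
qed

lemma hclass_eq_iff:
  assumes x: "x \<in> kcycles n X" and y: "y \<in> kcycles n X"
  shows "hclass K n X x = hclass K n X y \<longleftrightarrow> x - y \<in> kbounds n X"
proof -
  interpret B: abelian_subgroup "boundaries K n X" "cycle_space K n X"
    by (rule submodule_abelian_subgroup[OF vectorspace_cycle_space submodule_boundaries])
  show ?thesis
  proof
    assume "hclass K n X x = hclass K n X y"
    then show "x - y \<in> kbounds n X" using B.a_rcos_self[of x] x by (simp add: carrier_cycle_space mem_hclass_iff)
  next
    assume "x - y \<in> kbounds n X"
    then have "x \<in> hclass K n X y" by (simp only: mem_hclass_iff)
    then show "hclass K n X x = hclass K n X y"
      using B.a_repr_independence'[of x y] y by (simp add: carrier_cycle_space)
  qed
qed

lemma hclass_eq_zero_iff: "x \<in> kcycles n X \<Longrightarrow> hclass K n X x = \<zero>\<^bsub>homology K n X\<^esub> \<longleftrightarrow> x \<in> kbounds n X"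
  using hclass_eq_iff[of x n X 0 K] by (simp add: zero_homology kcycles_closed)

lemma id_minus_induced_hclass:
  fixes K :: "'k::field itself"
  assumes f: "continuous_map X X f" and c: "c \<in> kcycles n X"
  shows "id_minus_induced K n X f (hclass K n X c) = hclass K n X (c - kchain_map n f c)"
proof -
  interpret H: vectorspace "class_ring :: 'k ring" "homology K n X" by (rule vectorspace_homology)
  have fc: "kchain_map n f c \<in> kcycles n X" by (rule kcycles_map[OF c f])
  have "\<ominus>\<^bsub>homology K n X\<^esub> hclass K n X (kchain_map n f c) = hclass K n X (- kchain_map n f c)"
    by (rule H.M.minus_equality)
      (use fc in \<open>auto simp: add_homology zero_homology kcycles_closed carrier_homology\<close>)
  then show ?thesis
    unfolding id_minus_induced_def a_minus_def
    using induced_map_coset[of c K n X X f] f c fc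
    by (simp add: carrier_cycle_space add_homology kcycles_closed)
qed

text \<open>
  The spanning set is first exchanged for one that consists of cycles, whose classes then generate the
  homology.
\<close>

lemma homology_fin_dim:
  fixes K :: "'k::field itself"
  assumes "betti_le K m n X"
  shows "vectorspace.fin_dim class_ring (homology K n X)" and "betti K n X \<le> m"
proof -
  interpret H: vectorspace "class_ring :: 'k ring" "homology K n X" by (rule vectorspace_homology)
  obtain S0 :: "('k, 'a) kchain set" where S0: "finite S0" "card S0 \<le> m" "kcycles n X \<subseteq> kv.span (kbounds n X \<union> S0)"
    using assms unfolding betti_le_def by blast
  then obtain S :: "('k, 'a) kchain set" where S: "S \<subseteq> kcycles n X" "finite S" "card S \<le> card S0" "kcycles n X \<subseteq> kv.span (kbounds n X \<union> S)"
    using kv.subspace_spanning_subset[OF S0(1) subspace_kcycles S0(3)] by blast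
  define G where "G = hclass K n X ` S"
  have G: "G \<subseteq> carrier (homology K n X)" using S(1) by (auto simp: G_def carrier_homology)
  interpret sp: submodule "class_ring :: 'k ring" "H.span G" "homology K n X"
    by (rule H.span_is_submodule[OF G])
  have lin: "hclass K n X (\<Sum>s\<in>F. kscale (u s) s) \<in> H.span G" if "F \<subseteq> S" for F u
    using finite_subset[OF that S(2)] that
  proof (induction F rule: finite_induct)
    case empty
    then show ?case using sp.zero_closed by (simp add: zero_homology)
  next
    case (insert s F)
    have s: "s \<in> kcycles n X" using insert.prems S(1) by blast
    have F: "(\<Sum>s\<in>F. kscale (u s) s) \<in> kcycles n X"
      using insert.prems S(1) by (intro kv.subspace_sum[OF subspace_kcycles] kcycles_closed) auto
    have "hclass K n X s \<in> G" using insert.prems by (simp add: G_def)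
    then have "hclass K n X s \<in> H.span G" by (rule subsetD[OF H.in_own_span[OF G]])
    then have "u s \<odot>\<^bsub>homology K n X\<^esub> hclass K n X s \<in> H.span G" by (intro sp.smult_closed) simp_all
    then have 1: "hclass K n X (kscale (u s) s) \<in> H.span G" by (simp only: smult_homology[OF s])
    have 2: "hclass K n X (\<Sum>s\<in>F. kscale (u s) s) \<in> H.span G" using insert by simp
    have "hclass K n X (kscale (u s) s + (\<Sum>s\<in>F. kscale (u s) s)) \<in> H.span G"
      unfolding add_homology[OF kcycles_closed(5)[OF s] F, symmetric] by (rule sp.m_closed[OF 1 2])
    then show ?case using insert.hyps by simp
  qed
  have "hclass K n X z \<in> H.span G" if z: "z \<in> kcycles n X" for z
  proof -
    have "z \<in> kv.span (kbounds n X \<union> S)" using S(4) z by blast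
    then obtain b e where be: "b \<in> kv.span (kbounds n X)" "e \<in> kv.span S" "z = b + e"
      unfolding kv.span_Un by blast
    have b: "b \<in> kbounds n X" using be(1) by (simp add: kv.span_eq_iff[THEN iffD2, OF subspace_kbounds])
    obtain u where u: "e = (\<Sum>s\<in>S. kscale (u s) s)"
      using be(2) unfolding kv.span_finite[OF S(2)] by blast
    have e: "e \<in> kcycles n X"
      unfolding u using S(1) by (intro kv.subspace_sum[OF subspace_kcycles] kcycles_closed) auto
    have "hclass K n X z = hclass K n X e" unfolding hclass_eq_iff[OF z e] using b be(3) by simp
    also have "\<dots> \<in> H.span G" unfolding u by (rule lin) simp
    finally show ?thesis .
  qed
  then have gen: "H.gen_set G"
    using sp.subset by (auto simp: carrier_homology)
  have fin: "finite G" using S(2) by (simp add: G_def)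
  show "H.fin_dim" unfolding H.fin_dim_def by (intro exI[of _ G] conjI fin G gen)
  have "H.dim \<le> card G" by (rule H.gen_ge_dim[OF fin G gen])
  also have "card G \<le> m" using card_image_le[OF S(2), of "hclass K n X"] S(3) S0(2) by (simp add: G_def)
  finally show "betti K n X \<le> m" by (simp add: betti_def)
qed

lemma finite_type_imp_finite_total_homology:
  assumes "finite_type K X" shows "finite_total_homology K X"
proof -
  obtain b where b: "\<And>n. betti_le K (b n) n X" "finite {n. b n \<noteq> 0}"
    using assms unfolding finite_type_def by blast
  have "{n. betti K n X \<noteq> 0} \<subseteq> {n. b n \<noteq> 0}"
  proof
    fix n assume "n \<in> {n. betti K n X \<noteq> 0}"
    then show "n \<in> {n. b n \<noteq> 0}" using homology_fin_dim(2)[OF b(1)[of n]] by simp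
  qed
  then show ?thesis
    unfolding finite_total_homology_def using homology_fin_dim(1)[OF b(1)] finite_subset[OF _ b(2)] by simp
qed

section \<open>The exact sequence of the mapping torus\<close>

context self_map
begin

lemma continuous_map_half: "continuous_map X torus (\<lambda>x. q (x, 1/2))"
  by (rule continuous_map_slice_torus) auto

text \<open>
  The homology of the torus is an extension of a subspace of \<open>H\<^sub>m(X)\<close>, where \<open>m = n - 1\<close>, by a quotient of \<open>H\<^sub>n(X)\<close>. Rank
  and nullity of the connecting map may be added only once this bound is known.
\<close>

lemma betti_le_torus:
  fixes K :: "'k::field itself"
  assumes b: "betti_le K m n X" and b': "betti_le K m' (n - 1) X"
  shows "betti_le K (m + m') n torus"
proof -
  obtain S :: "('k, 'a) kchain set" where S: "finite S" "card S \<le> m" "kcycles n X \<subseteq> kv.span (kbounds n X \<union> S)"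
    using b unfolding betti_le_def by blast
  obtain S' :: "('k, 'a) kchain set" where S': "finite S'" "card S' \<le> m'"
    "kcycles (n - 1) X \<subseteq> kv.span (kbounds (n - 1) X \<union> S')"
    using b' unfolding betti_le_def by blast
  let ?j = "slice n (1/2) :: ('k, 'a) kchain \<Rightarrow> _"
  let ?W = "kv.span (kbounds n torus \<union> ?j ` S)"
  have "kv.subspace {c. ?j c \<in> ?W}"
    unfolding kv.subspace_def by (auto simp: kchain_map_linear kv.span_add kv.span_scale kv.span_zero)
  then have "kv.span (kbounds n X \<union> S) \<subseteq> {c. ?j c \<in> ?W}"
    by (intro kv.span_minimal) (auto intro: kv.span_base kbounds_map[OF _ continuous_map_half])
  then have j: "?j c \<in> ?W" if "c \<in> kcycles n X" for c using that S(3) by blast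
  have "\<exists>S''. finite S'' \<and> card S'' \<le> card S' \<and>
      (kcycles n torus :: ('k, ('a \<times> real) set) kchain set) \<subseteq> kv.span ((kbounds n torus \<union> ?j ` S) \<union> S'')"
  proof (rule kspan_lift[where R = "connecting n" and B = "kbounds (n - 1) X"])
    show "connecting n 0 (0 :: ('k, 'a) kchain)"
      using connecting_slice[OF kcycles_closed(1), of n] by (simp add: kchain_map_linear)
    show "w \<in> kv.span (kbounds (n - 1) X \<union> S')" if "connecting n z w" for z and w :: "('k, 'a) kchain"
      using connecting_cycle[OF that] S'(3) by blast
    show "z \<in> ?W" if zw: "connecting n z w" "w \<in> kv.span (kbounds (n - 1) X)" for z and w :: "('k, 'a) kchain"
    proof -
      have "w \<in> kbounds (n - 1) X"
        using zw(2) by (simp add: kv.span_eq_iff[THEN iffD2, OF subspace_kbounds])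
      then obtain c where c: "c \<in> kcycles n X" "z - ?j c \<in> kbounds n torus"
        using connecting_kernel[OF zw(1)] by blast
      then have "z - ?j c \<in> ?W" by (simp add: kv.span_base)
      from kv.span_add[OF this j[OF c(1)]] show ?thesis by simp
    qed
  qed (erule connecting_add connecting_scale connecting_exists, assumption? | rule S'(1))+
  then obtain S'' where S'': "finite S''" "card S'' \<le> card S'"
    "(kcycles n torus :: ('k, ('a \<times> real) set) kchain set) \<subseteq> kv.span (kbounds n torus \<union> (?j ` S \<union> S''))"
    by (auto simp: Un_assoc)
  have "card (?j ` S \<union> S'') \<le> m + m'"
    using card_Un_le[of "?j ` S" S''] card_image_le[OF S(1), of ?j] S(2) S'(2) S''(2) by linarith
  then show ?thesis
    unfolding betti_le_def using S(1) S'' by (intro exI[of _ "?j ` S \<union> S''"]) simp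
qed

lemma connecting_0:
  assumes "connecting 0 z w" shows "w = 0"
proof -
  obtain u v w\<^sub>0 w\<^sub>1 where "u \<in> kchains 0 (part mid)" "v \<in> kchains 0 (part seam)"
    "z - (u + v) \<in> kbounds 0 torus" "kboundary 0 (u + v) = 0"
    and "w\<^sub>0 \<in> kcycles (0 - 1) (part low)" "w\<^sub>1 \<in> kcycles (0 - 1) (part high)"
    and "kboundary 0 u = w\<^sub>0 + w\<^sub>1" "w = kchain_map (0 - 1) base w\<^sub>1"
    using assms by (rule connectingE)
  then have w: "w\<^sub>0 \<in> kcycles 0 (part low)" "w\<^sub>1 \<in> kcycles 0 (part high)"
    "kboundary 0 u = w\<^sub>0 + w\<^sub>1" "w = kchain_map 0 base w\<^sub>1" by simp_all
  have "w\<^sub>1 + w\<^sub>0 = 0" using w(3) by (simp add: add.commute)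
  moreover have "slab high \<inter> slab low = {}" using slab_low_high by (simp only: inf_commute)
  ultimately have "w\<^sub>1 = 0"
    using kchains_disjoint_zero[OF _ kcycles_chains[OF w(2)] kcycles_chains[OF w(1)]] by blast
  then show ?thesis by (simp add: w(4) kchain_map_linear)
qed

text \<open>
  The union has equal members by \<open>connecting_bounds\<close>, so it picks the class of any admissible \<open>w\<close>.
\<close>

definition connecting_hom ::
    "'k::field itself \<Rightarrow> nat \<Rightarrow> ('k, ('a \<times> real) set) kchain set \<Rightarrow> ('k, 'a) kchain set"
  where "connecting_hom K n C = (\<Union>z\<in>C. \<Union>w\<in>{w. connecting n z w}. hclass K (n - 1) X w)"

lemma connecting_hom_hclass:
  assumes zw: "connecting n z w"
  shows "connecting_hom K n (hclass K n torus z) = hclass K (n - 1) X w"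
proof -
  have "hclass K (n - 1) X w' = hclass K (n - 1) X w"
    if z': "z' \<in> hclass K n torus z" "connecting n z' w'" for z' w'
  proof -
    have "z' - z \<in> kbounds n torus" using z'(1) by (simp only: mem_hclass_iff)
    with connecting_diff[OF z'(2) zw] have "w' - w \<in> kbounds (n - 1) X" by (rule connecting_bounds)
    then show ?thesis by (simp only: hclass_eq_iff[OF connecting_cycle[OF z'(2)] connecting_cycle[OF zw]])
  qed
  note same = this
  have "z \<in> hclass K n torus z" by (simp add: mem_hclass_iff kbounds_closed)
  show ?thesis
    unfolding connecting_hom_def
  proof (rule subset_antisym)
    show "(\<Union>z\<in>hclass K n torus z. \<Union>w\<in>{w. connecting n z w}. hclass K (n - 1) X w) \<subseteq> hclass K (n - 1) X w"
      by (intro UN_least) (simp only: mem_Collect_eq same subset_refl)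
    show "hclass K (n - 1) X w \<subseteq> (\<Union>z\<in>hclass K n torus z. \<Union>w\<in>{w. connecting n z w}. hclass K (n - 1) X w)"
      by (intro subsetI UN_I[OF \<open>z \<in> hclass K n torus z\<close>] UN_I[of w]) (simp_all add: zw)
  qed
qed

lemma torus_classE:
  assumes "C \<in> carrier (homology K n torus)"
  obtains z w where "z \<in> kcycles n torus" "C = hclass K n torus z" "connecting n z w"
proof -
  obtain z where z: "z \<in> kcycles n torus" "C = hclass K n torus z"
    using assms by (auto simp: carrier_homology)
  obtain w where "connecting n z w" using connecting_exists[OF z(1)] by blast
  with z show ?thesis by (rule that)
qed

lemma connecting_hom_linear:
  fixes K :: "'k::field itself"
  shows "connecting_hom K n \<in> module_hom class_ring (homology K n torus) (homology K (n - 1) X)"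
  unfolding module_hom_def
proof (intro CollectI conjI allI impI funcsetI; (elim conjE)?)
  fix C assume "C \<in> carrier (homology K n torus)"
  then obtain z w where zw: "z \<in> kcycles n torus" "C = hclass K n torus z" "connecting n z w"
    by (rule torus_classE)
  have "connecting_hom K n C = hclass K (n - 1) X w"
    by (simp only: zw(2) connecting_hom_hclass[OF zw(3)])
  then show "connecting_hom K n C \<in> carrier (homology K (n - 1) X)"
    using connecting_cycle[OF zw(3)] by (simp add: carrier_homology)
next
  fix C D assume C: "C \<in> carrier (homology K n torus)" and D: "D \<in> carrier (homology K n torus)"
  obtain z w where zw: "z \<in> kcycles n torus" "C = hclass K n torus z" "connecting n z w"
    using C by (rule torus_classE)
  obtain z' w' where zw': "z' \<in> kcycles n torus" "D = hclass K n torus z'" "connecting n z' w'"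
    using D by (rule torus_classE)
  note cw = connecting_cycle[OF zw(3)] connecting_cycle[OF zw'(3)]
  show "connecting_hom K n (C \<oplus>\<^bsub>homology K n torus\<^esub> D) = connecting_hom K n C \<oplus>\<^bsub>homology K (n - 1) X\<^esub> connecting_hom K n D"
    using connecting_hom_hclass[OF connecting_add[OF zw(3) zw'(3)], of K]
    by (simp only: zw(2) zw'(2) add_homology[OF zw(1) zw'(1)] add_homology[OF cw]
        connecting_hom_hclass[OF zw(3)] connecting_hom_hclass[OF zw'(3)])
next
  fix a :: 'k and C assume "C \<in> carrier (homology K n torus)"
  then obtain z w where zw: "z \<in> kcycles n torus" "C = hclass K n torus z" "connecting n z w"
    by (rule torus_classE)
  show "connecting_hom K n (a \<odot>\<^bsub>homology K n torus\<^esub> C) = a \<odot>\<^bsub>homology K (n - 1) X\<^esub> connecting_hom K n C"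
    using connecting_hom_hclass[OF connecting_scale[OF zw(3)], of K]
    by (simp only: zw(2) smult_homology[OF zw(1)] smult_homology[OF connecting_cycle[OF zw(3)]] connecting_hom_hclass[OF zw(3)])
qed

lemma induced_half_hclass:
  "c \<in> kcycles n X \<Longrightarrow> induced_map K n torus (\<lambda>x. q (x, 1/2)) (hclass K n X c) = hclass K n torus (slice n (1/2) c)"
  by (rule induced_map_coset[OF _ continuous_map_half]) (simp add: carrier_cycle_space)

lemma exact_at_base:
  "{C \<in> carrier (homology K n X). induced_map K n torus (\<lambda>x. q (x, 1/2)) C = \<zero>\<^bsub>homology K n torus\<^esub>}
    = id_minus_induced K n X f ` carrier (homology K n X)" (is "?L = ?R")
proof
  show "?L \<subseteq> ?R"
  proof
    fix C assume "C \<in> ?L"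
    then obtain c where c: "c \<in> kcycles n X" "C = hclass K n X c"
      and "hclass K n torus (slice n (1/2) c) = \<zero>\<^bsub>homology K n torus\<^esub>"
      by (auto simp: carrier_homology induced_half_hclass)
    then have "slice n (1/2) c \<in> kbounds n torus"
      using kcycles_map[OF c(1) continuous_map_half] by (simp add: hclass_eq_zero_iff)
    then obtain e where e: "e \<in> kcycles n X" "c - (e - kchain_map n f e) \<in> kbounds n X"
      using slice_bounds_imp[OF c(1)] by blast
    have "e - kchain_map n f e \<in> kcycles n X" by (intro kcycles_closed(3) e(1) kcycles_map[OF e(1) f_cont])
    then have "C = hclass K n X (e - kchain_map n f e)" using hclass_eq_iff[OF c(1)] e(2) c(2) by blast
    then have "C = id_minus_induced K n X f (hclass K n X e)"
      by (simp only: id_minus_induced_hclass[OF f_cont e(1)])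
    then show "C \<in> ?R" using e(1) by (auto simp: carrier_homology)
  qed
  show "?R \<subseteq> ?L"
  proof
    fix C assume "C \<in> ?R"
    then obtain e where e: "e \<in> kcycles n X" "C = hclass K n X (e - kchain_map n f e)"
      by (auto simp: carrier_homology id_minus_induced_hclass[OF f_cont])
    have c: "e - kchain_map n f e \<in> kcycles n X" by (intro kcycles_closed(3) e(1) kcycles_map[OF e(1) f_cont])
    have "hclass K n torus (slice n (1/2) (e - kchain_map n f e)) = \<zero>\<^bsub>homology K n torus\<^esub>"
      using hclass_eq_zero_iff[OF kcycles_map[OF c continuous_map_half]] slice_bounds[OF e(1)] by blast
    then show "C \<in> ?L" using c e(2) by (simp add: induced_half_hclass carrier_homology)
  qed
qed

lemma exact_at_torus:
  "{C \<in> carrier (homology K n torus). connecting_hom K n C = \<zero>\<^bsub>homology K (n - 1) X\<^esub>}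
    = induced_map K n torus (\<lambda>x. q (x, 1/2)) ` carrier (homology K n X)" (is "?L = ?R")
proof
  show "?L \<subseteq> ?R"
  proof
    fix C assume C: "C \<in> ?L"
    then obtain z where z: "z \<in> kcycles n torus" "C = hclass K n torus z" by (auto simp: carrier_homology)
    obtain w where w: "connecting n z w" using connecting_exists[OF z(1)] by blast
    have "hclass K (n - 1) X w = \<zero>\<^bsub>homology K (n - 1) X\<^esub>"
      using C z(2) connecting_hom_hclass[OF w, of K] by simp
    then have "w \<in> kbounds (n - 1) X" using hclass_eq_zero_iff[OF connecting_cycle[OF w]] by blast
    then obtain c where c: "c \<in> kcycles n X" "z - slice n (1/2) c \<in> kbounds n torus"
      using connecting_kernel[OF w] by blast
    then have "C = hclass K n torus (slice n (1/2) c)"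
      using hclass_eq_iff[OF z(1) kcycles_map[OF c(1) continuous_map_half]] z(2) by blast
    then have "C = induced_map K n torus (\<lambda>x. q (x, 1/2)) (hclass K n X c)"
      by (simp only: induced_half_hclass[OF c(1)])
    then show "C \<in> ?R" using c(1) by (auto simp: carrier_homology)
  qed
  show "?R \<subseteq> ?L"
  proof
    fix C assume "C \<in> ?R"
    then obtain c where c: "c \<in> kcycles n X" "C = hclass K n torus (slice n (1/2) c)"
      by (auto simp: carrier_homology induced_half_hclass)
    have s: "slice n (1/2) c \<in> kcycles n torus" by (rule kcycles_map[OF c(1) continuous_map_half])
    have "connecting_hom K n C = hclass K (n - 1) X 0"
      unfolding c(2) by (rule connecting_hom_hclass[OF connecting_slice[OF c(1)]])
    then show "C \<in> ?L" using s c(2) by (simp add: carrier_homology zero_homology)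
  qed
qed

lemma exact_at_fibre:
  "connecting_hom K (Suc m) ` carrier (homology K (Suc m) torus)
    = {C \<in> carrier (homology K m X). id_minus_induced K m X f C = \<zero>\<^bsub>homology K m X\<^esub>}" (is "?L = ?R")
proof
  have inv_iff: "id_minus_induced K m X f (hclass K m X w) = \<zero>\<^bsub>homology K m X\<^esub> \<longleftrightarrow> w - kchain_map m f w \<in> kbounds m X"
    if w: "w \<in> kcycles m X" for w
    using hclass_eq_zero_iff[OF kcycles_closed(3)[OF w kcycles_map[OF w f_cont]], of K]
    by (simp only: id_minus_induced_hclass[OF f_cont w])
  show "?L \<subseteq> ?R"
  proof
    fix C assume "C \<in> ?L"
    then obtain z where z: "z \<in> kcycles (Suc m) torus" "C = connecting_hom K (Suc m) (hclass K (Suc m) torus z)"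
      by (auto simp: carrier_homology)
    obtain w where w: "connecting (Suc m) z w" using connecting_exists[OF z(1)] by blast
    have "C = hclass K m X w" "w \<in> kcycles m X" "w - kchain_map m f w \<in> kbounds m X"
      using connecting_hom_hclass[OF w, of K] z(2) connecting_cycle[OF w] connecting_invariant[OF w] by simp_all
    then show "C \<in> ?R" by (simp add: inv_iff carrier_homology)
  qed
  show "?R \<subseteq> ?L"
  proof
    fix C assume "C \<in> ?R"
    then obtain c where c: "c \<in> kcycles m X" "C = hclass K m X c" "c - kchain_map m f c \<in> kbounds m X"
      by (auto simp: carrier_homology inv_iff)
    then obtain z where z: "z \<in> kcycles (Suc m) torus" "connecting (Suc m) z c" using connecting_onto by blast
    then have "C = connecting_hom K (Suc m) (hclass K (Suc m) torus z)"
      using connecting_hom_hclass[OF z(2), of K] c(2) by simp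
    then show "C \<in> ?L" using z(1) by (auto simp: carrier_homology)
  qed
qed

text \<open>
  By exactness the image is the cokernel of \<open>1 - f\<^sub>*\<close>, which has the same dimension as its kernel.
\<close>

lemma rank_induced_half:
  fixes K :: "'k::field itself"
  assumes fd: "vectorspace.fin_dim class_ring (homology K n X)"
  shows "vectorspace.dim class_ring ((homology K n torus)\<lparr>carrier :=
    induced_map K n torus (\<lambda>x. q (x, 1/2)) ` carrier (homology K n X)\<rparr>) = nu K n X f"
proof -
  interpret H: vectorspace "class_ring :: 'k ring" "homology K n X" by (rule vectorspace_homology)
  interpret HT: vectorspace "class_ring :: 'k ring" "homology K n torus" by (rule vectorspace_homology)
  interpret J: linear_map "class_ring :: 'k ring" "homology K n X" "homology K n torus"
    "induced_map K n torus (\<lambda>x. q (x, 1/2))"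
    by (intro linear_map.intro mod_hom.intro mod_hom_axioms.intro H.module_axioms H.vectorspace_axioms
        HT.module_axioms HT.vectorspace_axioms induced_map_linear continuous_map_half)
  show ?thesis
    using J.rank_nullity[OF fd] rank_nullity_id_minus[OF fd f_cont]
    by (simp add: J.im_def J.ker_def exact_at_base rank_id_minus_def betti_def)
qed

text \<open>
  In degree 0 the connecting map vanishes, as boundaries of 0-chains are 0; the homology of the torus is
  just the cokernel.
\<close>

lemma betti_torus_0:
  fixes K :: "'k::field itself"
  assumes fd: "vectorspace.fin_dim class_ring (homology K 0 X)"
  shows "betti K 0 torus = nu K 0 X f"
proof -
  have "connecting_hom K 0 C = \<zero>\<^bsub>homology K (0 - 1) X\<^esub>" if C: "C \<in> carrier (homology K 0 torus)" for C
  proof -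
    obtain z w where z: "z \<in> kcycles 0 torus" "C = hclass K 0 torus z" and w: "connecting 0 z w"
      using C by (rule torus_classE)
    show ?thesis
      using connecting_hom_hclass[OF w, of K] connecting_0[OF w] by (simp add: z(2) zero_homology)
  qed
  then have "{C \<in> carrier (homology K 0 torus). connecting_hom K 0 C = \<zero>\<^bsub>homology K (0 - 1) X\<^esub>}
      = carrier (homology K 0 torus)" by blast
  then have "induced_map K 0 torus (\<lambda>x. q (x, 1/2)) ` carrier (homology K 0 X) = carrier (homology K 0 torus)"
    by (simp only: exact_at_torus)
  then show ?thesis
    using rank_induced_half[OF fd] by (simp add: betti_def)
qed

lemma betti_torus_Suc:
  fixes K :: "'k::field itself"
  assumes fd: "vectorspace.fin_dim class_ring (homology K (Suc m) X)"
    and fdT: "vectorspace.fin_dim class_ring (homology K (Suc m) torus)"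
  shows "betti K (Suc m) torus = nu K (Suc m) X f + nu K m X f"
proof -
  interpret HT: vectorspace "class_ring :: 'k ring" "homology K (Suc m) torus" by (rule vectorspace_homology)
  interpret H: vectorspace "class_ring :: 'k ring" "homology K m X" by (rule vectorspace_homology)
  interpret D: linear_map "class_ring :: 'k ring" "homology K (Suc m) torus" "homology K m X" "connecting_hom K (Suc m)"
    by (intro linear_map.intro mod_hom.intro mod_hom_axioms.intro H.module_axioms H.vectorspace_axioms
        HT.module_axioms HT.vectorspace_axioms connecting_hom_linear[of K "Suc m", unfolded diff_Suc_1])
  have "D.im = a_kernel (homology K m X) (homology K m X) (id_minus_induced K m X f)"
    by (simp add: D.im_def exact_at_fibre a_kernel_def kernel_def)
  moreover have "D.ker = induced_map K (Suc m) torus (\<lambda>x. q (x, 1/2)) ` carrier (homology K (Suc m) X)"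
    using exact_at_torus[of K "Suc m"] by (simp only: D.ker_def diff_Suc_1)
  ultimately show ?thesis
    using D.rank_nullity[OF fdT] rank_induced_half[OF fd] by (simp only: nu_def[of K m] betti_def add.commute)
qed

theorem poincare_poly_torus:
  assumes ft: "finite_type K X"
  shows "finite_total_homology K torus"
    and "poincare_poly K torus = [:1, 1:] * fixed_poly K X f"
proof -
  have X: "finite_total_homology K X" by (rule finite_type_imp_finite_total_homology[OF ft])
  then have fd: "vectorspace.fin_dim class_ring (homology K n X)" for n
    by (simp add: finite_total_homology_def)
  obtain b where b: "\<And>n. betti_le K (b n) n X" using ft unfolding finite_type_def by blast
  have fdT: "vectorspace.fin_dim class_ring (homology K n torus)" for n
    by (rule homology_fin_dim(1)[OF betti_le_torus[OF b b]])
  have "{n. nu K n X f \<noteq> 0} \<subseteq> {n. betti K n X \<noteq> 0}"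
    
  proof
    fix n assume "n \<in> {n. nu K n X f \<noteq> 0}"
    then show "n \<in> {n. betti K n X \<noteq> 0}" using rank_nullity_id_minus[OF fd f_cont, of n] by simp
  qed
  then have fin: "finite {n. nu K n X f \<noteq> 0}"
    using X finite_subset unfolding finite_total_homology_def by blast
  have "{n. betti K n torus \<noteq> 0} \<subseteq> {n. nu K n X f \<noteq> 0} \<union> Suc ` {n. nu K n X f \<noteq> 0}"
  proof
    fix n assume "n \<in> {n. betti K n torus \<noteq> 0}"
    then show "n \<in> {n. nu K n X f \<noteq> 0} \<union> Suc ` {n. nu K n X f \<noteq> 0}"
      using betti_torus_0[OF fd] betti_torus_Suc[OF fd fdT] by (cases n) auto
  qed
  then have finT: "finite {n. betti K n torus \<noteq> 0}"
    using fin by (meson finite_UnI finite_imageI finite_subset)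
  show "finite_total_homology K torus"
    unfolding finite_total_homology_def using fdT finT by blast
  show "poincare_poly K torus = [:1, 1:] * fixed_poly K X f"
  proof (rule poly_eqI)
    fix n
    have F: "coeff (fixed_poly K X f) n = int (nu K n X f)" for n
      unfolding fixed_poly_def by (rule coeff_sum_support[OF fin])
    have "coeff (poincare_poly K torus) n = int (betti K n torus)"
      unfolding poincare_poly_def by (rule coeff_sum_support[OF finT])
    then show "coeff (poincare_poly K torus) n = coeff ([:1, 1:] * fixed_poly K X f) n"
      using betti_torus_0[OF fd] betti_torus_Suc[OF fd fdT] by (cases n) (simp_all add: F)
  qed
qed

end

theorem theorem10p2:
  fixes X :: "'a topology" and I :: "'i set" and d :: "'i \<Rightarrow> nat"
    and \<phi> :: "'i \<Rightarrow> (nat \<Rightarrow> real) \<Rightarrow> 'a" and f :: "'a \<Rightarrow> 'a"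
  assumes "finite_cw_complex X I d \<phi>"
    and "cellular_self_map X I d \<phi> f"
  shows "finite_total_homology TYPE('k::field) X \<and>
    finite_total_homology TYPE('k) (mapping_torus X f) \<and>
    poincare_poly TYPE('k) (mapping_torus X f) = [:1, 1:] * fixed_poly TYPE('k) X f \<and>
    [:1, 1:] * poincare_poly TYPE('k) X - poincare_poly TYPE('k) (mapping_torus X f)
      = [:1, 1:] * delta_poly TYPE('k) X f"
proof -
  interpret cw: finite_cw_complex X I d \<phi> by (rule assms(1))
  interpret self_map X f
    using assms(2) by unfold_locales (simp add: cellular_self_map_def)
  have ft: "finite_type TYPE('k) X" by (rule cw.finite_type_cw)
  show ?thesis
    using finite_type_imp_finite_total_homology[OF ft] poincare_poly_torus[OF ft]
    by (simp add: delta_poly_def algebra_simps)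
qed

end
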